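(* Let $M$ be a regular analytic surface in the Minkowski space $\mathbb R^3_1$ and let ${\rm p}_0\in M$ be an umbilic point. Then there exists a $1$-parameter family of analytic surfaces $M_t$ with $M_0=M$ (locally at ${\rm p}_0$) such that all the umbilic points of $M_t$ near ${\rm p}_0$ have multiplicity $1$ for all $t\neq 0$ small enough.
   Context: $\mathbb R^3_1$ is $\mathbb R^3$ with the pseudo-scalar product $\langle u,v\rangle=u_0v_0+u_1v_1-u_2v_2$; $\langle u\times v,w\rangle=\det(u,v,w)$. For a local parametrisation $\mathbf x(u,v)$ of a regular surface, put $E=\langle \mathbf x_u,\mathbf x_u\rangle$, $F=\langle \mathbf x_u,\mathbf x_v\rangle$, $G=\langle \mathbf x_v,\mathbf x_v\rangle$, $\bar l=\langle \mathbf x_u\times \mathbf x_v,\mathbf x_{uu}\rangle$, $\bar m=\langle \mathbf x_u\times \mathbf x_v,\mathbf x_{uv}\rangle$, $\bar n=\langle \mathbf x_u\times \mathbf x_v,\mathbf x_{vv}\rangle$, $\mathfrak a=F\bar n-G\bar m$, $\mathfrak b=E\bar n-G\bar l$, $\mathfrak c=E\bar m-F\bar l$. A point ${\rm p}=\mathbf x(q)$ is an umbilic point if $\mathfrak a(q)=\mathfrak b(q)=\mathfrak c(q)=0$ (the induced metric at ${\rm p}$ may be Riemannian, Lorentzian or degenerate). Multiplicity: with $\mathcal O_2$ the ring of germs (at $q$) of holomorphic functions in two variables and $m(h,k)=\dim_{\mathbb C}\mathcal O_2/\langle h,k\rangle$ (real analytic germs complexified), $m_u({\rm p})=m(\mathfrak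 b,\mathfrak c)$ if $E(q)\neq0$, $m(\mathfrak a,\mathfrak c)$ if $F(q)\ne 0$, $m(\mathfrak a,\mathfrak b)$ if $G(q)\neq 0$ (at least one of these holds). The statement is local: a $1$-parameter family $M_t$ with $M_0=M$ is a local deformation of $M$, given by parametrisations $\mathbf x_t:U\to\mathbb R^3_1$, analytic for each $t$ near $0$, depending smoothly on $(u,v,t)$, with $\mathbf x_0=\mathbf x$ a parametrisation of $M$ near ${\rm p}_0$. "Near ${\rm p}_0$ for all $t\ne0$ small enough" means: in some fixed neighbourhood of ${\rm p}_0$ and for all $0<|t|<\varepsilon$, for some $\varepsilon>0$. *)

theory Defs
  imports
    "HOL-Analysis.Analysis"
    "HOL-Algebra.Embedded_Algebras"
    "HOL-Algebra.QuotRing"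
begin

section \<open>Minkowski 3-space\<close>

text \<open>The coordinates \<open>u\<^sub>0, u\<^sub>1, u\<^sub>2\<close> are the components \<open>u $ 1, u $ 2, u $ 3\<close>.\<close>

definition mink :: "real^3 \<Rightarrow> real^3 \<Rightarrow> real" where
  "mink u v = u$1 * v$1 + u$2 * v$2 - u$3 * v$3"

text \<open>The Minkowski vector product is the Euclidean one with the timelike component negated;
  it is characterised by \<open>mink_mcross\<close> and \<open>mcross_unique\<close>.\<close>

definition mcross :: "real^3 \<Rightarrow> real^3 \<Rightarrow> real^3" where
  "mcross u v = vector [cross3 u v $ 1, cross3 u v $ 2, - (cross3 u v $ 3)]"

lemma mink_mcross: "mink (mcross u v) w = det (vector [u, v, w])"
  by (simp add: mink_def mcross_def cross3_def det_3 algebra_simps)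

lemma mcross_unique:
  assumes "\<And>w. mink z w = det (vector [u, v, w])"
  shows "z = mcross u v"
proof -
  have eq: "mink z w = mink (mcross u v) w" for w
    by (simp add: assms mink_mcross)
  have "z $ 1 = mcross u v $ 1" "z $ 2 = mcross u v $ 2" "z $ 3 = mcross u v $ 3"
    using eq[of "vector [1, 0, 0]"] eq[of "vector [0, 1, 0]"] eq[of "vector [0, 0, 1]"]
    by (simp_all add: mink_def)
  then show ?thesis
    by (simp add: vec_eq_iff forall_3)
qed


section \<open>Analytic and smooth maps\<close>

text \<open>Over \<open>real\<close> this is real analyticity at a point. Over \<open>complex\<close> it is holomorphy of a
  function of two variables in a neighbourhood of the point (expandability in a power series).\<close>

definition analytic2_at :: "('a \<times> 'a \<Rightarrow> 'a::real_normed_field) \<Rightarrow> 'a \<times> 'a \<Rightarrow> bool" where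
  "analytic2_at f p \<longleftrightarrow>
     (\<exists>c :: nat \<Rightarrow> nat \<Rightarrow> 'a. \<forall>\<^sub>F z in nhds p.
        ((\<lambda>(i, j). c i j * (fst z - fst p)^i * (snd z - snd p)^j) has_sum f z) UNIV)"

primrec Ck_on :: "nat \<Rightarrow> ('a::real_normed_vector \<Rightarrow> 'b::real_normed_vector) \<Rightarrow> 'a set \<Rightarrow> bool" where
  "Ck_on 0 f S \<longleftrightarrow> continuous_on S f"
| "Ck_on (Suc k) f S \<longleftrightarrow>
     (\<forall>p\<in>S. f differentiable (at p)) \<and> (\<forall>v. Ck_on k (\<lambda>p. frechet_derivative f (at p) v) S)"

text \<open>To be used for open \<open>S\<close> in a finite-dimensional space.\<close>

definition smooth_on :: "('a::real_normed_vector \<Rightarrow> 'b::real_normed_vector) \<Rightarrow> 'a set \<Rightarrow> bool" where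
  "smooth_on f S \<longleftrightarrow> (\<forall>k. Ck_on k f S)"

definition partial_u :: "(real \<times> real \<Rightarrow> 'b::real_normed_vector) \<Rightarrow> real \<times> real \<Rightarrow> 'b" where
  "partial_u f q = vector_derivative (\<lambda>s. f (s, snd q)) (at (fst q))"

definition partial_v :: "(real \<times> real \<Rightarrow> 'b::real_normed_vector) \<Rightarrow> real \<times> real \<Rightarrow> 'b" where
  "partial_v f q = vector_derivative (\<lambda>s. f (fst q, s)) (at (snd q))"


section \<open>Regular analytic surfaces\<close>

definition analytic_parametrisation :: "(real \<times> real) set \<Rightarrow> (real \<times> real \<Rightarrow> real^3) \<Rightarrow> bool" where
  "analytic_parametrisation U x \<longleftrightarrow>
     open U \<and>
     (\<forall>q\<in>U. \<forall>i. analytic2_at (\<lambda>z. x z $ i) q) \<and>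
     (\<forall>q\<in>U. inj (frechet_derivative x (at q))) \<and>
     (\<exists>y. homeomorphism U (x ` U) x y)"

definition local_parametrisation ::
    "(real^3) set \<Rightarrow> (real \<times> real) set \<Rightarrow> (real \<times> real \<Rightarrow> real^3) \<Rightarrow> bool" where
  "local_parametrisation M U x \<longleftrightarrow>
     analytic_parametrisation U x \<and> openin (top_of_set M) (x ` U)"

definition regular_analytic_surface :: "(real^3) set \<Rightarrow> bool" where
  "regular_analytic_surface M \<longleftrightarrow> (\<forall>p\<in>M. \<exists>U x. local_parametrisation M U x \<and> p \<in> x ` U)"


section \<open>Umbilic points\<close>

definition coeff_E where "coeff_E x q = mink (partial_u x q) (partial_u x q)"
definition coeff_F where "coeff_F x q = mink (partial_u x q) (partial_v x q)"
definition coeff_G where "coeff_G x q = mink (partial_v x q) (partial_v x q)"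

definition coeff_l where
  "coeff_l x q = mink (mcross (partial_u x q) (partial_v x q)) (partial_u (partial_u x) q)"
definition coeff_m where
  "coeff_m x q = mink (mcross (partial_u x q) (partial_v x q)) (partial_v (partial_u x) q)"
definition coeff_n where
  "coeff_n x q = mink (mcross (partial_u x q) (partial_v x q)) (partial_v (partial_v x) q)"

definition coeff_a where "coeff_a x q = coeff_F x q * coeff_n x q - coeff_G x q * coeff_m x q"
definition coeff_b where "coeff_b x q = coeff_E x q * coeff_n x q - coeff_G x q * coeff_l x q"
definition coeff_c where "coeff_c x q = coeff_E x q * coeff_m x q - coeff_F x q * coeff_l x q"

definition umbilic_at :: "(real \<times> real \<Rightarrow> real^3) \<Rightarrow> real \<times> real \<Rightarrow> bool" where
  "umbilic_at x q \<longleftrightarrow> coeff_a x q = 0 \<and> coeff_b x q = 0 \<and> coeff_c x q = 0"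

definition umbilic_point :: "(real^3) set \<Rightarrow> real^3 \<Rightarrow> bool" where
  "umbilic_point M p \<longleftrightarrow>
     (\<exists>U x q. local_parametrisation M U x \<and> q \<in> U \<and> x q = p \<and> umbilic_at x q)"


section \<open>Germs of holomorphic functions in two variables\<close>

definition germ :: "complex \<times> complex \<Rightarrow> (complex \<times> complex \<Rightarrow> complex)
    \<Rightarrow> (complex \<times> complex \<Rightarrow> complex) set" where
  "germ p f = {g. \<forall>\<^sub>F z in nhds p. g z = f z}"

definition O2 :: "complex \<times> complex \<Rightarrow> (complex \<times> complex \<Rightarrow> complex) set ring" where
  "O2 p = \<lparr>carrier = {germ p f |f. analytic2_at f p},
           mult = (\<lambda>A B. {h. \<exists>f\<in>A. \<exists>g\<in>B. \<forall>\<^sub>F z in nhds p. h z = f z * g z}),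
           one = germ p (\<lambda>_. 1),
           zero = germ p (\<lambda>_. 0),
           add = (\<lambda>A B. {h. \<exists>f\<in>A. \<exists>g\<in>B. \<forall>\<^sub>F z in nhds p. h z = f z + g z})\<rparr>"

subsection \<open>The germs form a commutative ring\<close>

lemma has_sum_times_complex:
  fixes F :: "'a \<Rightarrow> complex" and G :: "'b \<Rightarrow> complex"
  assumes "(F has_sum f) A" "(G has_sum g) B"
  shows "((\<lambda>(p, q). F p * G q) has_sum f * g) (A \<times> B)"
proof -
  have absF: "(\<lambda>p. norm (F p)) summable_on A" and absG: "(\<lambda>q. norm (G q)) summable_on B"
    using assms summable_on_iff_abs_summable_on_complex has_sum_imp_summable by blast+
  have "(\<lambda>z. norm (case z of (p, q) \<Rightarrow> F p * G q)) summable_on (A \<times> B)"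
    unfolding Infinite_Sum.abs_summable_on_Sigma_iff
  proof (intro conjI ballI)
    show "(\<lambda>q. norm (case (p, q) of (p, q) \<Rightarrow> F p * G q)) summable_on B" for p
      using summable_on_cmult_right[OF absG, of "norm (F p)"] by (simp add: norm_mult)
    have "(\<lambda>p. norm (norm (F p) * infsum (\<lambda>q. norm (G q)) B)) summable_on A"
      using summable_on_cmult_left[OF absF, of "infsum (\<lambda>q. norm (G q)) B"]
      by (simp add: infsum_nonneg)
    then show "(\<lambda>p. norm (infsum (\<lambda>q. norm (case (p, q) of (p, q) \<Rightarrow> F p * G q)) B)) summable_on A"
      by (simp add: norm_mult infsum_cmult_right')
  qed
  then have "(\<lambda>(p, q). F p * G q) summable_on (A \<times> B)"
    using summable_on_iff_abs_summable_on_complex by blast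
  then obtain s where s: "((\<lambda>(p, q). F p * G q) has_sum s) (A \<times> B)"
    by (auto simp: summable_on_def)
  have "((\<lambda>p. F p * g) has_sum s) A"
    using has_sum_SigmaD[OF s, of "\<lambda>p. F p * g"] has_sum_cmult_right[OF assms(2)] by simp
  moreover have "((\<lambda>p. F p * g) has_sum f * g) A"
    by (rule has_sum_cmult_left[OF assms(1)])
  ultimately have "s = f * g"
    by (rule has_sum_unique)
  with s show ?thesis by simp
qed

lemma has_sum_cauchy2:
  fixes c d :: "nat \<Rightarrow> nat \<Rightarrow> complex"
  assumes "((\<lambda>(i, j). c i j * x^i * y^j) has_sum f) UNIV"
    and "((\<lambda>(i, j). d i j * x^i * y^j) has_sum g) UNIV"
  shows "((\<lambda>(n, m). (\<Sum>(i, j)\<in>{..n} \<times> {..m}. c i j * d (n - i) (m - j)) * x^n * y^m)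
           has_sum f * g) UNIV"
proof -
  define \<phi> :: "(nat \<times> nat) \<times> (nat \<times> nat) \<Rightarrow> (nat \<times> nat) \<times> (nat \<times> nat)"
    where "\<phi> = (\<lambda>((n, m), (i, j)). ((i, j), (n - i, m - j)))"
  define S :: "((nat \<times> nat) \<times> (nat \<times> nat)) set" where "S = (SIGMA p:UNIV. case p of (n, m) \<Rightarrow> {..n} \<times> {..m})"
  have bij: "bij_betw \<phi> S UNIV"
    by (rule bij_betwI[where g = "\<lambda>((i, j), (k, l)). ((i + k, j + l), (i, j))"])
       (auto simp: \<phi>_def S_def)
  define T where "T = (\<lambda>(p, q). (case p of (i, j) \<Rightarrow> c i j * x^i * y^j) * (case q of (i, j) \<Rightarrow> d i j * x^i * y^j))"
  have "(T has_sum f * g) UNIV"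
    using has_sum_times_complex[OF assms] by (simp add: T_def)
  then have *: "((\<lambda>z. T (\<phi> z)) has_sum f * g) S"
    using has_sum_reindex_bij_betw[OF bij] by blast
  show ?thesis
  proof (rule has_sum_SigmaD[OF *[unfolded S_def]])
    fix p :: "nat \<times> nat"
    obtain n m where p: "p = (n, m)" by fastforce
    have "(\<Sum>q\<in>{..n} \<times> {..m}. T (\<phi> (p, q)))
        = (\<Sum>(i, j)\<in>{..n} \<times> {..m}. (c i j * d (n - i) (m - j)) * (x^n * y^m))"
    proof (rule sum.cong)
      fix q assume q: "q \<in> {..n} \<times> {..m}"
      obtain i j where ij: "q = (i, j)" by fastforce
      have "x^n = x^i * x^(n - i)" "y^m = y^j * y^(m - j)"
        using q ij by (simp_all flip: power_add)
      then show "T (\<phi> (p, q)) = (case q of (i, j) \<Rightarrow> (c i j * d (n - i) (m - j)) * (x^n * y^m))"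
        by (simp add: T_def \<phi>_def p ij)
    qed simp
    also have "\<dots> = (\<Sum>(i, j)\<in>{..n} \<times> {..m}. c i j * d (n - i) (m - j)) * x^n * y^m"
      by (simp add: sum_distrib_right case_prod_unfold mult.assoc)
    finally show "((\<lambda>q. T (\<phi> (p, q))) has_sum
        (case p of (n, m) \<Rightarrow> (\<Sum>(i, j)\<in>{..n} \<times> {..m}. c i j * d (n - i) (m - j)) * x^n * y^m))
        (case p of (n, m) \<Rightarrow> {..n} \<times> {..m})"
      using has_sum_finite[of "{..n} \<times> {..m}" "\<lambda>q. T (\<phi> (p, q))"] by (simp add: p)
  qed
qed

lemma analytic2_at_mult:
  fixes f g :: "complex \<times> complex \<Rightarrow> complex"
  assumes "analytic2_at f p" "analytic2_at g p"
  shows "analytic2_at (\<lambda>z. f z * g z) p"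
proof -
  obtain c d where
    c: "\<forall>\<^sub>F z in nhds p. ((\<lambda>(i, j). c i j * (fst z - fst p)^i * (snd z - snd p)^j) has_sum f z) UNIV" and
    d: "\<forall>\<^sub>F z in nhds p. ((\<lambda>(i, j). d i j * (fst z - fst p)^i * (snd z - snd p)^j) has_sum g z) UNIV"
    using assms by (auto simp: analytic2_at_def)
  show ?thesis
    unfolding analytic2_at_def
    by (rule exI[of _ "\<lambda>n m. \<Sum>(i, j)\<in>{..n} \<times> {..m}. c i j * d (n - i) (m - j)"])
       (use c d in eventually_elim, rule has_sum_cauchy2)
qed

lemma analytic2_at_add:
  assumes "analytic2_at f p" "analytic2_at g p"
  shows "analytic2_at (\<lambda>z. f z + g z) p"
proof -
  obtain c d where
    c: "\<forall>\<^sub>F z in nhds p. ((\<lambda>(i, j). c i j * (fst z - fst p)^i * (snd z - snd p)^j) has_sum f z) UNIV" and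
    d: "\<forall>\<^sub>F z in nhds p. ((\<lambda>(i, j). d i j * (fst z - fst p)^i * (snd z - snd p)^j) has_sum g z) UNIV"
    using assms by (auto simp: analytic2_at_def)
  show ?thesis
    unfolding analytic2_at_def
  proof (rule exI[of _ "\<lambda>i j. c i j + d i j"], use c d in eventually_elim)
    case (elim z)
    show ?case
      using has_sum_add[OF elim] by (simp add: case_prod_unfold ring_distribs)
  qed
qed

lemma analytic2_at_const: "analytic2_at (\<lambda>_. a) p"
  unfolding analytic2_at_def
proof (rule exI[of _ "\<lambda>i j. if i = 0 \<and> j = 0 then a else 0"], rule always_eventually, rule allI)
  fix z
  show "((\<lambda>(i, j). (if i = 0 \<and> j = 0 then a else 0) * (fst z - fst p)^i * (snd z - snd p)^j) has_sum a) UNIV"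
    by (rule has_sum_finite_neutralI[where B = "{(0, 0)}"]) (auto split: if_splits)
qed

lemma germ_eq_iff: "germ p f = germ p g \<longleftrightarrow> (\<forall>\<^sub>F z in nhds p. f z = g z)"
proof
  assume "germ p f = germ p g"
  moreover have "f \<in> germ p f" by (simp add: germ_def)
  ultimately show "\<forall>\<^sub>F z in nhds p. f z = g z" by (simp add: germ_def)
next
  assume *: "\<forall>\<^sub>F z in nhds p. f z = g z"
  have "h \<in> germ p f \<longleftrightarrow> h \<in> germ p g" for h
    unfolding germ_def mem_Collect_eq by (rule eventually_subst) (use * in eventually_elim, simp)
  then show "germ p f = germ p g" by blast
qed

lemma germ_lift2:
  "{h. \<exists>f'\<in>germ p f. \<exists>g'\<in>germ p g. \<forall>\<^sub>F z in nhds p. h z = F (f' z) (g' z)}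
     = germ p (\<lambda>z. F (f z) (g z))"
  (is "?L = ?R")
proof
  show "?L \<subseteq> ?R"
  proof
    fix h assume "h \<in> ?L"
    then obtain f' g' where "\<forall>\<^sub>F z in nhds p. f' z = f z" "\<forall>\<^sub>F z in nhds p. g' z = g z"
      "\<forall>\<^sub>F z in nhds p. h z = F (f' z) (g' z)"
      by (auto simp: germ_def)
    then have "\<forall>\<^sub>F z in nhds p. h z = F (f z) (g z)"
      by eventually_elim simp
    then show "h \<in> ?R" by (simp add: germ_def)
  qed
  show "?R \<subseteq> ?L"
  proof
    fix h assume "h \<in> ?R"
    moreover have "f \<in> germ p f" "g \<in> germ p g" by (simp_all add: germ_def)
    ultimately show "h \<in> ?L" unfolding germ_def mem_Collect_eq by blast
  qed
qed

lemma O2_simps: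
  "carrier (O2 p) = {germ p f |f. analytic2_at f p}"
  "\<one>\<^bsub>O2 p\<^esub> = germ p (\<lambda>_. 1)"
  "\<zero>\<^bsub>O2 p\<^esub> = germ p (\<lambda>_. 0)"
  "germ p f \<otimes>\<^bsub>O2 p\<^esub> germ p g = germ p (\<lambda>z. f z * g z)"
  "germ p f \<oplus>\<^bsub>O2 p\<^esub> germ p g = germ p (\<lambda>z. f z + g z)"
  using germ_lift2[of p f g "(*)"] germ_lift2[of p f g "(+)"] by (simp_all add: O2_def)

lemma cring_O2: "cring (O2 p)"
proof (rule cringI)
  show "abelian_group (O2 p)"
  proof (rule abelian_groupI)
    fix A assume "A \<in> carrier (O2 p)"
    then obtain f where f: "A = germ p f" "analytic2_at f p" by (auto simp: O2_simps)
    have "analytic2_at (\<lambda>z. (\<lambda>_. -1) z * f z) p"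
      by (intro analytic2_at_mult analytic2_at_const f)
    then have "germ p (\<lambda>z. - f z) \<in> carrier (O2 p)" by (auto simp: O2_simps)
    moreover have "germ p (\<lambda>z. - f z) \<oplus>\<^bsub>O2 p\<^esub> A = \<zero>\<^bsub>O2 p\<^esub>"
      by (simp add: f O2_simps)
    ultimately show "\<exists>B\<in>carrier (O2 p). B \<oplus>\<^bsub>O2 p\<^esub> A = \<zero>\<^bsub>O2 p\<^esub>" by blast
  qed (auto simp: O2_simps add_ac intro: analytic2_at_add analytic2_at_const)
  show "comm_monoid (O2 p)"
    by (rule comm_monoidI)
       (auto simp: O2_simps mult_ac intro: analytic2_at_mult analytic2_at_const)
qed (auto simp: O2_simps ring_distribs)


subsection \<open>Multiplicity\<close>

text \<open>The copy of \<open>\<complex>\<close> in a quotient of the ring of germs, consisting of the classes of constants.\<close>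

definition constants :: "complex \<times> complex \<Rightarrow> (complex \<times> complex \<Rightarrow> complex) set set
    \<Rightarrow> (complex \<times> complex \<Rightarrow> complex) set set set" where
  "constants p I = range (\<lambda>a. I +>\<^bsub>O2 p\<^esub> germ p (\<lambda>_. a))"

text \<open>\<open>dim\<^sub>\<complex> \<O>\<^sub>2/\<langle>h,k\<rangle>\<close>, which may be infinite, for germs \<open>h\<close> and \<open>k\<close> at \<open>p\<close>.\<close>

definition germ_mult :: "complex \<times> complex \<Rightarrow> (complex \<times> complex \<Rightarrow> complex) set
    \<Rightarrow> (complex \<times> complex \<Rightarrow> complex) set \<Rightarrow> enat" where
  "germ_mult p h k =
     (let I = Idl\<^bsub>O2 p\<^esub> {h, k};
          is_dim = (\<lambda>n. ring.dimension (O2 p Quot I) n (constants p I) (carrier (O2 p Quot I)))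
      in if \<exists>n. is_dim n then enat (THE n. is_dim n) else \<infinity>)"

definition cpoint :: "real \<times> real \<Rightarrow> complex \<times> complex" where
  "cpoint q = (complex_of_real (fst q), complex_of_real (snd q))"

text \<open>The holomorphic extensions near \<open>q\<close> of a function which is real analytic at \<open>q\<close>. By the
  identity theorem any two of them agree near \<open>cpoint q\<close>, so this set is a single germ.\<close>

definition complexification ::
    "(real \<times> real \<Rightarrow> real) \<Rightarrow> real \<times> real \<Rightarrow> (complex \<times> complex \<Rightarrow> complex) set" where
  "complexification h q =
     {H. analytic2_at H (cpoint q) \<and> (\<forall>\<^sub>F z in nhds q. H (cpoint z) = complex_of_real (h z))}"

text \<open>Since \<open>E\<aa> - F\<bb> + G\<cc> = 0\<close> (lemma \<open>coeff_relation\<close>), the prescriptions for \<open>E \<noteq> 0\<close>,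
  \<open>F \<noteq> 0\<close>, \<open>G \<noteq> 0\<close> give the same ideal whenever more than one of them applies, so their order is
  immaterial. At a regular point at least one applies.\<close>

lemma coeff_relation:
  "coeff_E x q * coeff_a x q - coeff_F x q * coeff_b x q + coeff_G x q * coeff_c x q = 0"
  by (simp add: coeff_a_def coeff_b_def coeff_c_def algebra_simps)

definition umbilic_mult :: "(real \<times> real \<Rightarrow> real^3) \<Rightarrow> real \<times> real \<Rightarrow> enat" where
  "umbilic_mult x q =
     (if coeff_E x q \<noteq> 0 then
        germ_mult (cpoint q) (complexification (coeff_b x) q) (complexification (coeff_c x) q)
      else if coeff_F x q \<noteq> 0 then
        germ_mult (cpoint q) (complexification (coeff_a x) q) (complexification (coeff_c x) q)
      else
        germ_mult (cpoint q) (complexification (coeff_a x) q) (complexification (coeff_b x) q))"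


section \<open>Local deformations\<close>

text \<open>\<open>M\<^sub>t\<close> is the surface \<open>x t ` U\<close>.\<close>

definition local_deformation ::
    "(real^3) set \<Rightarrow> real^3 \<Rightarrow> (real \<times> real) set \<Rightarrow> real \<Rightarrow>
     (real \<Rightarrow> real \<times> real \<Rightarrow> real^3) \<Rightarrow> bool" where
  "local_deformation M p U \<delta> x \<longleftrightarrow>
     \<delta> > 0 \<and>
     local_parametrisation M U (x 0) \<and> p \<in> x 0 ` U \<and>
     (\<forall>t. \<bar>t\<bar> < \<delta> \<longrightarrow> analytic_parametrisation U (x t)) \<and>
     smooth_on (\<lambda>(q, t). x t q) (U \<times> {-\<delta><..<\<delta>})"

end

theory Submission
  imports Defs "HOL-Complex_Analysis.Complex_Analysis"
begin

text \<open>Let \<open>\<xi>\<close> be the cross product of \<open>x\<^sub>u\<close> and \<open>x\<^sub>v\<close> at \<open>p\<^sub>0\<close>. Adding \<open>Q \<xi>\<close> to the parametrisation, for a quadratic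
  form \<open>Q\<close> with two free coefficients \<open>\<lambda> = (\<lambda>\<^sub>1, \<lambda>\<^sub>2)\<close>, changes the two functions that define the umbilic
  points submersively in \<open>\<lambda>\<close>. By the implicit function theorem, \<open>q\<close> is therefore an umbilic point of the
  surface with parameter \<open>\<lambda>\<close> iff \<open>\<lambda> = \<Psi> q\<close> for an analytic map \<open>\<Psi>\<close>, and a point at which the two functions
  have dependent differentials is a critical point of \<open>\<Psi>\<close>. It remains to find a direction \<open>w\<close> such that no \<open>t w\<close>
  with small \<open>t \<noteq> 0\<close> is the value of \<open>\<Psi>\<close> at a critical point near \<open>p\<^sub>0\<close>; then the umbilic points of the
  surface with parameter \<open>t w\<close> are transversal zeros, so their multiplicity is \<open>1\<close>. On the zero set of a
  function \<open>D \<noteq> 0\<close>, such as the Jacobian of \<open>\<Psi>\<close>, elimination yields a binary form in the components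
  of \<open>\<Psi>\<close> that vanishes there and whose coefficients do not all vanish at the base point: any \<open>w\<close> at which
  the form at the base point is nonzero will do.\<close>

section \<open>Power series in two variables\<close>

text \<open>Sard's theorem would make almost every \<lambda> a regular value of \<Psi>, but a
  one-parameter family needs a whole punctured segment of regular values ending at 0, and 0 may
  itself be critical: critical values could meet every segment arbitrarily close to 0. Analyticity
  excludes this, because the values along the zero set of D can approach 0 only in the finitely many
  directions in which the form at the base point vanishes. The degenerate case is a Jacobian that
  vanishes identically: then every value is critical and the segment has to avoid the image of
  \<Psi> altogether. Two fields are in play. Multiplicity and elimination are complex, while the
  deformation, \<lambda> and w are real; the bridge is conjugation, which forces \<Psi> to be real
  at real points. Which two of the three coefficients cut out the umbilic points depends on which of
  E, F, G is nonzero. At points near \<open>p0\<close> another choice may be in force than at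
  \<open>p0\<close>, so transversality is carried along as the nonvanishing of one of three
  Jacobians.\<close>

lemma has_sum_imp_bounded_terms:
  fixes f :: "'a \<Rightarrow> 'b::real_normed_vector"
  assumes "(f has_sum s) A"
  shows "\<exists>M. \<forall>x\<in>A. norm (f x) \<le> M"
proof -
  have "\<forall>\<^sub>F X in finite_subsets_at_top A. dist (sum f X) s < 1"
    using assms unfolding has_sum_def by (rule tendstoD) simp
  then obtain X where "finite X \<and> X \<subseteq> A \<and> (\<forall>Y. finite Y \<and> X \<subseteq> Y \<and> Y \<subseteq> A \<longrightarrow> dist (sum f Y) s < 1)"
    unfolding eventually_finite_subsets_at_top by (elim exE)
  then have X: "finite X" "X \<subseteq> A"
    and *: "\<And>Y. finite Y \<Longrightarrow> X \<subseteq> Y \<Longrightarrow> Y \<subseteq> A \<Longrightarrow> dist (sum f Y) s < 1"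
    by simp_all
  \<comment> \<open>Outside \<open>X\<close> one further term moves a partial sum within the ball of
    radius 1 about \<open>s\<close>, so its norm is below 2.\<close>
  have "norm (f x) \<le> max 2 (Max (insert 0 (norm ` f ` X)))" if "x \<in> A" for x
  proof (cases "x \<in> X")
    case True
    then have "norm (f x) \<le> Max (insert 0 (norm ` f ` X))"
      using X by (intro Max_ge) auto
    then show ?thesis by simp
  next
    case False
    have "dist (sum f (insert x X)) s < 1" "dist (sum f X) s < 1"
      using X that by (intro *; blast)+
    then have "dist (sum f (insert x X)) (sum f X) < 2"
      using dist_triangle2[of "sum f (insert x X)" "sum f X" s] by simp
    then have "norm (f x) < 2"
      using False X by (simp add: dist_norm)
    then show ?thesis by simp
  qed
  then show ?thesis by blast
qed

lemma geometric2_summable_on: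
  "(\<lambda>(i, j). (1/2::real)^i * (1/2)^j) summable_on (UNIV :: (nat \<times> nat) set)"
proof -
  \<comment> \<open>The product of two sums is available from \<open>has_sum_times_complex\<close>;
    the real double series is then read off from the complex one by taking norms.\<close>
  have "((\<lambda>i. (1/2::complex)^i) has_sum 2) UNIV"
    using norm_summable_imp_has_sum[of "\<lambda>i. (1/2::complex)^i" 2] geometric_sums[of "1/2::complex"]
    by (simp add: norm_power norm_divide)
  from has_sum_times_complex[OF this this]
  have "(\<lambda>(i, j). (1/2::complex)^i * (1/2)^j) summable_on (UNIV :: (nat \<times> nat) set)"
    by (auto simp: summable_on_def)
  then have "(\<lambda>x. norm ((\<lambda>(i, j). (1/2::complex)^i * (1/2)^j) x)) summable_on (UNIV :: (nat \<times> nat) set)"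
    using summable_on_iff_abs_summable_on_complex by blast
  then show ?thesis
    by (simp add: case_prod_unfold norm_mult norm_power norm_divide)
qed

lemma summable_on_geometric2_bound:
  fixes t :: "nat \<times> nat \<Rightarrow> 'a::banach"
  assumes "\<And>i j. norm (t (i, j)) \<le> K * ((1/2)^i * (1/2)^j)"
  shows "t summable_on UNIV"
proof -
  have "(\<lambda>x. norm (t x)) summable_on UNIV"
  proof (rule summable_on_comparison_test)
    show "(\<lambda>x. K * (case x of (i, j) \<Rightarrow> (1/2)^i * (1/2)^j)) summable_on UNIV"
      by (intro summable_on_cmult_right geometric2_summable_on)
  qed (use assms in \<open>auto simp: case_prod_unfold\<close>)
  then show ?thesis by (rule abs_summable_summable)
qed

text \<open>Cauchy estimates serve as the working form of convergence: on the bidisc of radius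
  \<open>r/2\<close> the terms are dominated by \<open>M\<close> times a double geometric series.
  Summability, uniform convergence and, at half that radius, term by term differentiation follow
  from such majorants.\<close>

definition coeffs_bounded :: "(nat \<Rightarrow> nat \<Rightarrow> 'a::real_normed_field) \<Rightarrow> real \<Rightarrow> real \<Rightarrow> bool" where
  "coeffs_bounded c r M \<longleftrightarrow> r > 0 \<and> (\<forall>i j. norm (c i j) * r^(i + j) \<le> M)"

definition series2 :: "(nat \<Rightarrow> nat \<Rightarrow> 'a::real_normed_field) \<Rightarrow> 'a \<times> 'a \<Rightarrow> 'a" where
  "series2 c z = (\<Sum>\<^sub>\<infinity>(i, j). c i j * fst z^i * snd z^j)"

lemma coeffs_bounded_term:
  assumes "coeffs_bounded c r M" "norm x \<le> r/2" "norm y \<le> r/2"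
  shows "norm (c i j * x^i * y^j) \<le> M * ((1/2)^i * (1/2)^j)"
proof -
  have r: "r > 0" and M: "norm (c i j) * r^(i + j) \<le> M"
    using assms by (auto simp: coeffs_bounded_def)
  have "norm (c i j * x^i * y^j) \<le> norm (c i j) * (r/2)^i * (r/2)^j"
    unfolding norm_mult norm_power using assms r by (intro mult_mono power_mono) auto
  also have "\<dots> = norm (c i j) * r^(i+j) * ((1/2)^i * (1/2)^j)"
    by (simp add: power_add power_divide)
  also have "\<dots> \<le> M * ((1/2)^i * (1/2)^j)"
    using M by (intro mult_right_mono) auto
  finally show ?thesis .
qed

lemma has_sum_series2:
  fixes c :: "nat \<Rightarrow> nat \<Rightarrow> 'a::{real_normed_field,banach}"
  assumes "coeffs_bounded c r M" "norm (fst z) \<le> r/2" "norm (snd z) \<le> r/2"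
  shows "((\<lambda>(i, j). c i j * fst z^i * snd z^j) has_sum series2 c z) UNIV"
  unfolding series2_def
  by (rule has_sum_infsum, rule summable_on_geometric2_bound[of _ M])
     (use coeffs_bounded_term[OF assms] in simp)

lemma eventually_near2:
  fixes p :: "'a::real_normed_field \<times> 'a"
  assumes "r > 0"
  shows "\<forall>\<^sub>F z in nhds p. norm (fst (z - p)) \<le> r \<and> norm (snd (z - p)) \<le> r"
proof -
  have "\<forall>\<^sub>F z in nhds p. dist z p < r"
    using assms by (auto simp: eventually_nhds_metric)
  then show ?thesis
  proof eventually_elim
    case (elim z)
    then show ?case
      using norm_fst_le[of "fst (z - p)" "snd (z - p)"] norm_snd_le[of "snd (z - p)" "fst (z - p)"]
      unfolding dist_norm prod.collapse by linarith
  qed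
qed

text \<open>Convergence at one point with both coordinates displaced by \<open>r\<close> bounds all
  terms there, that is, all \<open>norm (c i j) * r^(i + j)\<close>. The local expansion thus
  becomes a statement about coefficients with a definite radius.\<close>

lemma analytic2_at_iff:
  fixes f :: "'a \<times> 'a \<Rightarrow> 'a::{real_normed_field,banach}"
  shows "analytic2_at f p \<longleftrightarrow>
    (\<exists>c r M. coeffs_bounded c r M \<and> (\<forall>\<^sub>F z in nhds p. f z = series2 c (z - p)))"
proof
  assume "analytic2_at f p"
  then obtain c where c: "\<forall>\<^sub>F z in nhds p.
      ((\<lambda>(i, j). c i j * (fst z - fst p)^i * (snd z - snd p)^j) has_sum f z) UNIV"
    by (auto simp: analytic2_at_def)
  then obtain e where e: "e > 0" "\<And>z. dist z p < e \<Longrightarrow>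
      ((\<lambda>(i, j). c i j * (fst z - fst p)^i * (snd z - snd p)^j) has_sum f z) UNIV"
    unfolding eventually_nhds_metric by blast
  \<comment> \<open>The test point \<open>p + (r, r)\<close> is at distance at most
    \<open>2 * e / 3\<close> from \<open>p\<close>, inside the region of convergence.\<close>
  define r where "r = e / 3"
  have r: "r > 0" using e by (simp add: r_def)
  define z where "z = p + (of_real r, of_real r)"
  have "dist z p \<le> r + r"
    using norm_Pair_le[of "of_real r :: 'a" "of_real r :: 'a"] r by (simp add: z_def dist_norm)
  also have "\<dots> < e" using e by (simp add: r_def)
  finally have "((\<lambda>(i, j). c i j * (fst z - fst p)^i * (snd z - snd p)^j) has_sum f z) UNIV"
    by (rule e)
  then obtain M where M: "\<forall>x\<in>UNIV. norm ((\<lambda>(i, j). c i j * (fst z - fst p)^i * (snd z - snd p)^j) x) \<le> M"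
    using has_sum_imp_bounded_terms by meson
  have cb: "coeffs_bounded c r M"
    unfolding coeffs_bounded_def
  proof (intro conjI allI r)
    fix i j
    show "norm (c i j) * r^(i + j) \<le> M"
      using M[rule_format, of "(i, j)"] r by (simp add: z_def norm_mult norm_power power_add mult.assoc)
  qed
  have "\<forall>\<^sub>F z in nhds p. f z = series2 c (z - p)"
    using c eventually_near2[of "r/2" p, OF half_gt_zero[OF r]]
  proof eventually_elim
    case (elim z)
    have "((\<lambda>(i, j). c i j * fst (z - p)^i * snd (z - p)^j) has_sum series2 c (z - p)) UNIV"
      using elim by (intro has_sum_series2[OF cb]) auto
    then show ?case using elim by (auto intro: has_sum_unique)
  qed
  with cb show "\<exists>c r M. coeffs_bounded c r M \<and> (\<forall>\<^sub>F z in nhds p. f z = series2 c (z - p))" by blast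
next
  assume "\<exists>c r M. coeffs_bounded c r M \<and> (\<forall>\<^sub>F z in nhds p. f z = series2 c (z - p))"
  then obtain c r M where cb: "coeffs_bounded c r M" and *: "\<forall>\<^sub>F z in nhds p. f z = series2 c (z - p)"
    by blast
  have r: "r > 0" using cb by (simp add: coeffs_bounded_def)
  show "analytic2_at f p" unfolding analytic2_at_def
    using * eventually_near2[of "r/2" p, OF half_gt_zero[OF r]]
  proof (intro exI[of _ c], eventually_elim)
    case (elim z)
    then show ?case using has_sum_series2[OF cb, of "z - p"] by simp
  qed
qed

text \<open>Over \<complex> the derivative is a priori only real linear; demanding the form
  \<open>a * fst h + b * snd h\<close> encodes the Cauchy-Riemann equations in both variables.
  Continuity of the partial derivatives is then a consequence of Cauchy's formula.\<close>

definition hol2 :: "('a \<times> 'a \<Rightarrow> 'a::real_normed_field) \<Rightarrow> ('a \<times> 'a) set \<Rightarrow> bool" where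
  "hol2 f S \<longleftrightarrow> (\<forall>z\<in>S. \<exists>a b. (f has_derivative (\<lambda>h. a * fst h + b * snd h)) (at z))"

text \<open>Halving the radius pays for the factor produced by differentiation, since
  \<open>i + 1 \<le> 2 * 2^i\<close>; the lost power of \<open>r\<close> gives the
  \<open>1 / r\<close> in the bound.\<close>

lemma coeffs_bounded_shift:
  assumes "coeffs_bounded c r M"
  shows "coeffs_bounded (\<lambda>i j. of_nat (Suc i) * c (Suc i) j) (r/2) (2 * M / r)"
    and "coeffs_bounded (\<lambda>i j. of_nat (Suc j) * c i (Suc j)) (r/2) (2 * M / r)"
proof -
  have r: "r > 0" and M: "\<And>i j. norm (c i j) * r^(i + j) \<le> M"
    using assms by (auto simp: coeffs_bounded_def)
  have *: "real (Suc k) \<le> 2 * 2^(k + l)" for k l :: nat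
  proof -
    have "Suc k < 2 ^ Suc k" by (rule less_exp)
    also have "(2::nat)^Suc k \<le> 2 * 2^(k + l)" by (simp add: power_increasing)
    finally have "Suc k \<le> 2 * 2^(k + l)" by simp
    then have "real (Suc k) \<le> real (2 * 2^(k + l))" by (rule of_nat_mono)
    then show ?thesis by simp
  qed
  have aux: "real (Suc k) * norm d * (r/2)^(k + l) \<le> 2 * M / r"
    if "norm d * r ^ Suc (k + l) \<le> M" for d :: 'a and k l
  proof -
    have "real (Suc k) * norm d * (r/2)^(k + l) \<le> (2 * 2^(k + l)) * norm d * (r/2)^(k + l)"
      using r * by (intro mult_right_mono) auto
    also have "\<dots> = (2 / r) * (norm d * r ^ Suc (k + l))"
      using r by (simp add: power_divide)
    also have "\<dots> \<le> (2 / r) * M"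
      using that r by (intro mult_left_mono) auto
    finally show ?thesis by simp
  qed
  show "coeffs_bounded (\<lambda>i j. of_nat (Suc i) * c (Suc i) j) (r/2) (2 * M / r)"
    unfolding coeffs_bounded_def norm_mult norm_of_nat
  proof (intro conjI allI)
    show "real (Suc i) * norm (c (Suc i) j) * (r/2)^(i + j) \<le> 2 * M / r" for i j
      using M[of "Suc i" j] by (intro aux) simp
  qed (use r in simp)
  show "coeffs_bounded (\<lambda>i j. of_nat (Suc j) * c i (Suc j)) (r/2) (2 * M / r)"
    unfolding coeffs_bounded_def norm_mult norm_of_nat
  proof (intro conjI allI)
    show "real (Suc j) * norm (c i (Suc j)) * (r/2)^(i + j) \<le> 2 * M / r" for i j
      using aux[of "c i (Suc j)" j i] M[of i "Suc j"] by (simp add: add.commute)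
  qed (use r in simp)
qed

section \<open>Double series as ordinary series, and their derivatives\<close>

lemma summable_geometric2_prod_decode:
  "summable (\<lambda>n. case prod_decode n of (i, j) \<Rightarrow> (1/2::real)^i * (1/2)^j)"
proof -
  have "(\<lambda>n. case prod_decode n of (i, j) \<Rightarrow> (1/2::real)^i * (1/2)^j) summable_on UNIV"
    using geometric2_summable_on summable_on_reindex_bij_betw[OF bij_prod_decode] by fast
  then show ?thesis by (rule summable_on_imp_summable)
qed

lemma has_sum_prod_decode_sums:
  fixes f :: "nat \<times> nat \<Rightarrow> 'a::real_normed_vector"
  assumes "(f has_sum s) UNIV"
  shows "(\<lambda>n. f (prod_decode n)) sums s"
  by (rule has_sum_imp_sums) (simp add: has_sum_reindex_bij_betw[OF bij_prod_decode, of f s] assms)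

text \<open>Enumerating the pairs by \<open>prod_decode\<close> produces a sequence of partial sums,
  to which the Weierstrass M-test applies. As \<open>has_sum\<close> is unconditional, the
  enumeration does not affect the limit.\<close>

lemma uniform_limit_prod_decode:
  fixes t :: "nat \<times> nat \<Rightarrow> 'b \<Rightarrow> 'a::banach"
  assumes "\<And>z i j. z \<in> S \<Longrightarrow> norm (t (i, j) z) \<le> K * ((1/2)^i * (1/2)^j)"
    and "\<And>z. z \<in> S \<Longrightarrow> ((\<lambda>x. t x z) has_sum s z) UNIV"
  shows "uniform_limit S (\<lambda>N z. \<Sum>n<N. t (prod_decode n) z) s sequentially"
proof -
  have "uniform_limit S (\<lambda>N z. \<Sum>n<N. t (prod_decode n) z) (\<lambda>z. \<Sum>n. t (prod_decode n) z) sequentially"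
  proof (rule Weierstrass_m_test)
    fix n z assume "z \<in> S"
    then show "norm (t (prod_decode n) z) \<le> K * (case prod_decode n of (i, j) \<Rightarrow> (1/2)^i * (1/2)^j)"
      using assms(1) by (auto split: prod.splits)
  qed (rule summable_mult[OF summable_geometric2_prod_decode])
  moreover have "(\<Sum>n. t (prod_decode n) z) = s z" if "z \<in> S" for z
    using has_sum_prod_decode_sums[OF assms(2)[OF that]] by (simp add: sums_iff)
  ultimately show ?thesis by (metis (no_types, lifting) uniform_limit_cong')
qed

text \<open>The coefficients of the formal partial derivative in the first variable.\<close>

definition shift1 :: "(nat \<Rightarrow> nat \<Rightarrow> 'a::real_normed_field) \<Rightarrow> nat \<Rightarrow> nat \<Rightarrow> 'a" where
  "shift1 c i j = of_nat (Suc i) * c (Suc i) j"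

definition shift2 :: "(nat \<Rightarrow> nat \<Rightarrow> 'a::real_normed_field) \<Rightarrow> nat \<Rightarrow> nat \<Rightarrow> 'a" where
  "shift2 c i j = of_nat (Suc j) * c i (Suc j)"

text \<open>Term by term differentiation. The derived series satisfy \<open>coeffs_bounded\<close>
  with radius \<open>r/2\<close>, hence are controlled where both coordinates have norm below
  \<open>r/4\<close>.\<close>

lemma has_derivative_series2:
  fixes c :: "nat \<Rightarrow> nat \<Rightarrow> 'a::{real_normed_field,banach}"
  assumes cb: "coeffs_bounded c r M" and z: "norm (fst z) < r/4" "norm (snd z) < r/4"
  shows "(series2 c has_derivative
            (\<lambda>h. series2 (shift1 c) z * fst h + series2 (shift2 c) z * snd h)) (at z)"
proof -
  define S where "S = {z :: 'a \<times> 'a. norm (fst z) < r/4 \<and> norm (snd z) < r/4}"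
  have S_eq: "S = ball 0 (r/4) \<times> ball 0 (r/4)" by (auto simp: S_def)
  have S: "convex S" "open S" by (auto simp: S_eq intro!: convex_Times open_Times)
  have r: "r > 0" using cb by (simp add: coeffs_bounded_def)
  have M0: "M \<ge> 0"
    using cb norm_ge_zero[of "c 0 0"]
    by (auto simp: coeffs_bounded_def dest!: spec[of _ 0] intro: order_trans[OF norm_ge_zero])
  have cb1: "coeffs_bounded (shift1 c) (r/2) (2*M/r)" and cb2: "coeffs_bounded (shift2 c) (r/2) (2*M/r)"
    using coeffs_bounded_shift[OF cb] by (simp_all add: shift1_def[abs_def] shift2_def[abs_def])
  \<comment> \<open>The derived terms keep the exponents of the original series as indices. For
    \<open>i = 0\<close> the truncated \<open>i - 1\<close> is harmless because the factor
    \<open>of_nat i\<close> vanishes.\<close>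
  define t1 where "t1 = (\<lambda>(i, j) z :: 'a \<times> 'a. of_nat i * c i j * fst z^(i - 1) * snd z^j)"
  define t2 where "t2 = (\<lambda>(i, j) z :: 'a \<times> 'a. of_nat j * c i j * fst z^i * snd z^(j - 1))"
  define t where "t = (\<lambda>(i, j) z :: 'a \<times> 'a. c i j * fst z^i * snd z^j)"
  \<comment> \<open>Reindexing by \<open>i = Suc k\<close> turns \<open>(1/2)^k\<close> into
    \<open>2 * (1/2)^i\<close>, whence \<open>4 * M / r\<close> instead of
    \<open>2 * M / r\<close>.\<close>
  have b1: "norm (t1 (i, j) z) \<le> (4*M/r) * ((1/2)^i * (1/2)^j)" if "z \<in> S" for i j z
  proof (cases i)
    case (Suc k)
    have "norm (shift1 c k j * fst z^k * snd z^j) \<le> (2*M/r) * ((1/2)^k * (1/2)^j)"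
      using that by (intro coeffs_bounded_term[OF cb1]) (auto simp: S_def)
    then show ?thesis using Suc by (simp add: t1_def shift1_def mult_ac)
  qed (use M0 r in \<open>simp add: t1_def\<close>)
  have b2: "norm (t2 (i, j) z) \<le> (4*M/r) * ((1/2)^i * (1/2)^j)" if "z \<in> S" for i j z
  proof (cases j)
    case (Suc k)
    have "norm (shift2 c i k * fst z^i * snd z^k) \<le> (2*M/r) * ((1/2)^i * (1/2)^k)"
      using that by (intro coeffs_bounded_term[OF cb2]) (auto simp: S_def)
    then show ?thesis using Suc by (simp add: t2_def shift2_def mult_ac)
  qed (use M0 r in \<open>simp add: t2_def\<close>)
  have s1: "((\<lambda>x. t1 x z) has_sum series2 (shift1 c) z) UNIV" if "z \<in> S" for z
  proof -
    have "((\<lambda>(i, j). shift1 c i j * fst z^i * snd z^j) has_sum series2 (shift1 c) z) UNIV"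
      using that by (intro has_sum_series2[OF cb1]) (auto simp: S_def)
    also have "(\<lambda>(i, j). shift1 c i j * fst z^i * snd z^j) = (\<lambda>x. t1 x z) \<circ> (\<lambda>(i, j). (Suc i, j))"
      by (auto simp: fun_eq_iff t1_def shift1_def)
    finally have "((\<lambda>x. t1 x z) has_sum series2 (shift1 c) z) ((\<lambda>(i, j). (Suc i, j)) ` UNIV)"
      by (rule has_sum_reindex[THEN iffD2, rotated]) (auto simp: inj_on_def)
    then show ?thesis
    proof (rule has_sum_cong_neutral[THEN iffD1, rotated -1])
      fix x assume "x \<in> UNIV - (\<lambda>(i, j). (Suc i, j)) ` (UNIV :: (nat \<times> nat) set)"
      then have "fst x = 0"
        using range_eqI[of x "\<lambda>(i, j). (Suc i, j)" "(fst x - 1, snd x)"] by (cases x) auto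
      then show "t1 x z = 0" by (simp add: t1_def case_prod_unfold)
    qed auto
  qed
  have s2: "((\<lambda>x. t2 x z) has_sum series2 (shift2 c) z) UNIV" if "z \<in> S" for z
  proof -
    have "((\<lambda>(i, j). shift2 c i j * fst z^i * snd z^j) has_sum series2 (shift2 c) z) UNIV"
      using that by (intro has_sum_series2[OF cb2]) (auto simp: S_def)
    also have "(\<lambda>(i, j). shift2 c i j * fst z^i * snd z^j) = (\<lambda>x. t2 x z) \<circ> (\<lambda>(i, j). (i, Suc j))"
      by (auto simp: fun_eq_iff t2_def shift2_def)
    finally have "((\<lambda>x. t2 x z) has_sum series2 (shift2 c) z) ((\<lambda>(i, j). (i, Suc j)) ` UNIV)"
      by (rule has_sum_reindex[THEN iffD2, rotated]) (auto simp: inj_on_def)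
    then show ?thesis
    proof (rule has_sum_cong_neutral[THEN iffD1, rotated -1])
      fix x assume "x \<in> UNIV - (\<lambda>(i, j). (i, Suc j)) ` (UNIV :: (nat \<times> nat) set)"
      then have "snd x = 0"
        using range_eqI[of x "\<lambda>(i, j). (i, Suc j)" "(fst x, snd x - 1)"] by (cases x) auto
      then show "t2 x z = 0" by (simp add: t2_def case_prod_unfold)
    qed auto
  qed
  have s: "(\<lambda>n. t (prod_decode n) z) sums series2 c z" if "z \<in> S" for z
  proof -
    have "((\<lambda>(i, j). c i j * fst z^i * snd z^j) has_sum series2 c z) UNIV"
      using that r by (intro has_sum_series2[OF cb]) (auto simp: S_def)
    then have "((\<lambda>x. t x z) has_sum series2 c z) UNIV"
      by (simp add: t_def case_prod_unfold)
    from has_sum_prod_decode_sums[OF this] show ?thesis .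
  qed
  have u1: "uniform_limit S (\<lambda>N z. \<Sum>n<N. t1 (prod_decode n) z) (series2 (shift1 c)) sequentially"
    by (rule uniform_limit_prod_decode[OF b1 s1])
  have u2: "uniform_limit S (\<lambda>N z. \<Sum>n<N. t2 (prod_decode n) z) (series2 (shift2 c)) sequentially"
    by (rule uniform_limit_prod_decode[OF b2 s2])
  have zS: "z \<in> S" using z by (simp add: S_def)
  have "\<exists>g. \<forall>x\<in>S. (\<lambda>n. t (prod_decode n) x) sums (g x) \<and>
      (g has_derivative (\<lambda>h. series2 (shift1 c) x * fst h + series2 (shift2 c) x * snd h)) (at x within S)"
  proof (rule has_derivative_series[where f = "\<lambda>n. t (prod_decode n)"])
    show "convex S" by fact
  next
    show "z \<in> S" by fact
    then show "(\<lambda>n. t (prod_decode n) z) sums series2 c z" by (rule s)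
  next
    show "(t (prod_decode n) has_derivative
        (\<lambda>h. t1 (prod_decode n) x * fst h + t2 (prod_decode n) x * snd h)) (at x within S)"
      if "x \<in> S" for n x
    proof -
      obtain i j where ij: "prod_decode n = (i, j)" by fastforce
      show ?thesis
        unfolding ij t_def t1_def t2_def prod.case
        by (rule derivative_eq_intros refl | simp add: algebra_simps)+
    qed
  next
    fix e :: real assume e: "e > 0"
    have "\<forall>\<^sub>F N in sequentially. \<forall>x\<in>S. dist (\<Sum>n<N. t1 (prod_decode n) x) (series2 (shift1 c) x) < e / 2"
      "\<forall>\<^sub>F N in sequentially. \<forall>x\<in>S. dist (\<Sum>n<N. t2 (prod_decode n) x) (series2 (shift2 c) x) < e / 2"
      using uniform_limitD[OF u1, of "e/2"] uniform_limitD[OF u2, of "e/2"] e by simp_all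
    then show "\<forall>\<^sub>F n in sequentially. \<forall>x\<in>S. \<forall>h. norm ((\<Sum>i<n. t1 (prod_decode i) x * fst h
        + t2 (prod_decode i) x * snd h)
            - (series2 (shift1 c) x * fst h + series2 (shift2 c) x * snd h)) \<le> e * norm h"
    proof (eventually_elim, intro ballI allI)
      fix N x and h :: "'a \<times> 'a"
      assume "\<forall>x\<in>S. dist (\<Sum>n<N. t1 (prod_decode n) x) (series2 (shift1 c) x) < e / 2"
        "\<forall>x\<in>S. dist (\<Sum>n<N. t2 (prod_decode n) x) (series2 (shift2 c) x) < e / 2"
        and x: "x \<in> S"
      then have d: "norm ((\<Sum>n<N. t1 (prod_decode n) x) - series2 (shift1 c) x) \<le> e/2"
        "norm ((\<Sum>n<N. t2 (prod_decode n) x) - series2 (shift2 c) x) \<le> e/2"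
        by (auto simp: dist_norm intro: less_imp_le)
      have h: "norm (fst h) \<le> norm h" "norm (snd h) \<le> norm h"
        using norm_fst_le[of "fst h" "snd h"] norm_snd_le[of "snd h" "fst h"] by simp_all
      have "(\<Sum>i<N. t1 (prod_decode i) x * fst h + t2 (prod_decode i) x * snd h)
            - (series2 (shift1 c) x * fst h + series2 (shift2 c) x * snd h)
          = ((\<Sum>n<N. t1 (prod_decode n) x) - series2 (shift1 c) x) * fst h
            + ((\<Sum>n<N. t2 (prod_decode n) x) - series2 (shift2 c) x) * snd h"
        by (simp add: sum.distrib left_diff_distrib flip: sum_distrib_right)
      also have "norm \<dots> \<le> (e/2) * norm h + (e/2) * norm h"
        by (intro norm_triangle_le add_mono, unfold norm_mult; intro mult_mono d h) (use e in auto)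
      finally show "norm ((\<Sum>i<N. t1 (prod_decode i) x * fst h + t2 (prod_decode i) x * snd h)
            - (series2 (shift1 c) x * fst h + series2 (shift2 c) x * snd h)) \<le> e * norm h"
        by simp
    qed
  qed
  then obtain g where g: "\<And>x. x \<in> S \<Longrightarrow> (\<lambda>n. t (prod_decode n) x) sums (g x)"
      "\<And>x. x \<in> S \<Longrightarrow>
      (g has_derivative (\<lambda>h. series2 (shift1 c) x * fst h + series2 (shift2 c) x * snd h)) (at x within S)"
    by blast
  have geq: "g x = series2 c x" if "x \<in> S" for x
    using g(1)[OF that] s[OF that] sums_unique2 by blast
  from g(2)[OF zS] have "(g has_derivative (\<lambda>h. series2 (shift1 c) z * fst h + series2 (shift2 c) z * snd h)) (at z)"
    unfolding at_within_open[OF zS S(2)] .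
  then show ?thesis
    by (rule has_derivative_transform_within_open[OF _ \<open>open S\<close> zS geq])
qed

lemma analytic2_at_has_derivative:
  fixes f :: "'a \<times> 'a \<Rightarrow> 'a::{real_normed_field,banach}"
  assumes "analytic2_at f p"
  obtains f1 f2 where "analytic2_at f1 p" "analytic2_at f2 p"
    "\<forall>\<^sub>F z in nhds p. (f has_derivative (\<lambda>h. f1 z * fst h + f2 z * snd h)) (at z)"
proof -
  obtain c r M where cb: "coeffs_bounded c r M" and ev: "\<forall>\<^sub>F z in nhds p. f z = series2 c (z - p)"
    using assms unfolding analytic2_at_iff by blast
  have r: "r > 0" using cb by (simp add: coeffs_bounded_def)
  have cb1: "coeffs_bounded (shift1 c) (r/2) (2*M/r)" and cb2: "coeffs_bounded (shift2 c) (r/2) (2*M/r)"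
    using coeffs_bounded_shift[OF cb] by (simp_all add: shift1_def[abs_def] shift2_def[abs_def])
  have "analytic2_at (\<lambda>z. series2 (shift1 c) (z - p)) p" "analytic2_at (\<lambda>z. series2 (shift2 c) (z - p)) p"
    unfolding analytic2_at_iff using cb1 cb2 by (blast intro: always_eventually)+
  moreover have "\<forall>\<^sub>F z in nhds p. (f has_derivative
      (\<lambda>h. series2 (shift1 c) (z - p) * fst h + series2 (shift2 c) (z - p) * snd h)) (at z)"
  proof -
    have "\<forall>\<^sub>F z in nhds p. \<forall>\<^sub>F y in nhds z. f y = series2 c (y - p)"
      using ev by (simp add: eventually_eventually)
    moreover have "\<forall>\<^sub>F z in nhds p. norm (fst (z - p)) \<le> r/5 \<and> norm (snd (z - p)) \<le> r/5"
      by (rule eventually_near2) (use r in simp)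
    ultimately show ?thesis
    proof eventually_elim
      case (elim z)
      have "(series2 c has_derivative (\<lambda>h. series2 (shift1 c) (z - p) * fst h
          + series2 (shift2 c) (z - p) * snd h)) (at (z - p))"
        by (rule has_derivative_series2[OF cb]) (use elim r in auto)
      then have *: "((\<lambda>z. series2 c (z - p)) has_derivative (\<lambda>h. series2 (shift1 c) (z - p) * fst h
          + series2 (shift2 c) (z - p) * snd h)) (at z)"
        by (rule has_derivative_compose[of "\<lambda>z. z - p" "\<lambda>h. h", rotated])
           (auto intro!: derivative_eq_intros)
      obtain A where A: "open A" "z \<in> A" "\<And>y. y \<in> A \<Longrightarrow> f y = series2 c (y - p)"
        using elim(1) unfolding eventually_nhds by blast
      show ?case
        by (rule has_derivative_transform_within_open[OF * A(1,2)]) (simp add: A(3))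
    qed
  qed
  ultimately show ?thesis by (rule that)
qed

section \<open>Holomorphic functions of two variables\<close>

abbreviation has_d12 :: "('a \<times> 'a \<Rightarrow> 'a::real_normed_field) \<Rightarrow> 'a \<Rightarrow> 'a \<Rightarrow> 'a \<times> 'a \<Rightarrow> bool" where
  "has_d12 f a b z \<equiv> (f has_derivative (\<lambda>h. a * fst h + b * snd h)) (at z)"

definition d1 :: "('a \<times> 'a \<Rightarrow> 'a::real_normed_field) \<Rightarrow> 'a \<times> 'a \<Rightarrow> 'a" where
  "d1 f z = frechet_derivative f (at z) (1, 0)"

definition d2 :: "('a \<times> 'a \<Rightarrow> 'a::real_normed_field) \<Rightarrow> 'a \<times> 'a \<Rightarrow> 'a" where
  "d2 f z = frechet_derivative f (at z) (0, 1)"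

lemma has_d12_imp:
  assumes "has_d12 f a b z"
  shows "d1 f z = a" "d2 f z = b"
  using frechet_derivative_at[OF assms, symmetric] by (simp_all add: d1_def d2_def)

lemma hol2D:
  assumes "hol2 f S" "z \<in> S"
  shows "has_d12 f (d1 f z) (d2 f z) z"
proof -
  obtain a b where ab: "has_d12 f a b z" using assms unfolding hol2_def by blast
  then show ?thesis unfolding has_d12_imp[OF ab] .
qed

lemma hol2I: "(\<And>z. z \<in> S \<Longrightarrow> has_d12 f (a z) (b z) z) \<Longrightarrow> hol2 f S"
  unfolding hol2_def by blast

lemma hol2_subset: "hol2 f S \<Longrightarrow> T \<subseteq> S \<Longrightarrow> hol2 f T"
  unfolding hol2_def by blast

lemma hol2_continuous_on: "hol2 f S \<Longrightarrow> continuous_on S f"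
  by (intro continuous_at_imp_continuous_on ballI) (rule has_derivative_continuous, erule (1) hol2D)

lemma has_d12_const: "has_d12 (\<lambda>_. c) 0 0 z"
  by (auto intro!: derivative_eq_intros)

lemma has_d12_fst: "has_d12 fst 1 0 z" and has_d12_snd: "has_d12 snd 0 1 z"
  by (auto intro!: derivative_eq_intros)

lemma has_d12_add:
  "has_d12 f a b z \<Longrightarrow> has_d12 g c d z \<Longrightarrow> has_d12 (\<lambda>z. f z + g z) (a + c) (b + d) z"
  by (auto intro!: derivative_eq_intros simp: algebra_simps)

lemma has_d12_diff:
  "has_d12 f a b z \<Longrightarrow> has_d12 g c d z \<Longrightarrow> has_d12 (\<lambda>z. f z - g z) (a - c) (b - d) z"
  by (auto intro!: derivative_eq_intros simp: algebra_simps)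

lemma has_d12_mult:
  "has_d12 f a b z \<Longrightarrow> has_d12 g c d z \<Longrightarrow>
   has_d12 (\<lambda>z. f z * g z) (a * g z + f z * c) (b * g z + f z * d) z"
  by (auto intro!: derivative_eq_intros simp: algebra_simps)

lemma has_d12_inverse:
  assumes "has_d12 f a b z" "f z \<noteq> 0"
  shows "has_d12 (\<lambda>z. inverse (f z)) (- (a * inverse (f z)^2)) (- (b * inverse (f z)^2)) z"
  using Deriv.has_derivative_inverse[OF assms(2,1)]
  by (rule has_derivative_eq_rhs) (auto simp: fun_eq_iff power2_eq_square algebra_simps)

lemma hol2_const: "hol2 (\<lambda>_. c) S"
  by (rule hol2I, rule has_d12_const)

lemma hol2_fst: "hol2 fst S" and hol2_snd: "hol2 snd S"
  by (rule hol2I, rule has_d12_fst) (rule hol2I, rule has_d12_snd)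

lemma hol2_add: "hol2 f S \<Longrightarrow> hol2 g S \<Longrightarrow> hol2 (\<lambda>z. f z + g z) S"
  by (rule hol2I, rule has_d12_add; erule (1) hol2D)

lemma hol2_diff: "hol2 f S \<Longrightarrow> hol2 g S \<Longrightarrow> hol2 (\<lambda>z. f z - g z) S"
  by (rule hol2I, rule has_d12_diff; erule (1) hol2D)

lemma hol2_mult: "hol2 f S \<Longrightarrow> hol2 g S \<Longrightarrow> hol2 (\<lambda>z. f z * g z) S"
  by (rule hol2I, rule has_d12_mult; erule (1) hol2D)

lemma hol2_inverse: "hol2 f S \<Longrightarrow> (\<And>z. z \<in> S \<Longrightarrow> f z \<noteq> 0) \<Longrightarrow> hol2 (\<lambda>z. inverse (f z)) S"
  by (rule hol2I, rule has_d12_inverse, erule (1) hol2D) blast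

lemma hol2_power: "hol2 f S \<Longrightarrow> hol2 (\<lambda>z. f z ^ n) S"
  by (induction n) (auto intro: hol2_const hol2_mult)

lemmas hol2_intros = hol2_const hol2_fst hol2_snd hol2_add hol2_diff hol2_mult hol2_power

lemma has_d12_slice:
  assumes "has_d12 f a b (u, v)"
  shows "((\<lambda>s. f (s, v)) has_field_derivative a) (at u)"
    and "((\<lambda>t. f (u, t)) has_field_derivative b) (at v)"
proof -
  have "((\<lambda>s. (s, v)) has_derivative (\<lambda>h. (h, 0))) (at u)" "((\<lambda>t. (u, t)) has_derivative (\<lambda>h. (0, h))) (at v)"
    by (auto intro!: derivative_eq_intros)
  from has_derivative_compose[OF this(1) assms] has_derivative_compose[OF this(2) assms]
  show "((\<lambda>s. f (s, v)) has_field_derivative a) (at u)" "((\<lambda>t. f (u, t)) has_field_derivative b) (at v)"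
    by (simp_all add: has_field_derivative_def)
qed

lemma hol2_slice1:
  fixes f :: "complex \<times> complex \<Rightarrow> complex"
  assumes "hol2 f S" and "\<And>s. s \<in> A \<Longrightarrow> (s, v) \<in> S"
  shows "(\<lambda>s. f (s, v)) holomorphic_on A"
  unfolding holomorphic_on_def field_differentiable_def
  using has_d12_slice(1)[OF hol2D[OF assms]] has_field_derivative_at_within by blast

lemma hol2_slice2:
  fixes f :: "complex \<times> complex \<Rightarrow> complex"
  assumes "hol2 f S" and "\<And>t. t \<in> A \<Longrightarrow> (u, t) \<in> S"
  shows "(\<lambda>t. f (u, t)) holomorphic_on A"
  unfolding holomorphic_on_def field_differentiable_def
  using has_d12_slice(2)[OF hol2D[OF assms]] has_field_derivative_at_within by blast

section \<open>Circle integrals depending on a parameter, and Osgood's lemma\<close>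

lemma contour_integral_circlepath:
  "contour_integral (circlepath b r) f = integral (cbox 0 1)
      (\<lambda>t. f (circlepath b r t) * (2 * pi * \<i> * r * exp (2 * of_real pi * \<i> * t)))"
  by (simp add: contour_integral_integral vector_derivative_circlepath)

lemma circlepath_in_sphere: "0 \<le> r \<Longrightarrow> circlepath b r t \<in> sphere b r"
  by (simp add: circlepath dist_norm norm_mult)

lemma circlepath_param_continuous:
  assumes cont: "continuous_on (U \<times> sphere b r) (\<lambda>(x, s). F x s)" and r: "0 \<le> r"
  shows "continuous_on (U \<times> cbox 0 1) (\<lambda>(x, t). F x (circlepath b r t) *
           (2 * pi * \<i> * r * exp (2 * of_real pi * \<i> * t)))"
proof -
  have "continuous_on (U \<times> cbox 0 1) (\<lambda>p. (fst p, circlepath b r (snd p)))"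
    unfolding circlepath by (intro continuous_intros)
  moreover have "(\<lambda>p. (fst p, circlepath b r (snd p))) ` (U \<times> cbox 0 1) \<subseteq> U \<times> sphere b r"
    using circlepath_in_sphere[OF r] by auto
  ultimately have "continuous_on (U \<times> cbox 0 1) (\<lambda>p. case (fst p, circlepath b r (snd p)) of (x, s) \<Rightarrow> F x s)"
    by (rule continuous_on_compose2[OF cont])
  then show ?thesis
    unfolding case_prod_unfold fst_conv snd_conv by (intro continuous_intros)
qed

lemma contour_integral_circlepath_param_continuous:
  fixes F :: "'a::topological_space \<Rightarrow> complex \<Rightarrow> complex"
  assumes "continuous_on (U \<times> sphere b r) (\<lambda>(x, s). F x s)" "0 \<le> r"
  shows "continuous_on U (\<lambda>x. contour_integral (circlepath b r) (F x))"
  unfolding contour_integral_circlepath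
  by (rule integral_continuous_on_param, rule circlepath_param_continuous[OF assms])

lemma contour_integral_circlepath_param_holomorphic:
  fixes F :: "complex \<Rightarrow> complex \<Rightarrow> complex"
  assumes U: "convex U" and r: "0 \<le> r"
    and cont: "continuous_on (U \<times> sphere b r) (\<lambda>(x, s). F x s)"
    and cont': "continuous_on (U \<times> sphere b r) (\<lambda>(x, s). F' x s)"
    and der: "\<And>x s. x \<in> U \<Longrightarrow> s \<in> sphere b r \<Longrightarrow> ((\<lambda>x. F x s) has_field_derivative F' x s) (at x)"
  shows "(\<lambda>x. contour_integral (circlepath b r) (F x)) holomorphic_on U"
  unfolding contour_integral_circlepath
proof (rule leibniz_rule_holomorphic)
  fix x and t :: real assume "x \<in> U" "t \<in> cbox 0 1"
  then have "((\<lambda>x. F x (circlepath b r t)) has_field_derivative F' x (circlepath b r t)) (at x)"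
    by (intro der circlepath_in_sphere r)
  then show "((\<lambda>x. F x (circlepath b r t) * (2 * pi * \<i> * r * exp (2 * of_real pi * \<i> * t))) has_field_derivative
      F' x (circlepath b r t) * (2 * pi * \<i> * r * exp (2 * of_real pi * \<i> * t))) (at x within U)"
    by (rule has_field_derivative_at_within[OF DERIV_cmult_right])
next
  fix x assume x: "x \<in> U"
  have "continuous_on (cbox 0 1) (\<lambda>t. (x, t :: real))" by (intro continuous_intros)
  moreover have "(\<lambda>t. (x, t)) ` cbox 0 1 \<subseteq> U \<times> cbox (0::real) 1" using x by auto
  ultimately have "continuous_on (cbox 0 1) (\<lambda>t. case (x, t) of (x, t) \<Rightarrow> F x (circlepath b r t) *
           (2 * pi * \<i> * r * exp (2 * of_real pi * \<i> * t)))"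
    by (rule continuous_on_compose2[OF circlepath_param_continuous[OF cont r]])
  then show "(\<lambda>t. F x (circlepath b r t) * (2 * pi * \<i> * r * exp (2 * of_real pi * \<i> * t))) integrable_on cbox 0 1"
    unfolding prod.case by (rule integrable_continuous)
next
  show "continuous_on (U \<times> cbox 0 1) (\<lambda>(x, t). F' x (circlepath b r t) * (2 * pi * \<i> * r * exp (2 * of_real pi *
      \<i> * t)))"
    by (rule circlepath_param_continuous[OF cont' r])
qed (fact U)

lemma open_contains_cball_Times:
  fixes p :: "'a::metric_space \<times> 'b::metric_space"
  assumes "open S" "p \<in> S"
  obtains r where "r > 0" "cball (fst p) r \<times> cball (snd p) r \<subseteq> S"
proof -
  obtain A B where "open A" "open B" "fst p \<in> A" "snd p \<in> B" "A \<times> B \<subseteq> S"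
    using assms by (metis open_prod_elim mem_Times_iff)
  then obtain r s where "r > 0" "cball (fst p) r \<subseteq> A" "s > 0" "cball (snd p) s \<subseteq> B"
    by (metis open_contains_cball)
  then have "cball (fst p) (min r s) \<times> cball (snd p) (min r s) \<subseteq> S" "min r s > 0"
    using \<open>A \<times> B \<subseteq> S\<close> by (auto simp: subset_iff)
  then show ?thesis using that by blast
qed

text \<open>Cauchy's formula for the derivative expresses \<open>d1 f\<close> near \<open>p\<close>
  as an integral of \<open>f\<close> over a fixed circle in the first variable. The integrand
  depends continuously on the point, so continuity passes from \<open>f\<close> to
  \<open>d1 f\<close>.\<close>

lemma hol2_continuous_d1:
  fixes f :: "complex \<times> complex \<Rightarrow> complex"
  assumes S: "open S" and f: "hol2 f S"
  shows "continuous_on S (d1 f)"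
proof (rule continuous_at_imp_continuous_on, rule ballI)
  fix p assume "p \<in> S"
  obtain r where r: "r > 0" "cball (fst p) r \<times> cball (snd p) r \<subseteq> S"
    by (rule open_contains_cball_Times[OF S \<open>p \<in> S\<close>])
  let ?B = "ball (fst p) r \<times> ball (snd p) r"
  have eq: "1 / (2 * of_real pi * \<i>) * contour_integral (circlepath (fst p) r) (\<lambda>s. f (s, snd z) / (s - fst z)^2)
      = d1 f z" if z: "z \<in> ?B" for z
  proof (rule DERIV_unique)
    have sub: "(s, snd z) \<in> S" if "s \<in> cball (fst p) r" for s
      using r z that by (auto simp: mem_Times_iff subset_iff)
    then have "continuous_on (cball (fst p) r) (\<lambda>s. f (s, snd z))" "(\<lambda>s. f (s, snd z)) holomorphic_on ball (fst p) r"
      using sub by (auto intro!: holomorphic_on_imp_continuous_on hol2_slice1[OF f])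
    then show "((\<lambda>s. f (s, snd z)) has_field_derivative 1 / (2 * of_real pi * \<i>) *
        contour_integral (circlepath (fst p) r) (\<lambda>s. f (s, snd z) / (s - fst z)^2)) (at (fst z))"
      using z by (intro Cauchy_derivative_integral_circlepath) auto
    show "((\<lambda>s. f (s, snd z)) has_field_derivative d1 f z) (at (fst z))"
      using hol2D[OF f sub[of "fst z"]] z by (intro has_d12_slice(1)[where b = "d2 f z"]) auto
  qed
  have "continuous_on ?B (\<lambda>z. contour_integral (circlepath (fst p) r) (\<lambda>s. f (s, snd z) / (s - fst z)^2))"
  proof (rule contour_integral_circlepath_param_continuous)
    have "continuous_on (?B \<times> sphere (fst p) r) (\<lambda>w. f (snd w, snd (fst w)))"
      by (rule continuous_on_compose2[OF hol2_continuous_on[OF f]])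
         (use r in \<open>auto intro!: continuous_intros simp: subset_iff\<close>)
    then show "continuous_on (?B \<times> sphere (fst p) r) (\<lambda>(z, s). f (s, snd z) / (s - fst z)\<^sup>2)"
      by (auto simp: case_prod_unfold intro!: continuous_intros)
  qed (use r in simp)
  then have "continuous_on ?B (\<lambda>z. 1 / (2 * of_real pi * \<i>) * contour_integral (circlepath (fst p) r) (\<lambda>s.
      f (s, snd z) / (s - fst z)^2))"
    by (intro continuous_intros)
  then have "continuous_on ?B (d1 f)"
    by (rule continuous_on_eq) (rule eq)
  moreover have "open ?B" "p \<in> ?B" using r by (simp_all add: open_Times mem_Times_iff)
  ultimately show "isCont (d1 f) p"
    using continuous_on_eq_continuous_at by blast
qed

lemma hol2_swap:
  assumes "hol2 f S"
  shows "hol2 (f \<circ> prod.swap) (prod.swap ` S)" "z \<in> S \<Longrightarrow> d1 (f \<circ> prod.swap) (prod.swap z) = d2 f z"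
proof -
  have sw: "(prod.swap has_derivative prod.swap) (at w)" for w :: "'a \<times> 'a"
    unfolding prod.swap_def[abs_def] by (auto intro!: derivative_eq_intros)
  have *: "has_d12 (f \<circ> prod.swap) (d2 f z) (d1 f z) (prod.swap z)" if "z \<in> S" for z
  proof -
    have "has_d12 f (d1 f z) (d2 f z) (prod.swap (prod.swap z))"
      using hol2D[OF assms that] by simp
    then have "(f \<circ> prod.swap has_derivative (\<lambda>h. d1 f z * fst (prod.swap h) + d2 f z * snd (prod.swap h)))
        (at (prod.swap z))"
      unfolding o_def by (rule has_derivative_compose[rotated]) (rule sw)
    then show ?thesis by (simp add: add.commute)
  qed
  then show "hol2 (f \<circ> prod.swap) (prod.swap ` S)" unfolding hol2_def by blast
  show "z \<in> S \<Longrightarrow> d1 (f \<circ> prod.swap) (prod.swap z) = d2 f z"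
    using * has_d12_imp by blast
qed

lemma hol2_continuous_d2:
  fixes f :: "complex \<times> complex \<Rightarrow> complex"
  assumes S: "open S" and f: "hol2 f S"
  shows "continuous_on S (d2 f)"
proof -
  have eq: "prod.swap ` S = prod.swap -` S" by force
  have "open (prod.swap -` S)"
    by (rule open_vimage[OF S]) (simp add: prod.swap_def continuous_intros)
  then have "continuous_on (prod.swap ` S) (d1 (f \<circ> prod.swap))"
    using hol2_swap(1)[OF f] by (intro hol2_continuous_d1) (simp_all add: eq)
  then have "continuous_on S (\<lambda>z. d1 (f \<circ> prod.swap) (prod.swap z))"
    by (rule continuous_on_compose2) (auto simp: prod.swap_def intro!: continuous_intros)
  then show ?thesis by (rule continuous_on_eq) (rule hol2_swap(2)[OF f])
qed

text \<open>Osgood's lemma, with the coefficients obtained by expanding in the first variable and then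
  expanding the coefficients of that expansion in the second one.\<close>

lemma hol2_imp_analytic2_at:
  fixes f :: "complex \<times> complex \<Rightarrow> complex"
  assumes S: "open S" and f: "hol2 f S" and p: "p \<in> S"
  shows "analytic2_at f p"
proof -
  obtain r where r: "r > 0" "cball (fst p) r \<times> cball (snd p) r \<subseteq> S"
    by (rule open_contains_cball_Times[OF S p])
  define a b where "a = fst p" and "b = snd p"
  have inS: "(s, t) \<in> S" if "s \<in> cball a r" "t \<in> cball b r" for s t
    using r that by (auto simp: a_def b_def)
  have contf: "continuous_on (cball a r \<times> cball b r) f"
    using hol2_continuous_on[OF f] by (rule continuous_on_subset) (auto intro: inS)
  have "compact (f ` (cball a r \<times> cball b r))"
    by (intro compact_continuous_image contf compact_Times) auto
  then obtain M where M': "\<forall>y\<in>f ` (cball a r \<times> cball b r). norm y \<le> M"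
    using compact_imp_bounded bounded_iff by blast
  have M: "norm (f (s, t)) \<le> M" if "s \<in> cball a r" "t \<in> cball b r" for s t
    using M' that by blast
  \<comment> \<open>\<open>\<alpha> i v\<close> is the Taylor coefficient of order \<open>i\<close>
    of the slice at height \<open>v\<close>; its integral formula shows that it is holomorphic in
    \<open>v\<close>.\<close>
  define \<alpha> where "\<alpha> i v = (deriv ^^ i) (\<lambda>s. f (s, v)) a / fact i" for i v
  have hol: "(\<lambda>s. f (s, v)) holomorphic_on cball a r" if "v \<in> cball b r" for v
    using that by (intro hol2_slice1[OF f] inS)
  have \<alpha>_eq: "\<alpha> i v = 1 / (2 * pi * \<i>) * contour_integral (circlepath a r) (\<lambda>s. f (s, v) / (s - a)^Suc i)"
    if "v \<in> cball b r" for i v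
    unfolding \<alpha>_def using r hol[OF that]
    by (subst Cauchy_higher_derivative_integral_circlepath(2)[where r = r and z = a])
       (auto intro: holomorphic_on_imp_continuous_on holomorphic_on_subset)
  have \<alpha>_le: "norm (\<alpha> i v) \<le> M / r^i" if "v \<in> cball b r" for i v
  proof -
    have "norm ((deriv ^^ i) (\<lambda>s. f (s, v)) a) \<le> fact i * M / r^i"
      using hol[OF that] r that
      by (intro Cauchy_inequality M)
         (auto intro: holomorphic_on_imp_continuous_on holomorphic_on_subset simp: dist_norm)
    then show ?thesis by (simp add: \<alpha>_def norm_divide field_simps)
  qed
  have \<alpha>_hol: "\<alpha> i holomorphic_on ball b r" for i
  proof -
    have "(\<lambda>v. contour_integral (circlepath a r) (\<lambda>s. f (s, v) / (s - a)^Suc i)) holomorphic_on ball b r"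
    proof (rule contour_integral_circlepath_param_holomorphic[where F' = "\<lambda>v s. d2 f (s, v) / (s - a)^Suc i"])
      have *: "continuous_on (ball b r \<times> sphere a r) (\<lambda>(v, s). g (s, v) / (s - a)^Suc i)" if "continuous_on S g" for g
      proof -
        have "continuous_on (ball b r \<times> sphere a r) (\<lambda>x. g (snd x, fst x))"
          by (rule continuous_on_compose2[OF that]) (auto intro!: continuous_intros inS)
        then show ?thesis using r
          unfolding case_prod_unfold by (intro continuous_intros) auto
      qed
      show "continuous_on (ball b r \<times> sphere a r) (\<lambda>(v, s). f (s, v) / (s - a)^Suc i)"
        "continuous_on (ball b r \<times> sphere a r) (\<lambda>(v, s). d2 f (s, v) / (s - a)^Suc i)"
        by (intro * hol2_continuous_on[OF f] hol2_continuous_d2[OF S f])+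
      show "((\<lambda>v. f (s, v) / (s - a)^Suc i) has_field_derivative d2 f (s, v) / (s - a)^Suc i) (at v)"
        if "v \<in> ball b r" "s \<in> sphere a r" for v s
        using that by (intro DERIV_cdivide has_d12_slice(2)[OF hol2D[OF f]] inS) auto
    qed (use r in auto)
    then have "(\<lambda>v. 1 / (2 * pi * \<i>) * contour_integral (circlepath a r) (\<lambda>s. f (s, v) / (s - a)^Suc i))
        holomorphic_on ball b r"
      by (intro holomorphic_intros)
    then show ?thesis by (rule holomorphic_transform) (simp add: \<alpha>_eq)
  qed
  \<comment> \<open>\<open>\<alpha> i\<close> is known to be holomorphic on the open disc of radius
    \<open>r\<close> only, so the Cauchy inequality is used on a smaller circle. Weakening
    \<open>M / r^i\<close> to \<open>M / \<rho>^i\<close> then gives one radius for both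
    variables.\<close>
  define \<rho> where "\<rho> = r / 2"
  have \<rho>: "\<rho> > 0" "\<rho> < r" using r by (simp_all add: \<rho>_def)
  define c where "c i j = (deriv ^^ j) (\<alpha> i) b / fact j" for i j
  have c_le: "norm (c i j) * \<rho>^(i + j) \<le> M" for i j
  proof -
    have "norm ((deriv ^^ j) (\<alpha> i) b) \<le> fact j * (M / r^i) / \<rho>^j"
    proof (rule Cauchy_inequality)
      show "\<alpha> i holomorphic_on ball b \<rho>" "continuous_on (cball b \<rho>) (\<alpha> i)"
        using \<alpha>_hol[of i] \<rho> by (auto intro!: holomorphic_on_imp_continuous_on intro: holomorphic_on_subset)
      show "norm (\<alpha> i x) \<le> M / r^i" if "norm (b - x) = \<rho>" for x
        using that \<rho> by (intro \<alpha>_le) (simp add: dist_norm)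
    qed (fact \<rho>)
    then have "norm (c i j) \<le> M / r^i / \<rho>^j" by (simp add: c_def norm_divide field_simps)
    also have "\<dots> \<le> M / \<rho>^i / \<rho>^j"
    proof (intro divide_right_mono divide_left_mono power_mono)
      show "0 \<le> M" using M[of a b] r norm_ge_zero[of "f (a, b)"] by (metis centre_in_cball less_imp_le order_trans)
    qed (use \<rho> r in auto)
    finally show ?thesis using \<rho> by (simp add: field_simps power_add)
  qed
  have cb: "coeffs_bounded c \<rho> M"
    using c_le \<rho> by (simp add: coeffs_bounded_def)
  have "\<forall>\<^sub>F z in nhds p. f z = series2 c (z - p)"
    using eventually_near2[of "\<rho>/2" p, OF half_gt_zero[OF \<rho>(1)]]
  proof eventually_elim
    case (elim z)
    define x y where "x = fst (z - p)" and "y = snd (z - p)"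
    have xy: "norm x \<le> \<rho>/2" "norm y \<le> \<rho>/2" using elim by (simp_all add: x_def y_def)
    have zeq: "fst z = a + x" "snd z = b + y" by (simp_all add: x_def y_def a_def b_def)
    have in1: "a + x \<in> ball a r" "b + y \<in> ball b r"
      using xy \<rho> by (auto simp: dist_norm)
    have "((\<lambda>(i, j). c i j * x^i * y^j) has_sum series2 c (z - p)) UNIV"
      unfolding x_def y_def by (rule has_sum_series2[OF cb]) (use elim in auto)
    then have S1: "((\<lambda>(i, j). c i j * x^i * y^j) has_sum series2 c (z - p)) (SIGMA i:UNIV. UNIV)"
      by simp
    \<comment> \<open>Unconditional summability allows summing over \<open>j\<close> first. What
      remains is the Taylor series of the slice through \<open>b + y\<close>, whose sum is
      \<open>f z\<close>.\<close>
    have "((\<lambda>i. \<alpha> i (b + y) * x^i) has_sum series2 c (z - p)) UNIV"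
    proof (rule has_sum_SigmaD[OF S1])
      fix i
      have "(\<lambda>j. (deriv ^^ j) (\<alpha> i) b / fact j * (b + y - b)^j) sums \<alpha> i (b + y)"
        by (rule holomorphic_power_series[OF \<alpha>_hol in1(2)])
      then have s: "(\<lambda>j. c i j * x^i * y^j) sums (\<alpha> i (b + y) * x^i)"
        using sums_mult2[of "\<lambda>j. c i j * y^j" "\<alpha> i (b + y)" "x^i"] by (simp add: c_def mult_ac)
      have "summable (\<lambda>j. norm (c i j * x^i * y^j))"
      proof (rule summable_comparison_test')
        show "summable (\<lambda>j. M * (1/2)^i * (1/2::real)^j)" by (intro summable_mult) (simp add: summable_geometric)
        show "norm (norm (c i j * x^i * y^j)) \<le> M * (1/2)^i * (1/2)^j" if "j \<ge> 0" for j
          using coeffs_bounded_term[OF cb xy, of i j] by (simp add: mult.assoc)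
      qed
      from norm_summable_imp_has_sum[OF this s]
      show "((\<lambda>j. case (i, j) of (i, j) \<Rightarrow> c i j * x^i * y^j) has_sum \<alpha> i (b + y) * x^i) UNIV" by simp
    qed
    then have *: "(\<lambda>i. \<alpha> i (b + y) * x^i) sums series2 c (z - p)" by (rule has_sum_imp_sums)
    have "(\<lambda>s. f (s, b + y)) holomorphic_on ball a r"
      by (rule holomorphic_on_subset[OF hol]) (use in1 in auto)
    from holomorphic_power_series[OF this in1(1)]
    have "(\<lambda>i. (deriv ^^ i) (\<lambda>s. f (s, b + y)) a / fact i * (a + x - a)^i) sums f (a + x, b + y)" .
    moreover have "f z = f (a + x, b + y)" by (simp flip: zeq)
    ultimately have "(\<lambda>i. \<alpha> i (b + y) * x^i) sums f z"
      by (simp add: \<alpha>_def)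
    then show ?case using * by (rule sums_unique2)
  qed
  then show ?thesis unfolding analytic2_at_iff using cb by blast
qed

lemma analytic2_at_cong:
  assumes "analytic2_at h p" "\<forall>\<^sub>F z in nhds p. g z = h z"
  shows "analytic2_at g p"
proof -
  obtain c where "\<forall>\<^sub>F z in nhds p. ((\<lambda>(i, j). c i j * (fst z - fst p)^i * (snd z - snd p)^j) has_sum h z) UNIV"
    using assms(1) unfolding analytic2_at_def by blast
  with assms(2) have "\<forall>\<^sub>F z in nhds p. ((\<lambda>(i, j). c i j * (fst z - fst p)^i * (snd z - snd p)^j) has_sum g z) UNIV"
    by eventually_elim simp
  then show ?thesis unfolding analytic2_at_def by blast
qed

lemma analytic2_at_imp_hol2:
  fixes f :: "'a \<times> 'a \<Rightarrow> 'a::{real_normed_field,banach}"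
  assumes "analytic2_at f p"
  obtains S where "open S" "p \<in> S" "hol2 f S" "analytic2_at (d1 f) p" "analytic2_at (d2 f) p"
proof -
  obtain f1 f2 where f12: "analytic2_at f1 p" "analytic2_at f2 p"
    and ev: "\<forall>\<^sub>F z in nhds p. has_d12 f (f1 z) (f2 z) z"
    by (rule analytic2_at_has_derivative[OF assms])
  have "\<forall>\<^sub>F z in nhds p. d1 f z = f1 z" "\<forall>\<^sub>F z in nhds p. d2 f z = f2 z"
    using ev by (eventually_elim, simp add: has_d12_imp)+
  then have "analytic2_at (d1 f) p" "analytic2_at (d2 f) p"
    using analytic2_at_cong f12 by blast+
  moreover obtain S where "open S" "p \<in> S" "\<forall>z\<in>S. has_d12 f (f1 z) (f2 z) z"
    using ev unfolding eventually_nhds by blast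
  ultimately show ?thesis using that[of S] unfolding hol2_def by blast
qed

text \<open>By Osgood's lemma \<open>f\<close> is a power series near every point, and
  differentiating a power series yields one again.\<close>

lemma hol2_d12:
  fixes f :: "complex \<times> complex \<Rightarrow> complex"
  assumes "open S" "hol2 f S"
  shows "hol2 (d1 f) S" "hol2 (d2 f) S"
proof -
  have *: "analytic2_at (d1 f) z" "analytic2_at (d2 f) z" if "z \<in> S" for z
    using analytic2_at_imp_hol2[OF hol2_imp_analytic2_at[OF assms that]] by blast+
  have "\<exists>a b. has_d12 g a b z" if "analytic2_at g z" for g :: "complex \<times> complex \<Rightarrow> complex" and z
    using analytic2_at_imp_hol2[OF that] unfolding hol2_def by blast
  with * show "hol2 (d1 f) S" "hol2 (d2 f) S" unfolding hol2_def by blast+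
qed

section \<open>Elimination along the zero set of a holomorphic function\<close>

lemma holomorphic_order_factor:
  fixes f :: "complex \<Rightarrow> complex"
  assumes f: "f holomorphic_on ball 0 r" and r: "r > 0" and nz: "\<not> (\<forall>\<^sub>F u in nhds 0. f u = 0)"
  obtains n h \<rho> where "0 < \<rho>" "\<rho> \<le> r" "h holomorphic_on ball 0 \<rho>"
    "\<And>u. u \<in> ball 0 \<rho> \<Longrightarrow> h u \<noteq> 0 \<and> f u = u ^ n * h u"
proof -
  have "\<exists>w\<in>ball 0 r. f w \<noteq> 0"
  proof (rule ccontr)
    assume "\<not> ?thesis"
    then have "\<forall>\<^sub>F u in nhds 0. f u = 0"
      using r unfolding eventually_nhds by (intro exI[of _ "ball 0 r"]) auto
    with nz show False by simp
  qed
  then have ex: "\<exists>w\<in>ball 0 r. f w \<noteq> 0" .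
  have z0: "0 \<in> ball (0::complex) r" using r by simp
  obtain \<rho> where \<rho>: "\<rho> > 0" "cball (0::complex) \<rho> \<subseteq> ball 0 r" "zor_poly f 0 holomorphic_on cball 0 \<rho>"
    "\<forall>w\<in>cball 0 \<rho>. f w = zor_poly f 0 w * (w - 0) ^ nat (zorder f 0) \<and> zor_poly f 0 w \<noteq> 0"
    using conjunct2[OF zorder_exist_zero[OF f open_ball connected_ball z0 ex]]
    by (elim exE conjE) (rule that)
  have "zor_poly f 0 holomorphic_on ball 0 \<rho>"
    by (rule holomorphic_on_subset[OF \<rho>(3)]) auto
  moreover have "\<rho> \<le> r" using \<rho>(1,2) by (simp add: cball_subset_ball_iff)
  moreover have "zor_poly f 0 u \<noteq> 0 \<and> f u = u ^ nat (zorder f 0) * zor_poly f 0 u" if "u \<in> ball 0 \<rho>" for u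
    using bspec[OF \<rho>(4), of u] that by (simp add: mult.commute)
  ultimately show ?thesis using that \<rho>(1) by blast
qed

text \<open>Divisibility of germs at 0 in one variable: the radius is existentially quantified, so
  the quotient may live on a smaller disc than the two functions.\<close>

definition hol_dvd :: "(complex \<Rightarrow> complex) \<Rightarrow> (complex \<Rightarrow> complex) \<Rightarrow> bool" where
  "hol_dvd g f \<longleftrightarrow> (\<exists>\<rho> q. 0 < \<rho> \<and> q holomorphic_on ball 0 \<rho> \<and> (\<forall>u\<in>ball 0 \<rho>. f u = q u * g u))"

lemma hol_dvd_refl: "hol_dvd f f"
  unfolding hol_dvd_def by (intro exI[of _ 1] exI[of _ "\<lambda>_. 1"]) auto

lemma hol_dvd_trans:
  assumes "hol_dvd h g" "hol_dvd g f"
  shows "hol_dvd h f"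
proof -
  obtain a p where p: "0 < a" "p holomorphic_on ball 0 a" "\<And>u. u \<in> ball 0 a \<Longrightarrow> g u = p u * h u"
    using assms(1) unfolding hol_dvd_def by blast
  obtain b q where q: "0 < b" "q holomorphic_on ball 0 b" "\<And>u. u \<in> ball 0 b \<Longrightarrow> f u = q u * g u"
    using assms(2) unfolding hol_dvd_def by blast
  have "(\<lambda>u. q u * p u) holomorphic_on ball 0 (min a b)"
    by (intro holomorphic_intros holomorphic_on_subset[OF p(2)] holomorphic_on_subset[OF q(2)]) auto
  moreover have "f u = q u * p u * h u" if "u \<in> ball 0 (min a b)" for u
    using that p(3)[of u] q(3)[of u] by simp
  moreover have "0 < min a b" using p q by simp
  ultimately show ?thesis unfolding hol_dvd_def by blast
qed

text \<open>A nonzero germ in one variable is a power of \<open>u\<close> times a unit, so the germ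
  of smaller order divides the other; the zero germ is divisible by everything.\<close>

lemma hol_dvd_linear:
  assumes f: "f holomorphic_on ball 0 r" and g: "g holomorphic_on ball 0 r" and r: "r > 0"
  shows "hol_dvd g f \<or> hol_dvd f g"
proof -
  have zero: "hol_dvd h k" if kz: "\<forall>\<^sub>F u in nhds 0. k u = 0" for h k :: "complex \<Rightarrow> complex"
  proof -
    obtain \<rho> where "\<rho> > 0" "\<forall>u. dist u 0 < \<rho> \<longrightarrow> k u = 0"
      using kz unfolding eventually_nhds_metric by blast
    then show ?thesis
      unfolding hol_dvd_def by (intro exI[of _ \<rho>] exI[of _ "\<lambda>_. 0"]) (auto simp: dist_norm)
  qed
  have main: "hol_dvd k h"
    if h: "0 < a" "h1 holomorphic_on ball 0 a" "\<And>u. u \<in> ball 0 a \<Longrightarrow> h1 u \<noteq> 0 \<and> h u = u ^ n * h1 u"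
      and k: "0 < b" "k1 holomorphic_on ball 0 b" "\<And>u. u \<in> ball 0 b \<Longrightarrow> k1 u \<noteq> 0 \<and> k u = u ^ m * k1 u"
      and mn: "m \<le> n" for a b h h1 k k1 m n
  proof -
    have "(\<lambda>u. u ^ (n - m) * h1 u / k1 u) holomorphic_on ball 0 (min a b)"
      using k(3) by (intro holomorphic_intros holomorphic_on_subset[OF h(2)] holomorphic_on_subset[OF k(2)]) auto
    moreover have "h u = u ^ (n - m) * h1 u / k1 u * k u" if "u \<in> ball 0 (min a b)" for u
      using that h(3)[of u] k(3)[of u] mn by (simp flip: power_add)
    moreover have "0 < min a b" using h k by simp
    ultimately show ?thesis unfolding hol_dvd_def by blast
  qed
  show ?thesis
  proof (cases "(\<forall>\<^sub>F u in nhds 0. f u = 0) \<or> (\<forall>\<^sub>F u in nhds 0. g u = 0)")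
    case True
    then show ?thesis using zero by blast
  next
    case False
    obtain n f1 a where F: "0 < a" "f1 holomorphic_on ball 0 a" "\<And>u. u \<in> ball 0 a \<Longrightarrow> f1 u \<noteq> 0 \<and> f u = u ^ n * f1 u"
      using holomorphic_order_factor[OF f r] False by metis
    obtain m g1 b where G: "0 < b" "g1 holomorphic_on ball 0 b" "\<And>u. u \<in> ball 0 b \<Longrightarrow> g1 u \<noteq> 0 \<and> g u = u ^ m * g1 u"
      using holomorphic_order_factor[OF g r] False by metis
    show ?thesis
    proof (cases "m \<le> n")
      case True
      then show ?thesis using main[OF F G] by blast
    next
      case False
      then show ?thesis using main[OF G F] by simp
    qed
  qed
qed

text \<open>Divisibility is total and transitive, so a finite nonempty family has a least
  member.\<close>

lemma hol_dvd_pivot: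
  assumes "finite I" "I \<noteq> {}" and "\<And>i. i \<in> I \<Longrightarrow> R i holomorphic_on ball 0 r" and r: "r > 0"
  obtains i0 where "i0 \<in> I" "\<And>i. i \<in> I \<Longrightarrow> hol_dvd (R i0) (R i)"
proof -
  have "\<exists>i0\<in>I. \<forall>i\<in>I. hol_dvd (R i0) (R i)"
    using assms(1-3)
  proof (induction I rule: finite_ne_induct)
    case (singleton x)
    then show ?case by (simp add: hol_dvd_refl)
  next
    case (insert x F)
    then obtain i0 where i0: "i0 \<in> F" "\<forall>i\<in>F. hol_dvd (R i0) (R i)" by auto
    consider "hol_dvd (R i0) (R x)" | "hol_dvd (R x) (R i0)"
      using hol_dvd_linear[of "R i0" r "R x"] insert.prems i0 r by auto
    then show ?case
    proof cases
      case 1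
      with i0 show ?thesis by blast
    next
      case 2
      with i0 have "\<forall>i\<in>F. hol_dvd (R x) (R i)" using hol_dvd_trans by blast
      then show ?thesis by (simp add: hol_dvd_refl)
    qed
  qed
  then show ?thesis using that by blast
qed

text \<open>Gaussian elimination over the discrete valuation ring of germs: pivoting on an entry of
  minimal order keeps the solution from vanishing at \<open>0\<close>.\<close>

lemma holomorphic_kernel:
  fixes M :: "nat \<Rightarrow> 'i \<Rightarrow> complex \<Rightarrow> complex"
  assumes "finite I" "n < card I" "0 < r"
    and "\<And>m i. m < n \<Longrightarrow> i \<in> I \<Longrightarrow> M m i holomorphic_on ball 0 r"
  shows "\<exists>\<rho> c. 0 < \<rho> \<and> (\<forall>i\<in>I. c i holomorphic_on ball 0 \<rho>) \<and> (\<exists>i\<in>I. c i 0 \<noteq> 0) \<and>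
           (\<forall>u\<in>ball 0 \<rho>. \<forall>m<n. (\<Sum>i\<in>I. M m i u * c i u) = 0)"
  using assms
proof (induction n arbitrary: I r M)
  case 0
  then have "I \<noteq> {}" by auto
  then show ?case
    by (intro exI[of _ 1] exI[of _ "\<lambda>_ _. 1"]) auto
next
  case (Suc n)
  have "I \<noteq> {}" using Suc.prems by auto
  then obtain i0 where i0: "i0 \<in> I" "\<And>i. i \<in> I \<Longrightarrow> hol_dvd (M n i0) (M n i)"
    using hol_dvd_pivot[of I "M n" r] Suc.prems by auto
  have "\<forall>i\<in>I. \<exists>\<rho> q. 0 < \<rho> \<and> q holomorphic_on ball 0 \<rho> \<and> (\<forall>u\<in>ball 0 \<rho>. M n i u = q u * M n i0 u)"
    using i0(2) unfolding hol_dvd_def by blast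
  then obtain R q where q: "\<And>i. i \<in> I \<Longrightarrow> 0 < R i" "\<And>i. i \<in> I \<Longrightarrow> q i holomorphic_on ball 0 (R i)"
    "\<And>i u. i \<in> I \<Longrightarrow> u \<in> ball 0 (R i) \<Longrightarrow> M n i u = q i u * M n i0 u"
    by metis
  define r' where "r' = Min (insert r (R ` I))"
  have r': "0 < r'" "r' \<le> r" "\<And>i. i \<in> I \<Longrightarrow> r' \<le> R i"
    using Suc.prems q(1) by (auto simp: r'_def)
  have qh: "q i holomorphic_on ball 0 r'" if "i \<in> I" for i
    by (rule holomorphic_on_subset[OF q(2)[OF that]]) (use r'(3)[OF that] in auto)
  have Mh: "M m i holomorphic_on ball 0 r'" if "m \<le> n" "i \<in> I" for m i
    by (rule holomorphic_on_subset[OF Suc.prems(4)]) (use that r'(2) in auto)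
  define I' where "I' = I - {i0}"
  have I: "finite I'" "I = insert i0 I'" "i0 \<notin> I'" and card: "n < card I'"
    using Suc.prems i0(1) by (auto simp: I'_def)
  \<comment> \<open>Row \<open>n\<close> is solved for the unknown \<open>i0\<close>; substituting
    the solution into the rows \<open>m < n\<close> leaves these \<open>n\<close> equations in one
    unknown fewer.\<close>
  have "\<exists>\<rho> c. 0 < \<rho> \<and> (\<forall>i\<in>I'. c i holomorphic_on ball 0 \<rho>) \<and> (\<exists>i\<in>I'. c i 0 \<noteq> 0) \<and>
           (\<forall>u\<in>ball 0 \<rho>. \<forall>m<n. (\<Sum>i\<in>I'. (M m i u - M m i0 u * q i u) * c i u) = 0)"
    using Suc.IH[OF I(1) card r'(1), of "\<lambda>m i u. M m i u - M m i0 u * q i u"]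
    by (simp add: I holomorphic_intros Mh qh)
  then obtain \<rho> c where c: "0 < \<rho>" "\<forall>i\<in>I'. c i holomorphic_on ball 0 \<rho>" "\<exists>i\<in>I'. c i 0 \<noteq> 0"
    "\<forall>u\<in>ball 0 \<rho>. \<forall>m<n. (\<Sum>i\<in>I'. (M m i u - M m i0 u * q i u) * c i u) = 0"
    by blast
  \<comment> \<open>Since \<open>M n i = q i * M n i0\<close>, this value at \<open>i0\<close> makes
    row \<open>n\<close> a multiple of 0. There is no division by the pivot, so a row of zero germs
    is covered too, and an entry that is nonzero at 0 is inherited from \<open>c\<close>.\<close>
  define c' where "c' i = (if i = i0 then (\<lambda>u. - (\<Sum>i\<in>I'. q i u * c i u)) else c i)" for i
  define \<rho>' where "\<rho>' = min \<rho> r'"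
  have ch: "c i holomorphic_on ball 0 \<rho>'" if "i \<in> I'" for i
    by (rule holomorphic_on_subset[OF c(2)[rule_format, OF that]]) (auto simp: \<rho>'_def)
  have qh': "q i holomorphic_on ball 0 \<rho>'" if "i \<in> I'" for i
    by (rule holomorphic_on_subset[OF qh]) (use that I in \<open>auto simp: \<rho>'_def\<close>)
  have "0 < \<rho>'" using c(1) r'(1) by (simp add: \<rho>'_def)
  moreover have "\<forall>i\<in>I. c' i holomorphic_on ball 0 \<rho>'"
    using ch qh' by (auto simp: c'_def I intro!: holomorphic_intros)
  moreover have "\<exists>i\<in>I. c' i 0 \<noteq> 0"
    using c(3) I by (auto simp: c'_def)
  moreover have "(\<Sum>i\<in>I. M m i u * c' i u) = 0" if u: "u \<in> ball 0 \<rho>'" and m: "m < Suc n" for u m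
  proof -
    have "(\<Sum>i\<in>I. M m i u * c' i u) = M m i0 u * c' i0 u + (\<Sum>i\<in>I'. M m i u * c' i u)"
      using I by simp
    also have "(\<Sum>i\<in>I'. M m i u * c' i u) = (\<Sum>i\<in>I'. M m i u * c i u)"
      using I by (intro sum.cong) (auto simp: c'_def)
    also have "M m i0 u * c' i0 u = - (\<Sum>i\<in>I'. M m i0 u * q i u * c i u)"
      by (simp add: c'_def sum_distrib_left mult.assoc)
    finally have *: "(\<Sum>i\<in>I. M m i u * c' i u) = (\<Sum>i\<in>I'. (M m i u - M m i0 u * q i u) * c i u)"
      by (simp add: left_diff_distrib sum_subtractf)
    show ?thesis
    proof (cases "m = n")
      case True
      have "M n i u = q i u * M n i0 u" if "i \<in> I'" for i
        using u that I r'(3)[of i] by (intro q(3)) (auto simp: \<rho>'_def)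
      then have "(\<Sum>i\<in>I'. (M m i u - M m i0 u * q i u) * c i u) = 0"
        using True by (intro sum.neutral) simp
      then show ?thesis unfolding * .
    next
      case False
      then show ?thesis unfolding * using u m by (intro c(4)[rule_format]) (auto simp: \<rho>'_def)
    qed
  qed
  ultimately show ?case by blast
qed

section \<open>Zeros in a disc: growth and moments\<close>

text \<open>For a zero in the disc of radius \<open>r\<close>, the linear factor is at least twice
  as large on the circle of radius \<open>5 * r\<close> as anywhere in that disc. This ratio is the
  \<open>1/2\<close> in \<open>factor_out_zeros\<close>.\<close>

lemma prod_list_linear_bounds:
  fixes as :: "complex list"
  assumes "set as \<subseteq> ball 0 r" "r > 0"
  shows "norm v \<le> r \<Longrightarrow> norm (\<Prod>a\<leftarrow>as. v - a) \<le> (2 * r) ^ length as"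
    and "norm v = 5 * r \<Longrightarrow> norm (\<Prod>a\<leftarrow>as. v - a) \<ge> (4 * r) ^ length as"
  using assms(1)
proof (induction as)
  case (Cons a as)
  case 1
  have "norm (v - a) \<le> 2 * r"
    using 1 norm_triangle_ineq4[of v a] by (simp add: dist_norm)
  then show ?case
    unfolding list.map prod_list.Cons norm_mult length_Cons power_Suc
    using 1 Cons.IH(1) assms(2) by (intro mult_mono) auto
next
  case (Cons a as)
  case 2
  have "norm (v - a) \<ge> 4 * r"
    using 2 norm_triangle_ineq2[of v a] by (simp add: dist_norm)
  then show ?case
    unfolding list.map prod_list.Cons norm_mult length_Cons power_Suc
    using 2 Cons.IH(2) assms(2) by (intro mult_mono) auto
qed auto

text \<open>The growth of \<open>f\<close> bounds the number of its zeros by \<open>N\<close>, uniformly in \<open>f\<close>; this replaces the Weierstrass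
  preparation theorem.\<close>

lemma factor_out_zeros:
  assumes r: "0 < r" and f: "f holomorphic_on ball 0 (6 * r)"
    and M: "\<And>v. norm v = 5 * r \<Longrightarrow> norm (f v) \<le> M"
    and v1: "norm v1 \<le> r" and N: "M * (1/2) ^ N < norm (f v1)"
  shows "\<exists>as g. length as < N \<and> set as \<subseteq> ball 0 r \<and> g holomorphic_on ball 0 (6 * r) \<and>
    (\<forall>v\<in>ball 0 (6 * r). f v = (\<Prod>a\<leftarrow>as. v - a) * g v) \<and> (\<forall>v\<in>ball 0 r. g v \<noteq> 0)"
proof -
  define P where "P as g \<longleftrightarrow> set as \<subseteq> ball 0 r \<and> g holomorphic_on ball 0 (6 * r) \<and>
    (\<forall>v\<in>ball 0 (6 * r). f v = (\<Prod>a\<leftarrow>as. v - a) * g v)" for as g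
  have M0: "0 \<le> M"
    using order_trans[OF norm_ge_zero M[of "of_real (5 * r)"]] r by simp
  have bound: "length as < N" if "P as g" for as g
  proof (rule ccontr)
    assume "\<not> length as < N"
    then have len: "N \<le> length as" by simp
    define n where "n = length as"
    have P: "set as \<subseteq> ball 0 r" "g holomorphic_on ball 0 (6 * r)"
      "\<And>v. v \<in> ball 0 (6 * r) \<Longrightarrow> f v = (\<Prod>a\<leftarrow>as. v - a) * g v"
      using that by (auto simp: P_def)
    have gb: "norm (g v) \<le> M / (4 * r) ^ n" if v: "norm v = 5 * r" for v
    proof -
      have "(4 * r) ^ n * norm (g v) \<le> norm (\<Prod>a\<leftarrow>as. v - a) * norm (g v)"
        unfolding n_def by (intro mult_right_mono prod_list_linear_bounds(2)[OF P(1) r v]) auto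
      also have "\<dots> = norm (f v)"
        using P(3)[of v] v r by (simp add: norm_mult)
      also have "\<dots> \<le> M" by (rule M[OF v])
      finally show ?thesis using r by (simp add: field_simps)
    qed
    \<comment> \<open>The maximum principle carries the bound for the cofactor from the circle of
      radius \<open>5 * r\<close> inward to \<open>v1\<close>.\<close>
    have "norm (g v1) \<le> M / (4 * r) ^ n"
    proof (rule maximum_modulus_frontier[of g "cball 0 (5 * r)"])
      show "g holomorphic_on interior (cball 0 (5 * r))"
        by (rule holomorphic_on_subset[OF P(2)]) (use r in auto)
      show "continuous_on (closure (cball 0 (5 * r))) g"
        by (rule continuous_on_subset[OF holomorphic_on_imp_continuous_on[OF P(2)]]) (use r in auto)
      show "norm (g z) \<le> M / (4 * r) ^ n" if "z \<in> frontier (cball 0 (5 * r))" for z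
        using that r by (intro gb) (simp add: frontier_cball)
    qed (use v1 r in auto)
    moreover have "norm (f v1) = norm (\<Prod>a\<leftarrow>as. v1 - a) * norm (g v1)"
      using P(3)[of v1] v1 r by (simp add: norm_mult)
    moreover have "norm (\<Prod>a\<leftarrow>as. v1 - a) \<le> (2 * r) ^ n"
      unfolding n_def by (rule prod_list_linear_bounds(1)[OF P(1) r v1])
    ultimately have "norm (f v1) \<le> (2 * r) ^ n * (M / (4 * r) ^ n)"
      using r by (simp only:) (intro mult_mono, auto)
    also have "\<dots> = M * (1/2) ^ n"
    proof -
      have "(2 * r) / (4 * r) = 1/2" using r by simp
      then show ?thesis by (metis (no_types) mult.commute power_divide times_divide_eq_right)
    qed
    also have "\<dots> \<le> M * (1/2) ^ N"
      using len M0 by (intro mult_left_mono power_decreasing) (auto simp: n_def)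
    finally show False using N by simp
  qed
  have "P [] f" using f by (simp add: P_def)
  define Q where "Q n \<longleftrightarrow> (\<exists>as g. length as = n \<and> P as g)" for n
  have "Q 0" using \<open>P [] f\<close> unfolding Q_def by force
  have Q_le: "k \<le> N" if "Q k" for k
    using that bound unfolding Q_def by (blast intro: less_imp_le)
  \<comment> \<open>As many zeros as possible are split off. The bound just shown guarantees that a
    maximum exists, and maximality leaves the cofactor without zeros in the disc.\<close>
  define n where "n = Greatest Q"
  have "Q n" unfolding n_def by (rule GreatestI_nat[where P = Q, OF \<open>Q 0\<close> Q_le])
  have n: "k \<le> n" if "Q k" for k
    unfolding n_def by (rule Greatest_le_nat[where P = Q, OF that Q_le])
  from \<open>Q n\<close> obtain as g where as: "length as = n" "P as g" unfolding Q_def by blast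
  have "g a \<noteq> 0" if a: "a \<in> ball 0 r" for a
  proof
    assume ga: "g a = 0"
    \<comment> \<open>The quotient by \<open>z - a\<close>, continued over the removable singularity
      by the value \<open>deriv g a\<close>.\<close>
    define h where "h z = (if z = a then deriv g a else (g z - g a) / (z - a))" for z
    have "h holomorphic_on ball 0 (6 * r)"
      unfolding h_def using as by (intro pole_lemma_open) (auto simp: P_def)
    moreover have "g z = (z - a) * h z" for z
      by (simp add: h_def ga)
    ultimately have "P (a # as) h"
      using as a by (auto simp: P_def mult_ac)
    then have "Suc n \<le> n"
      using as(1) unfolding Q_def by (intro n[unfolded Q_def] exI[of _ "a # as"] exI[of _ h]) simp
    then show False by simp
  qed
  then show ?thesis using as bound[OF as(2)] unfolding P_def by blast
qed

lemma poly_prod_list_linear: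
  fixes bs :: "complex list"
  shows "\<exists>e. \<forall>v. (\<Prod>b\<leftarrow>bs. v - b) = (\<Sum>m\<le>length bs. e m * v ^ m)"
proof -
  define p where "p = (\<Prod>b\<leftarrow>bs. [:- b, 1:])"
  have "degree p \<le> sum_list (map degree (map (\<lambda>b. [:- b, 1:]) bs))"
    unfolding p_def by (rule degree_prod_list_le)
  also have "\<dots> = length bs" by (induction bs) auto
  finally have deg: "degree p \<le> length bs" .
  have "poly p v = (\<Prod>b\<leftarrow>bs. v - b)" for v
    unfolding p_def by (induction bs) (auto simp: left_diff_distrib)
  moreover have "poly p v = (\<Sum>m\<le>length bs. Polynomial.coeff p m * v ^ m)" for v
    unfolding poly_altdef by (rule sum.mono_neutral_left) (use deg in \<open>auto simp: coeff_eq_0\<close>)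
  ultimately show ?thesis by metis
qed

text \<open>Write \<open>f\<close> as \<open>v - v0\<close> times the product of the other linear
  factors times \<open>g\<close>. Multiplying \<open>h / f\<close> by that product leaves
  \<open>h / g\<close> over \<open>v - v0\<close>, whose integral is
  \<open>2 * pi * \<i> * h v0 / g v0\<close> by Cauchy's formula. The product is a polynomial of
  degree below \<open>N\<close>, so the integral is also a combination of the given moments and
  vanishes. A bound on the number of zeros thus tells how many moments suffice.\<close>

lemma moments_vanish_imp_zero:
  assumes r: "0 < r" and f: "f holomorphic_on ball 0 (6 * r)" and h: "h holomorphic_on ball 0 (6 * r)"
    and M: "\<And>v. norm v = 5 * r \<Longrightarrow> norm (f v) \<le> M"
    and v1: "norm v1 \<le> r" and N: "M * (1/2) ^ N < norm (f v1)"
    and nz: "\<And>v. norm v = r \<Longrightarrow> f v \<noteq> 0"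
    and mom: "\<And>m. m < N \<Longrightarrow> contour_integral (circlepath 0 r) (\<lambda>v. h v * v ^ m / f v) = 0"
    and v0: "v0 \<in> ball 0 r" "f v0 = 0"
  shows "h v0 = 0"
proof -
  obtain as g where as: "length as < N" "set as \<subseteq> ball 0 r" and g: "g holomorphic_on ball 0 (6 * r)"
    and fg': "\<forall>v\<in>ball 0 (6 * r). f v = (\<Prod>a\<leftarrow>as. v - a) * g v"
    and gnz': "\<forall>v\<in>ball 0 r. g v \<noteq> 0"
    using factor_out_zeros[OF r f M v1 N] by blast
  note fg = fg'[rule_format] and gnz = gnz'[rule_format]
  have in6: "cball 0 r \<subseteq> ball 0 (6 * r)" using r by auto
  have gnz': "g v \<noteq> 0" if "v \<in> cball 0 r" for v
  proof (cases "norm v = r")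
    case True
    then have "f v \<noteq> 0" by (rule nz)
    moreover have "f v = (\<Prod>a\<leftarrow>as. v - a) * g v"
      by (rule fg) (use r True in simp)
    ultimately show ?thesis by auto
  next
    case False
    then show ?thesis using gnz[of v] that by simp
  qed
  have "(\<Prod>a\<leftarrow>as. v0 - a) = 0"
    using fg[of v0] v0 gnz[of v0] r by auto
  then have "v0 \<in> set as" by (induction as) auto
  \<comment> \<open>Only one copy of \<open>v0\<close> is removed: at a multiple zero the other
    copies stay in \<open>bs\<close> and cancel against \<open>f\<close>, so that a simple pole
    remains.\<close>
  define bs where "bs = remove1 v0 as"
  have prod: "(\<Prod>a\<leftarrow>as. v - a) = (v - v0) * (\<Prod>b\<leftarrow>bs. v - b)" for v
    using \<open>v0 \<in> set as\<close> unfolding bs_def by (induction as) auto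
  have "length bs \<le> length as" by (simp add: bs_def length_remove1)
  then have len: "length bs < N" using as(1) by simp
  obtain e where e: "\<forall>v. (\<Prod>b\<leftarrow>bs. v - b) = (\<Sum>m\<le>length bs. e m * v ^ m)"
    using poly_prod_list_linear by blast
  have cont: "continuous_on (path_image (circlepath 0 r)) (\<lambda>v. h v * v ^ m / f v)" for m
    using r in6 nz
    by (intro continuous_intros continuous_on_subset[OF holomorphic_on_imp_continuous_on[OF f]]
        continuous_on_subset[OF holomorphic_on_imp_continuous_on[OF h]]) auto
  have int: "(\<lambda>v. e m * (h v * v ^ m / f v)) contour_integrable_on circlepath 0 r" for m
    by (intro contour_integrable_lmul contour_integrable_continuous_circlepath cont)
  have "contour_integral (circlepath 0 r) (\<lambda>v. h v / g v / (v - v0))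
      = contour_integral (circlepath 0 r) (\<lambda>v. \<Sum>m\<le>length bs. e m * (h v * v ^ m / f v))"
  proof (rule contour_integral_eq)
    fix v assume "v \<in> path_image (circlepath 0 r)"
    then have v: "norm v = r" using r by simp
    then have fv: "f v = (v - v0) * (\<Prod>b\<leftarrow>bs. v - b) * g v" "v \<noteq> v0" "f v \<noteq> 0"
      using fg[of v] prod v0 nz[of v] r by auto
    have "(\<Sum>m\<le>length bs. e m * (h v * v ^ m / f v)) = h v * (\<Prod>b\<leftarrow>bs. v - b) / f v"
      unfolding e[rule_format] by (simp add: sum_distrib_left sum_divide_distrib mult_ac)
    also have "\<dots> = h v / g v / (v - v0)"
    proof -
      have "g v \<noteq> 0" "(\<Prod>b\<leftarrow>bs. v - b) \<noteq> 0" "v - v0 \<noteq> 0" using fv by auto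
      then show ?thesis unfolding fv(1) by (simp add: divide_simps)
    qed
    finally show "h v / g v / (v - v0) = (\<Sum>m\<le>length bs. e m * (h v * v ^ m / f v))" ..
  qed
  also have "\<dots> = (\<Sum>m\<le>length bs. contour_integral (circlepath 0 r) (\<lambda>v. e m * (h v * v ^ m / f v)))"
    by (intro contour_integral_sum int) auto
  also have "\<dots> = (\<Sum>m\<le>length bs. e m * contour_integral (circlepath 0 r) (\<lambda>v. h v * v ^ m / f v))"
    by (intro sum.cong refl contour_integral_lmul contour_integrable_continuous_circlepath cont)
  also have "\<dots> = 0"
    using len by (intro sum.neutral) (simp add: mom)
  finally have "contour_integral (circlepath 0 r) (\<lambda>v. h v / g v / (v - v0)) = 0" .
  moreover have "((\<lambda>v. h v / g v / (v - v0)) has_contour_integral (2 * of_real pi * \<i> * (h v0 / g v0)))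
      (circlepath 0 r)"
    using gnz' v0 in6
    by (intro Cauchy_integral_circlepath_simple holomorphic_intros holomorphic_on_subset[OF h]
        holomorphic_on_subset[OF g])
       auto
  ultimately have "2 * of_real pi * \<i> * (h v0 / g v0) = 0"
    by (metis contour_integral_unique)
  then show ?thesis using gnz[OF v0(1)] by simp
qed

text \<open>The form \<open>\<Sum>i\<le>d. c i * A\<^bsup>i\<^esup> * B\<^bsup>d-i\<^esup>\<close> with coefficients depending on the first variable is made divisible by
  \<open>D\<close> in the second variable, by requiring finitely many moments to vanish; \<open>(A, B) = s (w\<^sub>1, w\<^sub>2)\<close> turns it into
  \<open>s\<^bsup>d\<^esup>\<close> times a nonzero number.\<close>

lemma zero_direction_form:
  fixes A B D :: "complex \<times> complex \<Rightarrow> complex"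
  assumes S: "open S" "(0, 0) \<in> S" and D: "hol2 D S" and A: "hol2 A S" and B: "hol2 B S"
    and reg: "\<not> (\<forall>\<^sub>F v in nhds 0. D (0, v) = 0)"
  shows "\<exists>d c. (\<exists>i\<le>d. c i \<noteq> 0) \<and>
    (\<forall>w1 w2. (\<Sum>i\<le>d. c i * w1 ^ i * w2 ^ (d - i)) \<noteq> 0 \<longrightarrow>
       (\<forall>\<^sub>F z in nhds (0, 0). D z = 0 \<longrightarrow> (\<forall>s. A z = s * w1 \<longrightarrow> B z = s * w2 \<longrightarrow> s = 0)))"
proof -
  obtain R where R: "R > 0" "cball 0 R \<times> cball 0 R \<subseteq> S"
    using open_contains_cball_Times[OF S] by auto
  have inS: "(u, v) \<in> S" if "norm u \<le> R" "norm v \<le> R" for u v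
    using R(2) that by (auto simp: subset_iff)
  have "(\<lambda>v. D (0, v)) holomorphic_on ball 0 R"
    by (rule hol2_slice2[OF D]) (use R(1) in \<open>auto intro: inS\<close>)
  then obtain n h \<rho> where \<rho>: "0 < \<rho>" "\<rho> \<le> R" and h: "\<And>v. v \<in> ball 0 \<rho> \<Longrightarrow> h v \<noteq> 0 \<and> D (0, v) = v ^ n * h v"
    using holomorphic_order_factor[OF _ R(1) reg] by metis
  \<comment> \<open>Small enough that the circle of radius \<open>r\<close> carries no zero of
    \<open>D (0, _)\<close>, and with room within \<open>R\<close> for the radii
    \<open>5 * r\<close> and \<open>6 * r\<close> of \<open>factor_out_zeros\<close>.\<close>
  define r where "r = \<rho> / 7"
  have r: "0 < r" "7 * r \<le> R" using \<rho> by (auto simp: r_def)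
  have D0: "D (0, v) \<noteq> 0" if "norm v = r" for v
    using h[of v] that r \<rho> by (auto simp: r_def)
  have contD: "continuous_on (cball 0 R \<times> cball 0 R) D"
    by (rule continuous_on_subset[OF hol2_continuous_on[OF D] R(2)])
  have "compact (D ` (cball 0 R \<times> cball 0 R))"
    by (intro compact_continuous_image contD compact_Times compact_cball)
  then obtain M where M: "\<And>y. y \<in> D ` (cball 0 R \<times> cball 0 R) \<Longrightarrow> norm y \<le> M"
    using compact_imp_bounded bounded_iff by metis
  have M: "norm (D (u, v)) \<le> M" if "norm u \<le> R" "norm v \<le> R" for u v
    by (rule M) (use that in auto)
  \<comment> \<open>A lower bound for \<open>D\<close> on the circle over \<open>u = 0\<close>.
    Uniform continuity keeps half of it for \<open>norm u < \<eta>\<close>, so no zero crosses the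
    circle while \<open>u\<close> varies.\<close>
  obtain \<delta> where \<delta>: "\<delta> > 0" "\<And>v. norm v = r \<Longrightarrow> \<delta> \<le> norm (D (0, v))"
  proof -
    have "continuous_on (sphere 0 r) (\<lambda>v. norm (D (0, v)))"
      using \<rho> r by (intro continuous_intros continuous_on_compose2[OF contD]) auto
    moreover have "sphere 0 r \<noteq> ({} :: complex set)" using r by simp
    ultimately obtain v0 where "v0 \<in> sphere 0 r" "\<forall>v\<in>sphere 0 r. norm (D (0, v0)) \<le> norm (D (0, v))"
      using continuous_attains_inf[OF compact_sphere] by blast
    then show ?thesis using D0 that[of "norm (D (0, v0))"] by auto
  qed
  have "uniformly_continuous_on (cball 0 R \<times> cball 0 R) D"
    by (intro compact_uniformly_continuous contD compact_Times compact_cball)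
  then obtain \<eta>0 where \<eta>0: "\<eta>0 > 0"
    "\<And>z w. z \<in> cball 0 R \<times> cball 0 R \<Longrightarrow> w \<in> cball 0 R \<times> cball 0 R \<Longrightarrow> dist w z < \<eta>0 \<Longrightarrow> dist (D w) (D z) < \<delta>/2"
    unfolding uniformly_continuous_on_def using \<delta>(1) half_gt_zero by metis
  define \<eta> where "\<eta> = min \<eta>0 r"
  have \<eta>: "\<eta> > 0" "\<eta> \<le> r" using \<eta>0 r by (auto simp: \<eta>_def)
  have D\<delta>: "norm (D (u, v)) > \<delta>/2" if "norm u < \<eta>" "norm v = r" for u v
  proof -
    have "dist (D (u, v)) (D (0, v)) < \<delta>/2"
      using that r \<eta> by (intro \<eta>0(2)) (auto simp: dist_Pair_Pair \<eta>_def)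
    then show ?thesis
      using \<delta>(2)[OF that(2)] norm_triangle_ineq2[of "D (0, v)" "D (u, v)"] by (simp add: dist_norm norm_minus_commute)
  qed
  \<comment> \<open>The growth condition of \<open>moments_vanish_imp_zero\<close> will be tested at
    the point \<open>r\<close> of the circle, where \<open>norm (D (u, r))\<close> exceeds
    \<open>\<delta>/2\<close>; so one \<open>N\<close> serves all \<open>u\<close>.\<close>
  obtain N0 where N0: "M * (1/2) ^ N0 < \<delta>/2"
  proof -
    have "(\<lambda>n. M * (1/2) ^ n) \<longlonglongrightarrow> M * 0"
      by (intro tendsto_mult tendsto_const LIMSEQ_power_zero) simp
    then have "\<forall>\<^sub>F n in sequentially. M * (1/2) ^ n < \<delta>/2"
      by (rule order_tendstoD) (use \<delta> in simp)
    then show ?thesis using that by (auto simp: eventually_sequentially)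
  qed
  define N where "N = Suc N0"
  have M0: "0 \<le> M" using order_trans[OF norm_ge_zero M[of 0 0]] R(1) by simp
  have "M * (1/2) ^ N \<le> M * (1/2) ^ N0"
    using M0 by (intro mult_left_mono power_decreasing) (auto simp: N_def)
  with N0 have N: "M * (1/2) ^ N < \<delta>/2" by simp
  define S' where "S' = {z \<in> S. D z \<noteq> 0}"
  have "open (S \<inter> D -` (- {0}))"
    by (intro continuous_open_preimage hol2_continuous_on D S(1) open_Compl closed_singleton)
  moreover have "S' = S \<inter> D -` (- {0})" by (auto simp: S'_def)
  ultimately have S': "open S'" by simp
  define K where "K m i z = A z ^ i * B z ^ (N - i) * snd z ^ m * inverse (D z)" for m i z
  have K: "hol2 (K m i) S'" for m i
    unfolding K_def
    by (intro hol2_mult hol2_power hol2_inverse hol2_snd hol2_subset[OF A] hol2_subset[OF B] hol2_subset[OF D])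
       (auto simp: S'_def)
  have inS': "(u, v) \<in> S'" if "norm u < \<eta>" "norm v = r" for u v
    using D\<delta>[OF that] \<delta>(1) that r \<eta> by (auto simp: S'_def intro!: inS)
  have "(\<lambda>u. contour_integral (circlepath 0 r) (\<lambda>v. K m i (u, v))) holomorphic_on ball 0 \<eta>" for m i
  proof (rule contour_integral_circlepath_param_holomorphic[where F' = "\<lambda>u v. d1 (K m i) (u, v)"])
    have *: "continuous_on (ball 0 \<eta> \<times> sphere 0 r) (\<lambda>(u, v). F (u, v))" if "continuous_on S' F" for F :: "_ \<Rightarrow> complex"
      by (rule continuous_on_subset[OF that, THEN continuous_on_eq]) (auto intro: inS')
    show "continuous_on (ball 0 \<eta> \<times> sphere 0 r) (\<lambda>(u, v). K m i (u, v))"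
      by (intro * hol2_continuous_on[OF K])
    show "continuous_on (ball 0 \<eta> \<times> sphere 0 r) (\<lambda>(u, v). d1 (K m i) (u, v))"
      by (intro * hol2_continuous_d1[OF S' K])
    show "((\<lambda>u. K m i (u, v)) has_field_derivative d1 (K m i) (u, v)) (at u)"
      if "u \<in> ball 0 \<eta>" "v \<in> sphere 0 r" for u v
      by (rule has_d12_slice(1)[OF hol2D[OF K]]) (use that in \<open>auto intro: inS'\<close>)
  qed (use r in auto)
  \<comment> \<open>There are \<open>N\<close> moments to annihilate but \<open>N + 1\<close>
    coefficients, because the degree of the form was taken equal to \<open>N\<close>. This is what
    leaves a solution that does not vanish at 0.\<close>
  then have "\<exists>\<rho> c. 0 < \<rho> \<and> (\<forall>i\<in>{..N}. c i holomorphic_on ball 0 \<rho>) \<and> (\<exists>i\<in>{..N}. c i 0 \<noteq> 0) \<and>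
      (\<forall>u\<in>ball 0 \<rho>. \<forall>m<N. (\<Sum>i\<le>N. contour_integral (circlepath 0 r) (\<lambda>v. K m i (u, v)) * c i u) = 0)"
    using \<eta>(1) by (intro holomorphic_kernel[where r = \<eta>]) auto
  then obtain \<sigma> c where \<sigma>: "0 < \<sigma>" and c: "\<forall>i\<in>{..N}. c i holomorphic_on ball 0 \<sigma>" "\<exists>i\<in>{..N}. c i 0 \<noteq> 0"
    "\<forall>u\<in>ball 0 \<sigma>. \<forall>m<N. (\<Sum>i\<le>N. contour_integral (circlepath 0 r) (\<lambda>v. K m i (u, v)) * c i u) = 0"
    by blast
  define H where "H u v = (\<Sum>i\<le>N. c i u * (A (u, v) ^ i * B (u, v) ^ (N - i)))" for u v
  have H0: "H u v0 = 0" if u: "norm u < min \<eta> \<sigma>" and v0: "norm v0 < r" "D (u, v0) = 0" for u v0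
  proof (rule moments_vanish_imp_zero[where f = "\<lambda>v. D (u, v)" and h = "H u"
      and N = N and M = M and ?v1.0 = "of_real r"])
    show "0 < r" by fact
    have slice: "(\<lambda>v. F (u, v)) holomorphic_on ball 0 (6 * r)" if "hol2 F S" for F
      by (rule hol2_slice2[OF that], rule inS) (use u r \<eta> in auto)
    show "(\<lambda>v. D (u, v)) holomorphic_on ball 0 (6 * r)" by (rule slice[OF D])
    show "H u holomorphic_on ball 0 (6 * r)"
      unfolding H_def by (intro holomorphic_intros slice A B)
    show "norm (D (u, v)) \<le> M" if "norm v = 5 * r" for v
      by (rule M) (use u r \<eta> that in auto)
    show "norm (complex_of_real r) \<le> r" using r by simp
    show "M * (1/2) ^ N < norm (D (u, of_real r))"
      using N D\<delta>[of u "of_real r"] u r by simp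
    show "D (u, v) \<noteq> 0" if "norm v = r" for v
      using D\<delta>[of u v] that u \<delta>(1) by auto
    show "v0 \<in> ball 0 r" "D (u, v0) = 0" using v0 by auto
    fix m assume m: "m < N"
    have cont: "continuous_on (path_image (circlepath 0 r)) (\<lambda>v. K m i (u, v))" for i
      by (rule continuous_on_compose2[OF hol2_continuous_on[OF K]])
         (use u r in \<open>auto intro!: continuous_intros inS'\<close>)
    have "contour_integral (circlepath 0 r) (\<lambda>v. H u v * v ^ m / D (u, v))
        = contour_integral (circlepath 0 r) (\<lambda>v. \<Sum>i\<le>N. c i u * K m i (u, v))"
      by (simp add: H_def K_def sum_distrib_right sum_distrib_left divide_inverse mult_ac)
    also have "\<dots> = (\<Sum>i\<le>N. contour_integral (circlepath 0 r) (\<lambda>v. c i u * K m i (u, v)))"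
      by (intro contour_integral_sum contour_integrable_lmul contour_integrable_continuous_circlepath cont) auto
    also have "\<dots> = (\<Sum>i\<le>N. contour_integral (circlepath 0 r) (\<lambda>v. K m i (u, v)) * c i u)"
      by (intro sum.cong refl, subst contour_integral_lmul)
         (auto intro: contour_integrable_continuous_circlepath cont)
    also have "\<dots> = 0" using c(3) u m by simp
    finally show "contour_integral (circlepath 0 r) (\<lambda>v. H u v * v ^ m / D (u, v)) = 0" .
  qed
  have "\<forall>\<^sub>F z in nhds (0, 0). D z = 0 \<longrightarrow> (\<forall>s. A z = s * w1 \<longrightarrow> B z = s * w2 \<longrightarrow> s = 0)"
    if w: "(\<Sum>i\<le>N. c i 0 * w1 ^ i * w2 ^ (N - i)) \<noteq> 0" for w1 w2
  proof -
    \<comment> \<open>The form is known to be nonzero in the direction \<open>w\<close> at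
      \<open>u = 0\<close>; continuity of its coefficients extends this to nearby
      \<open>u\<close>.\<close>
    have "continuous_on (ball 0 \<sigma>) (\<lambda>u. \<Sum>i\<le>N. c i u * w1 ^ i * w2 ^ (N - i))"
      using c(1) by (intro continuous_intros holomorphic_on_imp_continuous_on) auto
    then have "isCont (\<lambda>u. \<Sum>i\<le>N. c i u * w1 ^ i * w2 ^ (N - i)) 0"
      using \<sigma> by (simp add: continuous_on_eq_continuous_at)
    then have "\<forall>\<^sub>F u in nhds 0. (\<Sum>i\<le>N. c i u * w1 ^ i * w2 ^ (N - i)) \<noteq> 0"
      using w unfolding isCont_def tendsto_at_iff_tendsto_nhds[of "\<lambda>u. \<Sum>i\<le>N. c i u * w1 ^ i * w2 ^ (N - i)" 0]
      by (rule tendsto_imp_eventually_ne)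
    then have "\<forall>\<^sub>F z in nhds ((0::complex), (0::complex)). (\<Sum>i\<le>N. c i (fst z) * w1 ^ i * w2 ^ (N - i)) \<noteq> 0"
      using tendsto_fst[OF filterlim_ident[of "nhds (0::complex, 0::complex)"]]
      by (intro eventually_compose_filterlim[where f = fst]) simp_all
    moreover have "\<forall>\<^sub>F z in nhds ((0::complex), (0::complex)). norm (fst z) \<le> min \<eta> \<sigma> / 2
        \<and> norm (snd z) \<le> min \<eta> \<sigma> / 2"
      using eventually_near2[of "min \<eta> \<sigma> / 2" "(0::complex, 0::complex)"] \<eta> \<sigma> by simp
    ultimately show ?thesis
    proof eventually_elim
      case (elim z)
      show ?case
      proof (intro impI allI)
        fix s assume z: "D z = 0" "A z = s * w1" "B z = s * w2"
        have "H (fst z) (snd z) = 0"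
          using elim(2) z(1) \<eta> \<sigma> by (intro H0) auto
        also have "H (fst z) (snd z) = s ^ N * (\<Sum>i\<le>N. c i (fst z) * w1 ^ i * w2 ^ (N - i))"
          unfolding H_def sum_distrib_left
        proof (intro sum.cong refl)
          fix i assume "i \<in> {..N}"
          then have "s ^ N = s ^ i * s ^ (N - i)" by (simp flip: power_add)
          then show "c i (fst z) * (A (fst z, snd z) ^ i * B (fst z, snd z) ^ (N - i))
              = s ^ N * (c i (fst z) * w1 ^ i * w2 ^ (N - i))"
            by (simp add: z power_mult_distrib mult_ac)
        qed
        finally show "s = 0" using elim(1) by simp
      qed
    qed
  qed
  then show ?thesis
    using c(2) by (intro exI[of _ N] exI[of _ "\<lambda>i. c i 0"]) auto
qed

section \<open>Germs and multiplicity\<close>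

lemma analytic2_at_diff:
  fixes f g :: "complex \<times> complex \<Rightarrow> complex"
  assumes "analytic2_at f p" "analytic2_at g p"
  shows "analytic2_at (\<lambda>z. f z - g z) p"
  using analytic2_at_add[OF assms(1) analytic2_at_mult[OF analytic2_at_const[of "-1"] assms(2)]] by simp

lemma analytic2_at_isCont:
  fixes f :: "complex \<times> complex \<Rightarrow> complex"
  assumes "analytic2_at f p"
  shows "isCont f p"
proof -
  obtain S where "open S" "p \<in> S" "hol2 f S" by (rule analytic2_at_imp_hol2[OF assms])
  then show ?thesis using hol2_continuous_on continuous_on_eq_continuous_at by blast
qed

lemma analytic2_at_inverse:
  fixes f :: "complex \<times> complex \<Rightarrow> complex"
  assumes f: "analytic2_at f p" and nz: "f p \<noteq> 0"
  shows "analytic2_at (\<lambda>z. inverse (f z)) p"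
proof -
  obtain S where S: "open S" "p \<in> S" "hol2 f S" by (rule analytic2_at_imp_hol2[OF f])
  have "\<forall>\<^sub>F z in nhds p. f z \<noteq> 0"
    using tendsto_imp_eventually_ne[OF _ nz] analytic2_at_isCont[OF f]
    by (simp add: isCont_def tendsto_at_iff_tendsto_nhds)
  then obtain T where T: "open T" "p \<in> T" "\<forall>z\<in>T. f z \<noteq> 0" unfolding eventually_nhds by blast
  have "hol2 (\<lambda>z. inverse (f z)) (S \<inter> T)"
    by (intro hol2_inverse hol2_subset[OF S(3)]) (use T in auto)
  then show ?thesis
    by (rule hol2_imp_analytic2_at[rotated]) (use S T in auto)
qed

text \<open>At \<open>p\<close> the cofactors are the partial derivatives of \<open>f\<close>; this
  links the differential of a germ to membership in ideals.\<close>

lemma analytic2_at_hadamard: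
  fixes f :: "complex \<times> complex \<Rightarrow> complex"
  assumes "analytic2_at f p" "f p = 0"
  obtains f1 f2 where "analytic2_at f1 p" "analytic2_at f2 p"
    "\<forall>\<^sub>F z in nhds p. f z = (fst z - fst p) * f1 z + (snd z - snd p) * f2 z"
    "d1 f p = f1 p" "d2 f p = f2 p"
proof -
  obtain c r M where cb: "coeffs_bounded c r M" and ev: "\<forall>\<^sub>F z in nhds p. f z = series2 c (z - p)"
    using assms(1) unfolding analytic2_at_iff by blast
  have r: "r > 0" and le: "\<And>i j. norm (c i j) * r ^ (i + j) \<le> M" using cb by (auto simp: coeffs_bounded_def)
  have M0: "0 \<le> M" by (rule order_trans[OF _ le[of 0 0]]) (simp add: r)
  define a where "a i j = c (Suc i) j" for i j
  \<comment> \<open>Monomials containing the first coordinate go into \<open>a\<close>; only the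
    pure powers of the second one remain for \<open>b\<close>, so none is counted twice.\<close>
  define b where "b i j = (if i = 0 then c 0 (Suc j) else 0)" for i j :: nat
  have cba: "coeffs_bounded a r (M / r)"
    unfolding coeffs_bounded_def
  proof (intro conjI allI)
    show "norm (a i j) * r ^ (i + j) \<le> M / r" for i j
      using le[of "Suc i" j] r by (simp add: a_def field_simps)
  qed (rule r)
  have cbb: "coeffs_bounded b r (M / r)"
    unfolding coeffs_bounded_def
  proof (intro conjI allI)
    show "norm (b i j) * r ^ (i + j) \<le> M / r" for i j
      using le[of 0 "Suc j"] r M0 by (simp add: b_def field_simps)
  qed (rule r)
  define f1 f2 where "f1 z = series2 a (z - p)" and "f2 z = series2 b (z - p)" for z
  have an: "analytic2_at f1 p" "analytic2_at f2 p"
    unfolding analytic2_at_iff f1_def f2_def using cba cbb by (blast intro: always_eventually)+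
  have split: "series2 c w = fst w * series2 a w + snd w * series2 b w"
    if w: "norm (fst w) \<le> r/2" "norm (snd w) \<le> r/2" for w
  proof -
    define F where "F = (\<lambda>(i, j). c i j * fst w ^ i * snd w ^ j)"
    let ?A = "range (\<lambda>(i, j). (Suc i, j)) :: (nat \<times> nat) set"
    let ?B = "range (\<lambda>(i, j). (i, Suc j)) :: (nat \<times> nat) set"
    let ?B' = "range (\<lambda>j. (0, Suc j)) :: (nat \<times> nat) set"
    have "((\<lambda>x. fst w * (\<lambda>(i, j). a i j * fst w ^ i * snd w ^ j) x) has_sum fst w * series2 a w) UNIV"
      by (intro has_sum_cmult_right has_sum_series2[OF cba] w)
    also have "(\<lambda>x. fst w * (\<lambda>(i, j). a i j * fst w ^ i * snd w ^ j) x) = F \<circ> (\<lambda>(i, j). (Suc i, j))"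
      by (auto simp: F_def a_def fun_eq_iff)
    finally have A: "(F has_sum fst w * series2 a w) ?A"
      by (rule has_sum_reindex[THEN iffD2, rotated]) (auto simp: inj_on_def)
    define G where "G = (\<lambda>(i, j). if i = (0::nat) then F (i, j) else 0)"
    have "((\<lambda>x. snd w * (\<lambda>(i, j). b i j * fst w ^ i * snd w ^ j) x) has_sum snd w * series2 b w) UNIV"
      by (intro has_sum_cmult_right has_sum_series2[OF cbb] w)
    also have "(\<lambda>x. snd w * (\<lambda>(i, j). b i j * fst w ^ i * snd w ^ j) x) = G \<circ> (\<lambda>(i, j). (i, Suc j))"
      by (auto simp: F_def G_def b_def fun_eq_iff)
    finally have "(G has_sum snd w * series2 b w) ?B"
      by (rule has_sum_reindex[THEN iffD2, rotated]) (auto simp: inj_on_def)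
    then have B: "(F has_sum snd w * series2 b w) ?B'"
      by (rule has_sum_cong_neutral[THEN iffD1, rotated -1]) (auto simp: G_def)
    have C: "(F has_sum c 0 0) {(0, 0)}"
      using has_sum_finite[of "{(0, 0)}" F] by (simp add: F_def)
    have AB: "(F has_sum fst w * series2 a w + snd w * series2 b w) (?A \<union> ?B')"
      by (rule has_sum_Un_disjoint[OF A B]) auto
    have "(F has_sum fst w * series2 a w + snd w * series2 b w + c 0 0) (?A \<union> ?B' \<union> {(0, 0)})"
      by (rule has_sum_Un_disjoint[OF AB C]) auto
    moreover have "?A \<union> ?B' \<union> {(0, 0)} = UNIV"
    proof -
      have "x \<in> ?A \<union> ?B' \<union> {(0, 0)}" for x :: "nat \<times> nat"
      proof (cases "fst x")
        case (Suc i)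
        then have "x = (\<lambda>(i, j). (Suc i, j)) (i, snd x)" by (cases x) simp
        then show ?thesis by blast
      next
        case 0
        then show ?thesis by (cases x; cases "snd x") auto
      qed
      then show ?thesis by blast
    qed
    ultimately have "(F has_sum fst w * series2 a w + snd w * series2 b w + c 0 0) UNIV" by simp
    moreover have "(F has_sum series2 c w) UNIV"
      unfolding F_def by (rule has_sum_series2[OF cb w])
    moreover have "c 0 0 = 0"
    proof -
      have "f p = series2 c (p - p)" using eventually_nhds_x_imp_x[OF ev] .
      moreover have "series2 c 0 = c 0 0"
      proof (rule has_sum_unique)
        show "((\<lambda>(i, j). c i j * fst (0::complex \<times> complex) ^ i * snd (0::complex \<times> complex) ^ j) has_sum
            series2 c 0) UNIV"
          by (rule has_sum_series2[OF cb]) (use r in auto)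
        show "((\<lambda>(i, j). c i j * fst (0::complex \<times> complex) ^ i * snd (0::complex \<times> complex) ^ j) has_sum c 0 0) UNIV"
          by (rule has_sum_finite_neutralI[where B = "{(0, 0)}"]) (auto simp: power_0_left split: if_splits)
      qed
      ultimately show ?thesis using assms(2) by simp
    qed
    ultimately show ?thesis using has_sum_unique by fastforce
  qed
  have dec: "\<forall>\<^sub>F z in nhds p. f z = (fst z - fst p) * f1 z + (snd z - snd p) * f2 z"
    using ev eventually_near2[of "r/2" p, OF half_gt_zero[OF r]]
  proof eventually_elim
    case (elim z)
    then show ?case using split[of "z - p"] by (simp add: f1_def f2_def)
  qed
  obtain S1 where S1: "open S1" "p \<in> S1" "hol2 f1 S1" by (rule analytic2_at_imp_hol2[OF an(1)])
  obtain S2 where S2: "open S2" "p \<in> S2" "hol2 f2 S2" by (rule analytic2_at_imp_hol2[OF an(2)])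
  note [derivative_intros] = hol2D[OF S1(3,2)] hol2D[OF S2(3,2)]
  have "has_d12 (\<lambda>z. (fst z - fst p) * f1 z + (snd z - snd p) * f2 z) (f1 p) (f2 p) p"
    by (rule has_derivative_eq_rhs, (rule derivative_intros)+) (auto simp: fun_eq_iff mult.commute)
  moreover obtain A where A: "open A" "p \<in> A" "\<And>z. z \<in> A \<Longrightarrow> f z = (fst z - fst p) * f1 z + (snd z - snd p) * f2 z"
    using dec unfolding eventually_nhds by metis
  ultimately have "has_d12 f (f1 p) (f2 p) p"
    using has_derivative_transform_within_open[OF _ A(1,2), of _ _ UNIV f] A(3) by simp
  from that[OF an dec has_d12_imp[OF this]] show ?thesis .
qed

lemma O2_minus:
  assumes "analytic2_at f p"
  shows "\<ominus>\<^bsub>O2 p\<^esub> germ p f = germ p (\<lambda>z. - f z)"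
proof -
  interpret cring "O2 p" by (rule cring_O2)
  have "analytic2_at (\<lambda>z. - f z) p"
    using analytic2_at_mult[OF analytic2_at_const[of "-1"] assms] by simp
  then show ?thesis
    using assms by (intro minus_equality) (auto simp: O2_simps)
qed

section \<open>The maximal ideal and the residue field\<close>

definition germs_vanishing :: "complex \<times> complex \<Rightarrow> (complex \<times> complex \<Rightarrow> complex) set set" where
  "germs_vanishing p = {germ p f |f. analytic2_at f p \<and> f p = 0}"

lemma germ_in_germs_vanishing:
  "germ p f \<in> germs_vanishing p \<longleftrightarrow> germ p f \<in> carrier (O2 p) \<and> f p = 0"
proof
  assume "germ p f \<in> germs_vanishing p"
  then obtain g where g: "germ p f = germ p g" "analytic2_at g p" "g p = 0"
    by (auto simp: germs_vanishing_def)
  then have "f p = g p" using eventually_nhds_x_imp_x unfolding germ_eq_iff by fast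
  with g show "germ p f \<in> carrier (O2 p) \<and> f p = 0" by (auto simp: O2_simps)
next
  assume "germ p f \<in> carrier (O2 p) \<and> f p = 0"
  then obtain g where g: "germ p f = germ p g" "analytic2_at g p" and 0: "f p = 0"
    by (auto simp: O2_simps)
  then have "f p = g p" using eventually_nhds_x_imp_x unfolding germ_eq_iff by fast
  with g 0 show "germ p f \<in> germs_vanishing p" by (auto simp: germs_vanishing_def)
qed

lemma ideal_germs_vanishing: "ideal (germs_vanishing p) (O2 p)"
proof (rule idealI)
  interpret cring "O2 p" by (rule cring_O2)
  show "ring (O2 p)" by (rule ring_axioms)
  show "subgroup (germs_vanishing p) (add_monoid (O2 p))"
  proof (rule subgroup.intro)
    show "germs_vanishing p \<subseteq> carrier (add_monoid (O2 p))"
      by (auto simp: germs_vanishing_def O2_simps)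
    show "x \<otimes>\<^bsub>add_monoid (O2 p)\<^esub> y \<in> germs_vanishing p"
      if xy: "x \<in> germs_vanishing p" "y \<in> germs_vanishing p" for x y
    proof -
      obtain f g where "x = germ p f" "y = germ p g" "analytic2_at f p" "f p = 0" "analytic2_at g p" "g p = 0"
        using xy by (auto simp: germs_vanishing_def)
      then show ?thesis
        by (auto simp: O2_simps germs_vanishing_def intro!: exI[of _ "\<lambda>z. f z + g z"] analytic2_at_add)
    qed
    show "\<one>\<^bsub>add_monoid (O2 p)\<^esub> \<in> germs_vanishing p"
      by (auto simp: O2_simps germs_vanishing_def intro!: exI[of _ "\<lambda>_. 0"] analytic2_at_const)
    show "inv\<^bsub>add_monoid (O2 p)\<^esub> x \<in> germs_vanishing p" if x: "x \<in> germs_vanishing p" for x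
    proof -
      obtain f where f: "x = germ p f" "analytic2_at f p" "f p = 0"
        using x by (auto simp: germs_vanishing_def)
      have "analytic2_at (\<lambda>z. - f z) p"
        using analytic2_at_mult[OF analytic2_at_const[of "-1"] f(2)] by simp
      then have "\<ominus>\<^bsub>O2 p\<^esub> x \<in> germs_vanishing p"
        using f by (auto simp: O2_minus germs_vanishing_def)
      then show ?thesis by (simp add: a_inv_def)
    qed
  qed
  show *: "x \<otimes>\<^bsub>O2 p\<^esub> a \<in> germs_vanishing p" if ax: "a \<in> germs_vanishing p" "x \<in> carrier (O2 p)" for a x
  proof -
    obtain f g where "x = germ p f" "a = germ p g" "analytic2_at f p" "analytic2_at g p" "g p = 0"
      using ax by (auto simp: germs_vanishing_def O2_simps)
    then show ?thesis
      by (auto simp: O2_simps germs_vanishing_def intro!: exI[of _ "\<lambda>z. f z * g z"] analytic2_at_mult)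
  qed
  show "a \<otimes>\<^bsub>O2 p\<^esub> x \<in> germs_vanishing p" if ax: "a \<in> germs_vanishing p" "x \<in> carrier (O2 p)" for a x
  proof -
    have "a \<in> carrier (O2 p)" using ax(1) by (auto simp: germs_vanishing_def O2_simps)
    then show ?thesis using *[OF ax] m_comm[OF _ ax(2)] by simp
  qed
qed

text \<open>A germ with nonzero value at \<open>p\<close> has a holomorphic inverse, so an ideal
  containing one is the whole ring.\<close>

lemma maximalideal_germs_vanishing: "maximalideal (germs_vanishing p) (O2 p)"
proof (rule maximalidealI[OF ideal_germs_vanishing])
  interpret cring "O2 p" by (rule cring_O2)
  have "germ p (\<lambda>_. 1) \<notin> germs_vanishing p" by (simp add: germ_in_germs_vanishing)
  then show "carrier (O2 p) \<noteq> germs_vanishing p" using one_closed by (auto simp: O2_simps)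
  fix J assume J: "ideal J (O2 p)" "germs_vanishing p \<subseteq> J" "J \<subseteq> carrier (O2 p)"
  interpret J: ideal J "O2 p" by (rule J(1))
  show "J = germs_vanishing p \<or> J = carrier (O2 p)"
  proof (rule disjCI)
    assume "J \<noteq> carrier (O2 p)"
    have "x \<in> germs_vanishing p" if x: "x \<in> J" for x
    proof (rule ccontr)
      assume nx: "x \<notin> germs_vanishing p"
      obtain f where f: "x = germ p f" "analytic2_at f p"
        using J(3) x by (auto simp: O2_simps)
      then have nz: "f p \<noteq> 0" using nx by (auto simp: germs_vanishing_def)
      have g: "germ p (\<lambda>z. inverse (f z)) \<in> carrier (O2 p)"
        using analytic2_at_inverse[OF f(2) nz] by (auto simp: O2_simps)
      have "\<forall>\<^sub>F z in nhds p. f z \<noteq> 0"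
        using tendsto_imp_eventually_ne[OF _ nz] analytic2_at_isCont[OF f(2)]
        by (simp add: isCont_def tendsto_at_iff_tendsto_nhds)
      then have "germ p (\<lambda>z. inverse (f z) * f z) = germ p (\<lambda>_. 1)"
        unfolding germ_eq_iff by eventually_elim simp
      then have "\<one>\<^bsub>O2 p\<^esub> \<in> J"
        using J.I_l_closed[OF x g] by (simp add: f O2_simps)
      then have "J = carrier (O2 p)" by (rule J.one_imp_carrier)
      with \<open>J \<noteq> carrier (O2 p)\<close> show False ..
    qed
    with J(2) show "J = germs_vanishing p" by blast
  qed
qed

text \<open>A germ differs from the constant \<open>f p\<close> by a germ vanishing at
  \<open>p\<close>. The residue field is therefore \<complex>, and the scalars used by
  \<open>germ_mult\<close> fill the whole quotient.\<close>

lemma constants_germs_vanishing: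
  "constants p (germs_vanishing p) = carrier (O2 p Quot germs_vanishing p)"
proof -
  interpret cring "O2 p" by (rule cring_O2)
  interpret I: ideal "germs_vanishing p" "O2 p" by (rule ideal_germs_vanishing)
  have const: "germ p (\<lambda>_. a) \<in> carrier (O2 p)" for a
    using analytic2_at_const[of a p] unfolding O2_simps by blast
  have "germs_vanishing p +>\<^bsub>O2 p\<^esub> germ p f = germs_vanishing p +>\<^bsub>O2 p\<^esub> germ p (\<lambda>_. f p)"
    if f: "analytic2_at f p" for f
  proof (rule I.a_repr_independence'[symmetric])
    have "germ p (\<lambda>z. f z - f p) \<in> germs_vanishing p"
      using analytic2_at_diff[OF f analytic2_at_const] by (auto simp: germs_vanishing_def)
    moreover have "germ p f = germ p (\<lambda>z. f z - f p) \<oplus>\<^bsub>O2 p\<^esub> germ p (\<lambda>_. f p)"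
      by (simp add: O2_simps)
    ultimately show "germ p f \<in> germs_vanishing p +>\<^bsub>O2 p\<^esub> germ p (\<lambda>_. f p)"
      unfolding a_r_coset_def' by blast
  qed (rule const)
  then show ?thesis
    using const unfolding constants_def FactRing_def A_RCOSETS_def'
    by (force simp: O2_simps intro: analytic2_at_const)
qed

text \<open>Where the Jacobian is nonzero, the matrix of Hadamard cofactors of \<open>h\<close> and
  \<open>k\<close> is invertible near \<open>p\<close>. Both coordinates, and with them all germs
  vanishing at \<open>p\<close>, then lie in the ideal of \<open>h\<close> and \<open>k\<close>, and
  the quotient is the residue field.\<close>

lemma germ_mult_eq_1:
  assumes h: "analytic2_at h p" "h p = 0" and k: "analytic2_at k p" "k p = 0"
    and det: "d1 h p * d2 k p - d2 h p * d1 k p \<noteq> 0"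
  shows "germ_mult p (germ p h) (germ p k) = 1"
proof -
  interpret cring "O2 p" by (rule cring_O2)
  obtain a b where ab: "analytic2_at a p" "analytic2_at b p"
    "\<forall>\<^sub>F z in nhds p. h z = (fst z - fst p) * a z + (snd z - snd p) * b z" "d1 h p = a p" "d2 h p = b p"
    by (rule analytic2_at_hadamard[OF h])
  obtain c d where cd: "analytic2_at c p" "analytic2_at d p"
    "\<forall>\<^sub>F z in nhds p. k z = (fst z - fst p) * c z + (snd z - snd p) * d z" "d1 k p = c p" "d2 k p = d p"
    by (rule analytic2_at_hadamard[OF k])
  define \<Delta> where "\<Delta> z = a z * d z - b z * c z" for z
  have \<Delta>: "analytic2_at \<Delta> p" "\<Delta> p \<noteq> 0"
    unfolding \<Delta>_def[abs_def] using det ab cd by (auto intro!: analytic2_at_diff analytic2_at_mult)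
  have \<Delta>nz: "\<forall>\<^sub>F z in nhds p. \<Delta> z \<noteq> 0"
    using tendsto_imp_eventually_ne[OF _ \<Delta>(2)] analytic2_at_isCont[OF \<Delta>(1)]
    by (simp add: isCont_def tendsto_at_iff_tendsto_nhds)
  have hk: "{germ p h, germ p k} \<subseteq> carrier (O2 p)" using h k by (auto simp: O2_simps)
  define I where "I = Idl\<^bsub>O2 p\<^esub> {germ p h, germ p k}"
  interpret I: ideal I "O2 p" unfolding I_def by (rule genideal_ideal[OF hk])
  have hkI: "germ p h \<in> I" "germ p k \<in> I" using genideal_self[OF hk] by (auto simp: I_def)
  have comb: "germ p (\<lambda>z. r z * h z + s z * k z) \<in> I" if "analytic2_at r p" "analytic2_at s p" for r s
  proof -
    have "germ p r \<otimes>\<^bsub>O2 p\<^esub> germ p h \<oplus>\<^bsub>O2 p\<^esub> germ p s \<otimes>\<^bsub>O2 p\<^esub> germ p k \<in> I"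
      using that by (intro I.a_closed I.I_l_closed hkI) (auto simp: O2_simps)
    then show ?thesis by (simp add: O2_simps)
  qed
  have inv: "analytic2_at (\<lambda>z. inverse (\<Delta> z)) p" by (rule analytic2_at_inverse[OF \<Delta>])
  have "germs_vanishing p \<subseteq> I"
  proof
    fix x assume "x \<in> germs_vanishing p"
    then obtain f where f: "x = germ p f" "analytic2_at f p" "f p = 0" by (auto simp: germs_vanishing_def)
    obtain f1 f2 where f12: "analytic2_at f1 p" "analytic2_at f2 p"
      "\<forall>\<^sub>F z in nhds p. f z = (fst z - fst p) * f1 z + (snd z - snd p) * f2 z"
      by (rule analytic2_at_hadamard[OF f(2,3)])
    \<comment> \<open>Cramer's rule, writing the cofactors of \<open>f\<close> in terms of those of
      \<open>h\<close> and \<open>k\<close>.\<close>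
    define r s where "r z = (f1 z * d z - f2 z * c z) * inverse (\<Delta> z)"
      and "s z = (f2 z * a z - f1 z * b z) * inverse (\<Delta> z)" for z
    have "analytic2_at r p" "analytic2_at s p"
      unfolding r_def[abs_def] s_def[abs_def]
      by (intro analytic2_at_diff analytic2_at_mult inv ab cd f12)+
    then have "germ p (\<lambda>z. r z * h z + s z * k z) \<in> I" by (rule comb)
    moreover have "\<forall>\<^sub>F z in nhds p. f z = r z * h z + s z * k z"
      using ab(3) cd(3) f12(3) \<Delta>nz
    proof eventually_elim
      case (elim z)
      define x y where "x = fst z - fst p" and "y = snd z - snd p"
      have "r z * h z + s z * k z = inverse (\<Delta> z) *
          ((f1 z * d z - f2 z * c z) * (x * a z + y * b z) + (f2 z * a z - f1 z * b z) * (x * c z + y * d z))"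
      proof -
        have hk: "h z = x * a z + y * b z" "k z = x * c z + y * d z" using elim by (simp_all add: x_def y_def)
        show ?thesis unfolding hk r_def s_def by (simp only: ring_distribs mult_ac)
      qed
      also have "(f1 z * d z - f2 z * c z) * (x * a z + y * b z) + (f2 z * a z - f1 z * b z) * (x * c z + y * d z)
          = \<Delta> z * (x * f1 z + y * f2 z)"
        by (simp add: \<Delta>_def algebra_simps)
      also have "inverse (\<Delta> z) * \<dots> = f z" using elim by (simp add: x_def y_def)
      finally show ?case ..
    qed
    then have "x = germ p (\<lambda>z. r z * h z + s z * k z)"
      unfolding f(1) germ_eq_iff .
    ultimately show "x \<in> I" by simp
  qed
  moreover have "I \<subseteq> germs_vanishing p"
    unfolding I_def using h k by (intro genideal_minimal ideal_germs_vanishing) (auto simp: germs_vanishing_def)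
  ultimately have I: "I = germs_vanishing p" by blast
  define Q where "Q = O2 p Quot germs_vanishing p"
  interpret Q: field Q
    unfolding Q_def by (rule maximalideal.quotient_is_field[OF maximalideal_germs_vanishing cring_O2])
  have sub: "subfield (carrier Q) Q" by (rule Q.carrier_is_subfield)
  \<comment> \<open>A field has dimension 1 over itself and no other dimension, which settles both
    the existence test and the definite description in \<open>germ_mult\<close>.\<close>
  have dim: "Q.dimension n (carrier Q) (carrier Q) \<longleftrightarrow> n = 1" for n
    using Q.dimension_one[OF sub] Q.dimension_is_inj[OF sub] by blast
  show ?thesis
    unfolding germ_mult_def I_def[symmetric] I Let_def constants_germs_vanishing Q_def[symmetric]
    by (simp add: dim one_enat_def)
qed

section \<open>Real points and the identity theorem\<close>

lemma holomorphic_zero_on_reals: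
  assumes g: "g holomorphic_on ball (of_real a) r" and r: "r > 0"
    and zero: "\<And>x::real. \<bar>x - a\<bar> < r \<Longrightarrow> g (of_real x) = 0" and w: "w \<in> ball (of_real a) r"
  shows "g w = 0"
proof (rule analytic_continuation[OF g open_ball connected_ball, of "of_real ` {x. \<bar>x - a\<bar> < r}" "of_real a"])
  show "of_real ` {x. \<bar>x - a\<bar> < r} \<subseteq> ball (of_real a :: complex) r"
    by (auto simp: dist_norm simp flip: of_real_diff)
  show "(of_real a :: complex) islimpt of_real ` {x. \<bar>x - a\<bar> < r}"
    unfolding islimpt_approachable
  proof (intro allI impI)
    fix e :: real assume e: "e > 0"
    define x where "x = a + min e r / 2"
    have "\<bar>x - a\<bar> < r" "x \<noteq> a" "\<bar>x - a\<bar> < e" using e r by (auto simp: x_def)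
    then show "\<exists>y\<in>of_real ` {x. \<bar>x - a\<bar> < r}. y \<noteq> (of_real a :: complex) \<and> dist y (of_real a) < e"
      by (intro bexI[of _ "of_real x"]) (auto simp: dist_norm simp flip: of_real_diff)
  qed
  show "of_real a \<in> ball (of_real a :: complex) r" using r by simp
  show "w \<in> ball (of_real a) r" by (rule w)
  show "g z = 0" if "z \<in> of_real ` {x. \<bar>x - a\<bar> < r}" for z
    using that by (auto intro: zero)
qed

text \<open>The identity theorem in one variable is applied twice: in the first variable for a fixed
  real second coordinate, and then in the second variable for any complex first coordinate.\<close>

lemma hol2_zero_on_reals:
  fixes D :: "complex \<times> complex \<Rightarrow> complex"
  assumes S: "open S" "cpoint q \<in> S" and D: "hol2 D S" and zero: "\<forall>\<^sub>F z in nhds q. D (cpoint z) = 0"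
  shows "\<forall>\<^sub>F z in nhds (cpoint q). D z = 0"
proof -
  obtain r where r: "r > 0" "cball (fst (cpoint q)) r \<times> cball (snd (cpoint q)) r \<subseteq> S"
    by (rule open_contains_cball_Times[OF S])
  obtain U where U: "open U" "q \<in> U" "\<forall>z\<in>U. D (cpoint z) = 0"
    using zero unfolding eventually_nhds by blast
  obtain s where s: "s > 0" "cball (fst q) s \<times> cball (snd q) s \<subseteq> U"
    by (rule open_contains_cball_Times[OF U(1,2)])
  define t where "t = min r s"
  have t: "t > 0" "t \<le> r" "t \<le> s" using r s by (auto simp: t_def)
  define a b where "a = fst q" and "b = snd q"
  have inS: "(x, y) \<in> S" if "x \<in> ball (of_real a) t" "y \<in> ball (of_real b) t" for x y
    by (rule subsetD[OF r(2)]) (use t that in \<open>simp add: cpoint_def a_def b_def\<close>)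
  have R: "D (of_real x, of_real y) = 0" if "\<bar>x - a\<bar> < t" "\<bar>y - b\<bar> < t" for x y
  proof -
    have "(x, y) \<in> U"
      by (rule subsetD[OF s(2)]) (use t that in \<open>simp add: a_def b_def dist_real_def abs_minus_commute\<close>)
    from bspec[OF U(3) this] show ?thesis by (simp add: cpoint_def)
  qed
  have real_mem: "of_real y \<in> ball (of_real b :: complex) t" if "\<bar>y - b\<bar> < t" for y b
    using that by (simp add: dist_norm abs_minus_commute flip: of_real_diff)
  have C: "D (x, of_real y) = 0" if x: "x \<in> ball (of_real a) t" and y: "\<bar>y - b\<bar> < t" for x y
  proof (rule holomorphic_zero_on_reals[where g = "\<lambda>x. D (x, of_real y)"])
    show "(\<lambda>x. D (x, of_real y)) holomorphic_on ball (of_real a) t"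
      by (rule hol2_slice1[OF D], rule inS) (use real_mem[OF y] in auto)
    show "D (of_real x, of_real y) = 0" if "\<bar>x - a\<bar> < t" for x by (rule R[OF that y])
  qed (fact t(1) x)+
  have "D (x, y) = 0" if x: "x \<in> ball (of_real a) t" and y: "y \<in> ball (of_real b) t" for x y
  proof (rule holomorphic_zero_on_reals[where g = "\<lambda>y. D (x, y)"])
    show "(\<lambda>y. D (x, y)) holomorphic_on ball (of_real b) t"
      by (rule hol2_slice2[OF D], rule inS) (use x in auto)
    show "D (x, of_real y) = 0" if "\<bar>y - b\<bar> < t" for y by (rule C[OF x that])
  qed (fact t(1) y)+
  then have "\<forall>z\<in>ball (of_real a) t \<times> ball (of_real b) t. D z = 0" by auto
  moreover have "open (ball (complex_of_real a) t \<times> ball (complex_of_real b) t)"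
    "cpoint q \<in> ball (of_real a) t \<times> ball (of_real b) t"
    using t by (auto simp: open_Times cpoint_def a_def b_def)
  ultimately show ?thesis
    unfolding eventually_nhds by (intro exI[of _ "ball (of_real a) t \<times> ball (of_real b) t"] conjI)
qed

lemma complexification_eq_germ:
  assumes H: "analytic2_at H (cpoint q)" and ext: "\<forall>\<^sub>F z in nhds q. H (cpoint z) = complex_of_real (h z)"
  shows "complexification h q = germ (cpoint q) H"
proof (rule equalityI; rule subsetI)
  fix K assume "K \<in> complexification h q"
  then have K: "analytic2_at K (cpoint q)" "\<forall>\<^sub>F z in nhds q. K (cpoint z) = complex_of_real (h z)"
    by (auto simp: complexification_def)
  obtain S where S: "open S" "cpoint q \<in> S" "hol2 (\<lambda>z. K z - H z) S"
    by (rule analytic2_at_imp_hol2[OF analytic2_at_diff[OF K(1) H]])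
  have "\<forall>\<^sub>F z in nhds q. K (cpoint z) - H (cpoint z) = 0"
    using K(2) ext by eventually_elim simp
  then have "\<forall>\<^sub>F z in nhds (cpoint q). K z - H z = 0" by (rule hol2_zero_on_reals[OF S])
  then show "K \<in> germ (cpoint q) H" by (simp add: germ_def)
next
  fix K assume "K \<in> germ (cpoint q) H"
  then have K: "\<forall>\<^sub>F z in nhds (cpoint q). K z = H z" by (simp add: germ_def)
  have "isCont cpoint q" unfolding cpoint_def[abs_def] by (intro continuous_intros)
  then have "filterlim cpoint (nhds (cpoint q)) (nhds q)"
    by (simp add: isCont_def tendsto_at_iff_tendsto_nhds)
  then have "\<forall>\<^sub>F z in nhds q. K (cpoint z) = H (cpoint z)"
    using K by (rule eventually_compose_filterlim[rotated])
  then have "\<forall>\<^sub>F z in nhds q. K (cpoint z) = complex_of_real (h z)"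
    using ext by eventually_elim simp
  then show "K \<in> complexification h q"
    using analytic2_at_cong[OF H K] by (simp add: complexification_def)
qed

text \<open>The real coefficients, read as complex ones, satisfy the same Cauchy estimates.\<close>

lemma analytic2_at_complexify:
  fixes f :: "real \<times> real \<Rightarrow> real"
  assumes "analytic2_at f q"
  obtains H where "analytic2_at H (cpoint q)" "\<forall>\<^sub>F z in nhds q. H (cpoint z) = complex_of_real (f z)"
proof -
  obtain c r M where cb: "coeffs_bounded c r M" and ev: "\<forall>\<^sub>F z in nhds q. f z = series2 c (z - q)"
    using assms unfolding analytic2_at_iff by blast
  have r: "r > 0" using cb by (simp add: coeffs_bounded_def)
  define c' where "c' i j = complex_of_real (c i j)" for i j
  have cb': "coeffs_bounded c' r M" using cb by (simp add: coeffs_bounded_def c'_def)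
  define H where "H z = series2 c' (z - cpoint q)" for z
  have "analytic2_at H (cpoint q)"
    unfolding analytic2_at_iff H_def using cb' by (blast intro: always_eventually)
  moreover have "\<forall>\<^sub>F z in nhds q. H (cpoint z) = complex_of_real (f z)"
    using ev eventually_near2[of "r/2" q, OF half_gt_zero[OF r]]
  proof eventually_elim
    case (elim z)
    have "((\<lambda>(i, j). c i j * fst (z - q) ^ i * snd (z - q) ^ j) has_sum f z) UNIV"
      unfolding elim(1) by (rule has_sum_series2[OF cb]) (use elim in auto)
    then have "((\<lambda>x. complex_of_real ((\<lambda>(i, j). c i j * fst (z - q) ^ i * snd (z - q) ^ j) x)) has_sum
        of_real (f z)) UNIV"
      by (rule has_sum_of_real)
    then have "((\<lambda>(i, j). c' i j * fst (cpoint z - cpoint q) ^ i * snd (cpoint z - cpoint q) ^ j) has_sum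
        of_real (f z)) UNIV"
      by (simp add: case_prod_unfold c'_def cpoint_def)
    moreover have "((\<lambda>(i, j). c' i j * fst (cpoint z - cpoint q) ^ i * snd (cpoint z - cpoint q) ^ j) has_sum
        H (cpoint z)) UNIV"
      unfolding H_def using elim
      by (intro has_sum_series2[OF cb']) (auto simp: cpoint_def simp flip: of_real_diff)
    ultimately show ?case by (rule has_sum_unique[rotated])
  qed
  ultimately show ?thesis by (rule that)
qed

section \<open>Directions avoiding the critical values\<close>

text \<open>In finite dimension, continuity of the derivative on basis vectors is continuity in
  operator norm, and an injective endomorphism has a linear left inverse. Derivatives can thus be
  handed over as plain functions.\<close>

lemma inverse_function_C1:
  fixes f :: "'a::euclidean_space \<Rightarrow> 'a"
  assumes "open U" and der: "\<And>x. x \<in> U \<Longrightarrow> (f has_derivative f' x) (at x)"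
    and cont: "\<And>i. i \<in> Basis \<Longrightarrow> continuous_on U (\<lambda>x. f' x i)"
    and "x0 \<in> U" and inj: "inj (f' x0)"
  obtains U' V g where "open U'" "U' \<subseteq> U" "x0 \<in> U'" "open V" "f x0 \<in> V" "homeomorphism U' V f g"
    "\<And>y. y \<in> V \<Longrightarrow> (g has_derivative inv_into UNIV (f' (g y))) (at y)" "\<And>y. y \<in> V \<Longrightarrow> bij (f' (g y))"
proof -
  define F where "F x = Blinfun (f' x)" for x
  have F: "blinfun_apply (F x) = f' x" if "x \<in> U" for x
    unfolding F_def by (rule bounded_linear_Blinfun_apply[OF has_derivative_bounded_linear[OF der[OF that]]])
  have "linear (f' x0)" using has_derivative_linear[OF der[OF \<open>x0 \<in> U\<close>]] .
  then obtain i where i: "linear i" "i \<circ> f' x0 = id"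
    using linear_injective_left_inverse inj by blast
  have "bounded_linear i" using i(1) by (simp add: linear_conv_bounded_linear)
  then have "blinfun_apply (Blinfun i) = i" by (rule bounded_linear_Blinfun_apply)
  then have inv: "Blinfun i o\<^sub>L F x0 = id_blinfun"
    using i(2) F[OF \<open>x0 \<in> U\<close>] by (intro blinfun_eqI) (simp add: fun_eq_iff)
  have contF: "continuous_on U F"
  proof (rule continuous_on_blinfun_componentwise)
    fix i :: 'a assume "i \<in> Basis"
    show "continuous_on U (\<lambda>x. blinfun_apply (F x) i)"
      by (rule continuous_on_eq[OF cont[OF \<open>i \<in> Basis\<close>]]) (simp add: F)
  qed
  have derF: "(f has_derivative blinfun_apply (F x)) (at x)" if "x \<in> U" for x
    using der[OF that] F[OF that] by simp
  show ?thesis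
  proof (rule inverse_function_theorem[OF \<open>open U\<close> derF contF \<open>x0 \<in> U\<close> inv])
    fix U' V g g'
    assume *: "open U'" "U' \<subseteq> U" "x0 \<in> U'" "open V" "f x0 \<in> V" "homeomorphism U' V f g"
      "\<And>y. y \<in> V \<Longrightarrow> (g has_derivative g' y) (at y)"
      "\<And>y. y \<in> V \<Longrightarrow> g' y = inv_into UNIV (blinfun_apply (F (g y)))"
      "\<And>y. y \<in> V \<Longrightarrow> bij (blinfun_apply (F (g y)))"
    have "g y \<in> U" if "y \<in> V" for y
      using *(2,6) that by (auto simp: homeomorphism_def)
    then show ?thesis
      using * by (intro that[of U' V g]) (simp_all add: F)
  qed
qed

abbreviation has_d4 :: "((complex \<times> complex) \<times> (complex \<times> complex) \<Rightarrow> complex) \<Rightarrow>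
    complex \<Rightarrow> complex \<Rightarrow> complex \<Rightarrow> complex \<Rightarrow> (complex \<times> complex) \<times> (complex \<times> complex) \<Rightarrow> bool" where
  "has_d4 F a b c d w \<equiv>
     (F has_derivative (\<lambda>h. a * fst (fst h) + b * snd (fst h) + c * fst (snd h) + d * snd (snd h))) (at w)"

lemma cramer2:
  fixes a b c d :: "'a::field"
  assumes "a * x + b * y = s" "c * x + d * y = t" "a * d - b * c \<noteq> 0"
  shows "x = (s * d - b * t) / (a * d - b * c)" "y = (a * t - s * c) / (a * d - b * c)"
proof -
  have "x * (a * d - b * c) = s * d - b * t" "y * (a * d - b * c) = a * t - s * c"
    unfolding assms(1,2)[symmetric] by (simp_all add: algebra_simps)
  then show "x = (s * d - b * t) / (a * d - b * c)" "y = (a * t - s * c) / (a * d - b * c)"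
    using assms(3) by (simp_all add: eq_divide_eq)
qed

text \<open>The map \<open>(z, l) \<mapsto> (z, (F1, F2))\<close> is inverted as a real C1 map; the
  solution is complex differentiable because its derivative solves a complex linear system. The last
  clause holds since the Jacobian of \<Psi> is the quotient of the determinants of F in
  \<open>z\<close> and in \<open>l\<close>: at a zero with dependent differentials in
  \<open>z\<close>, \<Psi> is critical.\<close>

lemma holomorphic_implicit_function:
  fixes F1 F2 :: "(complex \<times> complex) \<times> (complex \<times> complex) \<Rightarrow> complex"
  assumes S: "open S" "(z0, l0) \<in> S"
    and F1': "\<forall>w\<in>S. has_d4 F1 (p1 w) (p2 w) (p3 w) (p4 w) w"
    and F2': "\<forall>w\<in>S. has_d4 F2 (q1 w) (q2 w) (q3 w) (q4 w) w"
    and cont: "continuous_on S p1" "continuous_on S p2" "continuous_on S p3" "continuous_on S p4"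
      "continuous_on S q1" "continuous_on S q2" "continuous_on S q3" "continuous_on S q4"
    and zero: "F1 (z0, l0) = 0" "F2 (z0, l0) = 0"
    and det: "p3 (z0, l0) * q4 (z0, l0) - p4 (z0, l0) * q3 (z0, l0) \<noteq> 0"
  shows "\<exists>r \<Psi>1 \<Psi>2. r > 0 \<and> hol2 \<Psi>1 (ball z0 r) \<and> hol2 \<Psi>2 (ball z0 r) \<and> (\<Psi>1 z0, \<Psi>2 z0) = l0 \<and>
    (\<forall>z\<in>ball z0 r. (z, (\<Psi>1 z, \<Psi>2 z)) \<in> S \<and> F1 (z, (\<Psi>1 z, \<Psi>2 z)) = 0 \<and> F2 (z, (\<Psi>1 z, \<Psi>2 z)) = 0) \<and>
    (\<forall>z\<in>ball z0 r. \<forall>l\<in>ball l0 r. F1 (z, l) = 0 \<longrightarrow> F2 (z, l) = 0 \<longrightarrow> l = (\<Psi>1 z, \<Psi>2 z)) \<and>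
    (\<forall>z\<in>ball z0 r. p1 (z, (\<Psi>1 z, \<Psi>2 z)) * q2 (z, (\<Psi>1 z, \<Psi>2 z)) = p2 (z, (\<Psi>1 z, \<Psi>2 z)) * q1 (z, (\<Psi>1 z, \<Psi>2 z)) \<longrightarrow>
       d1 \<Psi>1 z * d2 \<Psi>2 z - d2 \<Psi>1 z * d1 \<Psi>2 z = 0)"
proof -
  note F1 = F1'[rule_format] and F2 = F2'[rule_format]
  define f where "f w = (fst w, (F1 w, F2 w))" for w
  define f' where "f' w h = (fst h,
      (p1 w * fst (fst h) + p2 w * snd (fst h) + p3 w * fst (snd h) + p4 w * snd (snd h),
       q1 w * fst (fst h) + q2 w * snd (fst h) + q3 w * fst (snd h) + q4 w * snd (snd h)))"
    for w h :: "(complex \<times> complex) \<times> (complex \<times> complex)"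
  have f': "(f has_derivative f' w) (at w)" if "w \<in> S" for w
    unfolding f_def[abs_def] f'_def[abs_def]
    by (intro has_derivative_Pair has_derivative_fst has_derivative_ident F1[OF that] F2[OF that])
  have inj: "inj (f' (z0, l0))"
  proof (rule injI)
    fix h k assume eq: "f' (z0, l0) h = f' (z0, l0) k"
    define x y where "x = fst (snd h) - fst (snd k)" and "y = snd (snd h) - snd (snd k)"
    have "fst h = fst k" using eq by (simp add: f'_def)
    moreover from this have e: "p3 (z0, l0) * x + p4 (z0, l0) * y = 0" "q3 (z0, l0) * x + q4 (z0, l0) * y = 0"
      using eq by (simp_all add: f'_def x_def y_def algebra_simps)
    moreover have "x = 0" "y = 0" using cramer2[OF e det] by simp_all
    ultimately show "h = k" by (simp add: x_def y_def prod_eq_iff)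
  qed
  have "continuous_on S (\<lambda>w. f' w i)" for i
    unfolding f'_def by (intro continuous_intros cont)
  then obtain U V g where U: "open U" "U \<subseteq> S" "(z0, l0) \<in> U" and V: "open V" "f (z0, l0) \<in> V"
    and hom: "homeomorphism U V f g"
    and g: "\<And>y. y \<in> V \<Longrightarrow> (g has_derivative inv_into UNIV (f' (g y))) (at y)"
    using inverse_function_C1[OF S(1) f' _ S(2) inj] by metis
  have fg: "f (g y) = y" "g y \<in> U" if "y \<in> V" for y
    using hom that by (auto simp: homeomorphism_def)
  have gf: "g (f w) = w" "f w \<in> V" if "w \<in> U" for w
    using hom that by (auto simp: homeomorphism_def)
  define \<Psi> where "\<Psi> z = snd (g (z, (0, 0)))" for z
  have V0: "(z0, (0, 0)) \<in> V" using V(2) zero by (simp add: f_def)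
  have g_eq: "g (z, (0, 0)) = (z, \<Psi> z)" if "(z, (0, 0)) \<in> V" for z
    using fg(1)[OF that] by (simp add: f_def \<Psi>_def prod_eq_iff)
  have F0: "F1 (z, \<Psi> z) = 0" "F2 (z, \<Psi> z) = 0" "(z, \<Psi> z) \<in> U" if "(z, (0, 0)) \<in> V" for z
    using fg[OF that] unfolding g_eq[OF that] by (simp_all add: f_def)
  have uniq: "l = \<Psi> z" if "(z, l) \<in> U" "F1 (z, l) = 0" "F2 (z, l) = 0" for z l
    using gf(1)[OF that(1)] that(2,3) by (simp add: f_def \<Psi>_def)
  have \<Psi>0: "\<Psi> z0 = l0" using uniq[OF U(3) zero] ..
  define \<Delta> where "\<Delta> w = p3 w * q4 w - p4 w * q3 w" for w
  have contg: "continuous_on V g" using hom by (simp add: homeomorphism_def)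
  define T where "T = {z. (z, (0, 0)) \<in> V}"
  have T_eq: "T = (\<lambda>z. (z, (0, 0))) -` V" by (auto simp: T_def)
  have oT: "open T"
    unfolding T_eq by (intro open_vimage V continuous_intros)
  have contPsi: "continuous_on T (\<lambda>z. (z, \<Psi> z))"
  proof (rule continuous_on_eq)
    show "continuous_on T (\<lambda>z. g (z, (0, 0)))"
      by (rule continuous_on_compose2[OF contg]) (auto simp: T_def intro!: continuous_intros)
  qed (simp add: T_def g_eq)
  have "continuous_on T (\<lambda>z. \<Delta> (z, \<Psi> z))"
  proof (rule continuous_on_compose2[OF _ contPsi])
    show "continuous_on S \<Delta>" unfolding \<Delta>_def by (intro continuous_intros cont)
    show "(\<lambda>z. (z, \<Psi> z)) ` T \<subseteq> S" using F0(3) U(2) by (auto simp: T_def)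
  qed
  then have "open (T \<inter> (\<lambda>z. \<Delta> (z, \<Psi> z)) -` (- {0}))"
    by (intro continuous_open_preimage oT) auto
  moreover have "z0 \<in> T \<inter> (\<lambda>z. \<Delta> (z, \<Psi> z)) -` (- {0})"
    using V0 det by (simp add: T_def \<Psi>0 \<Delta>_def)
  ultimately obtain r1 where r1: "r1 > 0" "ball z0 r1 \<subseteq> T \<inter> (\<lambda>z. \<Delta> (z, \<Psi> z)) -` (- {0})"
    using open_contains_ball by blast
  obtain r2 where r2: "r2 > 0" "cball z0 r2 \<times> cball l0 r2 \<subseteq> U"
    using open_contains_cball_Times[OF U(1,3)] by auto
  define r where "r = min r1 r2"
  have r: "r > 0" using r1 r2 by (simp add: r_def)
  have inT: "(z, (0, 0)) \<in> V" and nz: "\<Delta> (z, \<Psi> z) \<noteq> 0" if "z \<in> ball z0 r" for z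
    using r1(2) that by (auto simp: r_def T_def)
  define \<Psi>1 \<Psi>2 where "\<Psi>1 z = fst (\<Psi> z)" and "\<Psi>2 z = snd (\<Psi> z)" for z
  have P12: "(\<Psi>1 z, \<Psi>2 z) = \<Psi> z" for z by (simp add: \<Psi>1_def \<Psi>2_def)
  \<comment> \<open>The derivative of \<Psi>, from differentiating
    \<open>F (z, \<Psi> z) = 0\<close> and solving by Cramer's rule with determinant
    \<Delta>.\<close>
  define a1 a2 b1 b2 where
    "a1 w = (p4 w * q1 w - p1 w * q4 w) / \<Delta> w" and "a2 w = (p4 w * q2 w - p2 w * q4 w) / \<Delta> w" and
    "b1 w = (p1 w * q3 w - p3 w * q1 w) / \<Delta> w" and "b2 w = (p2 w * q3 w - p3 w * q2 w) / \<Delta> w" for w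
  have dPsi: "has_d12 \<Psi>1 (a1 (z, \<Psi> z)) (a2 (z, \<Psi> z)) z \<and> has_d12 \<Psi>2 (b1 (z, \<Psi> z)) (b2 (z, \<Psi> z)) z"
    if z: "z \<in> ball z0 r" for z
  proof -
    have "((\<lambda>z. (z, (0::complex, 0::complex))) has_derivative (\<lambda>h. (h, (0, 0)))) (at z)"
      by (intro has_derivative_Pair has_derivative_ident has_derivative_const)
    from has_derivative_compose[OF this g[OF inT[OF z]]]
    have "((\<lambda>z. g (z, (0, 0))) has_derivative (\<lambda>h. inv_into UNIV (f' (g (z, (0, 0)))) (h, (0, 0)))) (at z)" .
    from has_derivative_snd[OF this] obtain D where D: "(\<Psi> has_derivative D) (at z)"
      unfolding \<Psi>_def[abs_def] by blast
    define w where "w = (z, \<Psi> z)"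
    have w: "w \<in> S" using F0(3)[OF inT[OF z]] U(2) by (auto simp: w_def)
    have pair: "((\<lambda>z. (z, \<Psi> z)) has_derivative (\<lambda>h. (h, D h))) (at z)"
      by (intro has_derivative_Pair has_derivative_ident D)
    have zeroder: "L = (\<lambda>h. 0)" if "((\<lambda>z. F (z, \<Psi> z)) has_derivative L) (at z)"
      "\<And>z. z \<in> ball z0 r \<Longrightarrow> F (z, \<Psi> z) = 0" for F :: "_ \<Rightarrow> complex" and L
    proof -
      have "((\<lambda>z. 0) has_derivative L) (at z)"
        by (rule has_derivative_transform_within_open[OF that(1) open_ball z]) (use that(2) in auto)
      then show ?thesis using has_derivative_unique has_derivative_const by blast
    qed
    have "((\<lambda>z. F1 (z, \<Psi> z)) has_derivative (\<lambda>h. p1 w * fst h + p2 w * snd h + p3 w * fst (D h)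
        + p4 w * snd (D h))) (at z)"
      using has_derivative_compose[OF pair F1[OF w, unfolded w_def]] by (simp add: w_def)
    from zeroder[OF this] F0(1)[OF inT]
    have e1: "p1 w * fst h + p2 w * snd h + p3 w * fst (D h) + p4 w * snd (D h) = 0" for h
      by (metis (no_types, lifting))
    have "((\<lambda>z. F2 (z, \<Psi> z)) has_derivative (\<lambda>h. q1 w * fst h + q2 w * snd h + q3 w * fst (D h)
        + q4 w * snd (D h))) (at z)"
      using has_derivative_compose[OF pair F2[OF w, unfolded w_def]] by (simp add: w_def)
    from zeroder[OF this] F0(2)[OF inT]
    have e2: "q1 w * fst h + q2 w * snd h + q3 w * fst (D h) + q4 w * snd (D h) = 0" for h
      by (metis (no_types, lifting))
    have d: "p3 w * q4 w - p4 w * q3 w \<noteq> 0" using nz[OF z] by (simp add: w_def \<Delta>_def)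
    have D1: "fst (D h) = a1 w * fst h + a2 w * snd h" and D2: "snd (D h) = b1 w * fst h + b2 w * snd h" for h
    proof -
      have l: "p3 w * fst (D h) + p4 w * snd (D h) = - (p1 w * fst h + p2 w * snd h)"
        "q3 w * fst (D h) + q4 w * snd (D h) = - (q1 w * fst h + q2 w * snd h)"
        using e1[of h] e2[of h] by (simp_all add: algebra_simps eq_neg_iff_add_eq_0)
      show "fst (D h) = a1 w * fst h + a2 w * snd h" "snd (D h) = b1 w * fst h + b2 w * snd h"
        unfolding cramer2[OF l d] a1_def a2_def b1_def b2_def \<Delta>_def
        by (simp_all add: algebra_simps add_divide_distrib diff_divide_distrib)
    qed
    show ?thesis
      using has_derivative_fst[OF D] has_derivative_snd[OF D]
      unfolding \<Psi>1_def[abs_def] \<Psi>2_def[abs_def] D1 D2 w_def by simp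
  qed
  \<comment> \<open>The minus sign in the derivative of the implicit function is squared away in a
    determinant of size 2.\<close>
  have det_rel: "(d1 \<Psi>1 z * d2 \<Psi>2 z - d2 \<Psi>1 z * d1 \<Psi>2 z) * \<Delta> (z, \<Psi> z) =
      p1 (z, \<Psi> z) * q2 (z, \<Psi> z) - p2 (z, \<Psi> z) * q1 (z, \<Psi> z)" if z: "z \<in> ball z0 r" for z
  proof -
    define w where "w = (z, \<Psi> z)"
    have "d1 \<Psi>1 z = a1 w" "d2 \<Psi>1 z = a2 w" "d1 \<Psi>2 z = b1 w" "d2 \<Psi>2 z = b2 w"
      using dPsi[OF z] has_d12_imp unfolding w_def by blast+
    then have "(d1 \<Psi>1 z * d2 \<Psi>2 z - d2 \<Psi>1 z * d1 \<Psi>2 z) * \<Delta> w * \<Delta> w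
        = ((a1 w * \<Delta> w) * (b2 w * \<Delta> w) - (a2 w * \<Delta> w) * (b1 w * \<Delta> w))"
      by (simp add: algebra_simps)
    also have "\<dots> = (p1 w * q2 w - p2 w * q1 w) * \<Delta> w"
    proof -
      have eqs: "a1 w * \<Delta> w = p4 w * q1 w - p1 w * q4 w" "a2 w * \<Delta> w = p4 w * q2 w - p2 w * q4 w"
        "b1 w * \<Delta> w = p1 w * q3 w - p3 w * q1 w" "b2 w * \<Delta> w = p2 w * q3 w - p3 w * q2 w"
        using nz[OF z] by (simp_all add: a1_def a2_def b1_def b2_def w_def)
      show ?thesis unfolding eqs by (simp add: \<Delta>_def algebra_simps)
    qed
    finally show ?thesis using nz[OF z] by (simp add: w_def)
  qed
  show ?thesis
  proof (rule exI[of _ r], rule exI[of _ \<Psi>1], rule exI[of _ \<Psi>2], intro conjI ballI impI)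
    show "r > 0" by (rule r)
    show "hol2 \<Psi>1 (ball z0 r)" "hol2 \<Psi>2 (ball z0 r)" using dPsi unfolding hol2_def by blast+
    show "(\<Psi>1 z0, \<Psi>2 z0) = l0" using P12 \<Psi>0 by simp
  next
    fix z assume z: "z \<in> ball z0 r"
    show "(z, (\<Psi>1 z, \<Psi>2 z)) \<in> S" "F1 (z, (\<Psi>1 z, \<Psi>2 z)) = 0" "F2 (z, (\<Psi>1 z, \<Psi>2 z)) = 0"
      using F0[OF inT[OF z]] U(2) unfolding P12 by blast+
  next
    fix z l assume "z \<in> ball z0 r" "l \<in> ball l0 r" "F1 (z, l) = 0" "F2 (z, l) = 0"
    then show "l = (\<Psi>1 z, \<Psi>2 z)"
      unfolding P12 using r2(2) by (intro uniq) (auto simp: r_def)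
  next
    fix z assume z: "z \<in> ball z0 r"
      and "p1 (z, (\<Psi>1 z, \<Psi>2 z)) * q2 (z, (\<Psi>1 z, \<Psi>2 z)) = p2 (z, (\<Psi>1 z, \<Psi>2 z)) * q1 (z, (\<Psi>1 z, \<Psi>2 z))"
    then show "d1 \<Psi>1 z * d2 \<Psi>2 z - d2 \<Psi>1 z * d1 \<Psi>2 z = 0"
      using det_rel[OF z] nz[OF z] unfolding P12 by simp
  qed
qed

section \<open>Elimination at an arbitrary base point\<close>

lemma has_d12_affine:
  assumes "has_d12 f a b (\<alpha> + m * fst z + n * snd z, \<beta> + k * fst z + l * snd z)"
  shows "has_d12 (\<lambda>z. f (\<alpha> + m * fst z + n * snd z, \<beta> + k * fst z + l * snd z)) (a * m + b * k) (a * n + b * l) z"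
proof -
  have "((\<lambda>z. (\<alpha> + m * fst z + n * snd z, \<beta> + k * fst z + l * snd z)) has_derivative
      (\<lambda>h. (m * fst h + n * snd h, k * fst h + l * snd h))) (at z)"
    by (auto intro!: derivative_eq_intros)
  from has_derivative_compose[OF this assms] show ?thesis
    by (rule has_derivative_eq_rhs) (simp add: fun_eq_iff algebra_simps)
qed

lemma hol2_affine:
  assumes "hol2 f S"
  shows "hol2 (\<lambda>z. f (\<alpha> + m * fst z + n * snd z, \<beta> + k * fst z + l * snd z))
           ((\<lambda>z. (\<alpha> + m * fst z + n * snd z, \<beta> + k * fst z + l * snd z)) -` S)"
  by (rule hol2I, rule has_d12_affine, rule hol2D[OF assms]) simp

text \<open>Setting \<open>w2 = 1\<close> turns the form into a nonzero polynomial in one variable,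
  which has only finitely many roots, so some real \<open>w1\<close> is not a root.\<close>

lemma exists_real_nonzero_form:
  fixes c :: "nat \<Rightarrow> complex"
  assumes "\<exists>i\<le>d. c i \<noteq> 0"
  obtains w1 w2 :: real where "(\<Sum>i\<le>d. c i * of_real w1 ^ i * of_real w2 ^ (d - i)) \<noteq> 0"
proof -
  define p where "p = (\<Sum>i\<le>d. Polynomial.monom (c i) i)"
  have "Polynomial.coeff p i = c i" if "i \<le> d" for i
    using that by (simp add: p_def coeff_sum)
  then have "p \<noteq> 0" using assms by (metis coeff_0)
  then have "finite {x. poly p x = 0}" by (rule poly_roots_finite)
  from finite_vimageI[OF this inj_of_real] have "finite {x::real. poly p (of_real x) = 0}"
    by (simp add: vimage_def)
  then obtain x :: real where "poly p (of_real x) \<noteq> 0"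
    using ex_new_if_finite[OF infinite_UNIV_char_0] by blast
  then show ?thesis
    using that[of x 1] by (simp add: p_def poly_sum poly_monom)
qed

text \<open>On a given line \<open>D\<close> may vanish although it does not vanish near
  \<open>z0\<close>. If \<open>D z0 = 0\<close>, the line joining \<open>z0\<close> to a point with
  \<open>D \<noteq> 0\<close> works, by the identity theorem on the convex part of the line inside
  the ball. This line will be the second axis in the elimination.\<close>

lemma eventually_zero_on_line:
  fixes D :: "complex \<times> complex \<Rightarrow> complex"
  assumes D: "hol2 D (ball z0 r)" and r: "r > 0" and nz: "\<not> (\<forall>\<^sub>F z in nhds z0. D z = 0)"
  obtains e1 e2 where "(e1, e2) \<noteq> (0, 0)" "\<not> (\<forall>\<^sub>F v in nhds 0. D (fst z0 + e1 * v, snd z0 + e2 * v) = 0)"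
proof (cases "D z0 = 0")
  case False
  have "\<not> (\<forall>\<^sub>F v in nhds (0::complex). D (fst z0 + 0 * v, snd z0 + 1 * v) = 0)"
  proof
    assume "\<forall>\<^sub>F v in nhds (0::complex). D (fst z0 + 0 * v, snd z0 + 1 * v) = 0"
    from eventually_nhds_x_imp_x[OF this] False show False by simp
  qed
  then show ?thesis by (intro that[of 0 1]) auto
next
  case True
  have "\<exists>z1\<in>ball z0 r. D z1 \<noteq> 0"
  proof (rule ccontr)
    assume "\<not> ?thesis"
    then have "\<forall>\<^sub>F z in nhds z0. D z = 0"
      unfolding eventually_nhds using r by (intro exI[of _ "ball z0 r"]) auto
    with nz show False ..
  qed
  then obtain z1 where z1: "z1 \<in> ball z0 r" "D z1 \<noteq> 0" by blast
  define e1 e2 where "e1 = fst z1 - fst z0" and "e2 = snd z1 - snd z0"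
  define L where "L v = (fst z0 + e1 * v, snd z0 + e2 * v)" for v
  have L01: "L 0 = z0" "L 1 = z1" by (simp_all add: L_def e1_def e2_def)
  have L_eq: "L v = z0 + (e1 * v, e2 * v)" for v by (simp add: L_def plus_prod_def)
  have "(e1, e2) \<noteq> (0, 0)" using True z1(2) by (cases "z1 = z0") (auto simp: e1_def e2_def prod_eq_iff)
  moreover have "\<not> (\<forall>\<^sub>F v in nhds 0. D (L v) = 0)"
  proof
    assume ev: "\<forall>\<^sub>F v in nhds 0. D (L v) = 0"
    obtain s where s: "open s" "0 \<in> s" "\<forall>v\<in>s. D (L v) = 0" using ev unfolding eventually_nhds by blast
    have "D (L 1) = 0"
    proof (rule analytic_continuation_open[where f = "\<lambda>v. D (L v)" and g = "\<lambda>_. 0"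
          and s = "s \<inter> L -` ball z0 r" and s' = "L -` ball z0 r"])
      have Lcont: "continuous_on UNIV L" unfolding L_def by (intro continuous_intros)
      have opn: "open (L -` ball z0 r)" by (rule open_vimage[OF open_ball Lcont])
      then show "open (L -` ball z0 r)" .
      show "open (s \<inter> L -` ball z0 r)" using s opn by blast
      show "s \<inter> L -` ball z0 r \<noteq> {}" using s L01 r by force
      show "s \<inter> L -` ball z0 r \<subseteq> L -` ball z0 r" by blast
      show "D (L v) = 0" if "v \<in> s \<inter> L -` ball z0 r" for v using s(3) that by blast
      have "convex (L -` ball z0 r)"
      proof -
        have "linear (\<lambda>v. (e1 * v, e2 * v))"
          by (rule linearI) (auto simp: ring_distribs)
        moreover have "L -` ball z0 r = (\<lambda>v. (e1 * v, e2 * v)) -` ball 0 r"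
          unfolding vimage_def mem_ball L_eq by (simp add: dist_norm)
        ultimately show ?thesis by (simp add: convex_linear_vimage)
      qed
      then show "connected (L -` ball z0 r)" by (rule convex_connected)
      show "(\<lambda>v. D (L v)) holomorphic_on L -` ball z0 r"
      proof -
        have "hol2 (\<lambda>z. D (fst z0 + e1 * fst z + 0 * snd z, snd z0 + e2 * fst z + 0 * snd z))
           ((\<lambda>z. (fst z0 + e1 * fst z + 0 * snd z, snd z0 + e2 * fst z + 0 * snd z)) -` ball z0 r)"
          by (rule hol2_affine[OF D])
        from hol2_slice1[OF this, of "L -` ball z0 r" 0] show ?thesis by (simp add: L_def)
      qed
      show "1 \<in> L -` ball z0 r" using z1 L01 by simp
    qed simp
    with z1 L01 show False by simp
  qed
  ultimately show ?thesis using that[of e1 e2] by (simp add: L_def)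
qed

lemma zero_direction_at:
  fixes A B D :: "complex \<times> complex \<Rightarrow> complex"
  assumes r: "r > 0" and D: "hol2 D (ball z0 r)" and A: "hol2 A (ball z0 r)" and B: "hol2 B (ball z0 r)"
    and nz: "\<not> (\<forall>\<^sub>F z in nhds z0. D z = 0)"
  shows "\<exists>w1 w2 :: real. \<forall>\<^sub>F z in nhds z0. D z = 0 \<longrightarrow>
           (\<forall>s. A z = s * of_real w1 \<longrightarrow> B z = s * of_real w2 \<longrightarrow> s = 0)"
proof -
  obtain e1 e2 where e: "(e1, e2) \<noteq> (0, 0)" "\<not> (\<forall>\<^sub>F v in nhds 0. D (fst z0 + e1 * v, snd z0 + e2 * v) = 0)"
    by (rule eventually_zero_on_line[OF D r nz])
  \<comment> \<open>A vector that completes \<open>(e1, e2)\<close> to a basis. \<open>L\<close>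
    sends the second axis to the chosen line, and \<open>K\<close> is its inverse.\<close>
  define f1 f2 where "f1 = (if e1 = 0 then 1 else 0 :: complex)" and "f2 = (if e1 = 0 then 0 else 1 :: complex)"
  define \<delta> where "\<delta> = f1 * e2 - e1 * f2"
  have \<delta>: "\<delta> \<noteq> 0" using e(1) by (auto simp: \<delta>_def f1_def f2_def)
  define L where "L z = (fst z0 + f1 * fst z + e1 * snd z, snd z0 + f2 * fst z + e2 * snd z)" for z
  define K where "K z = ((e2 * (fst z - fst z0) - e1 * (snd z - snd z0)) / \<delta>,
      (f1 * (snd z - snd z0) - f2 * (fst z - fst z0)) / \<delta>)" for z
  have LK: "L (K z) = z" for z
  proof -
    have "f1 * (e2 * x - e1 * y) + e1 * (f1 * y - f2 * x) = x * \<delta>"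
      "f2 * (e2 * x - e1 * y) + e2 * (f1 * y - f2 * x) = y * \<delta>" for x y
      by (simp_all add: \<delta>_def algebra_simps)
    then have "(f1 * (e2 * x - e1 * y)) / \<delta> + (e1 * (f1 * y - f2 * x)) / \<delta> = x"
      "(f2 * (e2 * x - e1 * y)) / \<delta> + (e2 * (f1 * y - f2 * x)) / \<delta> = y" for x y
      using \<delta> by (simp_all flip: add_divide_distrib)
    then show ?thesis by (simp add: L_def K_def prod_eq_iff add.assoc)
  qed
  have K0: "K z0 = (0, 0)" by (simp add: K_def)
  have L0: "L (0, 0) = z0" by (simp add: L_def)
  define S where "S = L -` ball z0 r"
  have oS: "open S" unfolding S_def L_def by (intro open_vimage open_ball continuous_intros)
  have S0: "(0, 0) \<in> S" using r by (simp add: S_def L0)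
  have comp: "hol2 (\<lambda>z. f (L z)) S" if "hol2 f (ball z0 r)" for f
    unfolding S_def L_def[abs_def] by (rule hol2_affine[OF that])
  have "\<not> (\<forall>\<^sub>F v in nhds 0. D (L (0, v)) = 0)"
    using e(2) by (simp add: L_def)
  from zero_direction_form[OF oS S0 comp[OF D] comp[OF A] comp[OF B] this]
  obtain d c where "\<exists>i\<le>d. c i \<noteq> 0" and
    dir: "\<forall>w1 w2. (\<Sum>i\<le>d. c i * w1 ^ i * w2 ^ (d - i)) \<noteq> 0 \<longrightarrow>
       (\<forall>\<^sub>F z in nhds (0, 0). D (L z) = 0 \<longrightarrow> (\<forall>s. A (L z) = s * w1 \<longrightarrow> B (L z) = s * w2 \<longrightarrow> s = 0))"
    by blast
  obtain w1 w2 :: real where "(\<Sum>i\<le>d. c i * of_real w1 ^ i * of_real w2 ^ (d - i)) \<noteq> 0"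
    by (rule exists_real_nonzero_form[OF \<open>\<exists>i\<le>d. c i \<noteq> 0\<close>])
  then have ev: "\<forall>\<^sub>F z in nhds (0, 0). D (L z) = 0 \<longrightarrow>
      (\<forall>s. A (L z) = s * of_real w1 \<longrightarrow> B (L z) = s * of_real w2 \<longrightarrow> s = 0)"
    using dir by blast
  have "isCont K z0" unfolding K_def[abs_def] using \<delta> by (intro continuous_intros) auto
  then have "filterlim K (nhds (K z0)) (nhds z0)"
    by (simp add: isCont_def tendsto_at_iff_tendsto_nhds)
  then have "filterlim K (nhds (0, 0)) (nhds z0)" unfolding K0 .
  then have "\<forall>\<^sub>F z in nhds z0. D (L (K z)) = 0 \<longrightarrow>
      (\<forall>s. A (L (K z)) = s * of_real w1 \<longrightarrow> B (L (K z)) = s * of_real w2 \<longrightarrow> s = 0)"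
    using ev by (rule eventually_compose_filterlim[rotated])
  then show ?thesis unfolding LK by blast
qed

section \<open>Real points: derivatives, level sets and the choice of a direction\<close>

lemma cpoint_linear: "linear cpoint"
  by (rule linearI) (auto simp: cpoint_def scaleR_conv_of_real)

lemma has_derivative_cpoint: "(cpoint has_derivative cpoint) (at q)"
  by (rule bounded_linear_imp_has_derivative) (simp add: linear_conv_bounded_linear[symmetric] cpoint_linear)

lemma norm_cpoint: "norm (cpoint q) = norm q"
  by (cases q) (simp add: cpoint_def norm_prod_def)

lemma dist_cpoint: "dist (cpoint p) (cpoint q) = dist p q"
  using norm_cpoint[of "p - q"] linear_diff[OF cpoint_linear] by (simp add: dist_norm)

lemma filterlim_cpoint: "filterlim cpoint (nhds (cpoint q)) (nhds q)"
  using has_derivative_continuous[OF has_derivative_cpoint[of q]]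
  by (simp add: isCont_def tendsto_at_iff_tendsto_nhds)

text \<open>Along the real points the imaginary part of \<open>H\<close> is 0, so its derivative
  vanishes and both complex partial derivatives are real.\<close>

lemma has_derivative_of_real_cpoint:
  assumes H: "has_d12 H a b (cpoint q)" and U: "open U" "q \<in> U" "\<And>z. z \<in> U \<Longrightarrow> H (cpoint z) = of_real (h z)"
  shows "has_d12 h (Re a) (Re b) q" "a = of_real (Re a)" "b = of_real (Re b)"
proof -
  have "((\<lambda>z. H (cpoint z)) has_derivative (\<lambda>h. a * fst (cpoint h) + b * snd (cpoint h))) (at q)"
    by (rule has_derivative_compose[OF has_derivative_cpoint H])
  then have *: "((\<lambda>z. of_real (h z)) has_derivative (\<lambda>h. a * fst (cpoint h) + b * snd (cpoint h))) (at q)"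
    by (rule has_derivative_transform_within_open[OF _ U(1,2)]) (simp add: U(3))
  from has_derivative_Re[OF this] show "has_d12 h (Re a) (Re b) q"
    by (simp add: cpoint_def)
  from has_derivative_Im[OF *] have "((\<lambda>z. 0 :: real) has_derivative (\<lambda>h. Im a * fst h + Im b * snd h)) (at q)"
    by (simp add: cpoint_def)
  then have "(\<lambda>h :: real \<times> real. Im a * fst h + Im b * snd h) = (\<lambda>h. 0)"
    using has_derivative_unique has_derivative_const by blast
  from fun_cong[OF this, of "(1, 0)"] fun_cong[OF this, of "(0, 1)"]
  show "a = of_real (Re a)" "b = of_real (Re b)" by (simp_all add: complex_eq_iff)
qed

text \<open>A substitute for Lagrange multipliers when the second constraint depends on the first one.\<close>

lemma descend_along_level_set:
  fixes p q g :: "real \<times> real \<Rightarrow> real"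
  assumes U: "open U" "x0 \<in> U"
    and p: "\<And>x. x \<in> U \<Longrightarrow> has_d12 p (p1 x) (p2 x) x" and cp: "continuous_on U p1" "continuous_on U p2"
    and q: "\<And>x. x \<in> U \<Longrightarrow> has_d12 q (q1 x) (q2 x) x"
    and g: "\<And>x. x \<in> U \<Longrightarrow> has_d12 g (g1 x) (g2 x) x" and cg: "continuous_on U g1" "continuous_on U g2"
    and dep: "\<And>x. x \<in> U \<Longrightarrow> p1 x * q2 x - p2 x * q1 x = 0"
    and det: "p1 x0 * g2 x0 - p2 x0 * g1 x0 \<noteq> 0"
  shows "\<exists>x\<in>U. p x = p x0 \<and> q x = q x0 \<and> g x < g x0"
proof -
  define f where "f x = (p x, g x)" for x
  define f' where "f' x h = (p1 x * fst h + p2 x * snd h, g1 x * fst h + g2 x * snd h)" for x h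
  have der: "(f has_derivative f' x) (at x)" if "x \<in> U" for x
    unfolding f_def[abs_def] f'_def[abs_def] by (intro has_derivative_Pair p g that)
  have inj: "inj (f' x0)"
  proof (rule injI)
    fix h k assume eq: "f' x0 h = f' x0 k"
    have e: "p1 x0 * (fst h - fst k) + p2 x0 * (snd h - snd k) = 0"
      "g1 x0 * (fst h - fst k) + g2 x0 * (snd h - snd k) = 0"
      using eq by (simp_all add: f'_def algebra_simps)
    from cramer2[OF e det] show "h = k" by (simp add: prod_eq_iff)
  qed
  have "continuous_on U (\<lambda>x. f' x i)" for i
    unfolding f'_def by (intro continuous_intros cp cg)
  then obtain U' V \<gamma> where U': "open U'" "U' \<subseteq> U" "x0 \<in> U'" and V: "open V" "f x0 \<in> V"
    and hom: "homeomorphism U' V f \<gamma>"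
    and d\<gamma>: "\<And>y. y \<in> V \<Longrightarrow> (\<gamma> has_derivative inv_into UNIV (f' (\<gamma> y))) (at y)"
    and bij: "\<And>y. y \<in> V \<Longrightarrow> bij (f' (\<gamma> y))"
    using inverse_function_C1[OF U(1) der _ U(2) inj] by metis
  have f\<gamma>: "f (\<gamma> y) = y" "\<gamma> y \<in> U" if "y \<in> V" for y
    using hom U'(2) that by (auto simp: homeomorphism_def)
  have \<gamma>0: "\<gamma> (p x0, g x0) = x0"
    using hom U'(3) by (auto simp: homeomorphism_def f_def)
  obtain e where e: "e > 0" "ball (f x0) e \<subseteq> V" using V open_contains_ball by blast
  \<comment> \<open>In the coordinates \<open>(p, g)\<close> provided by the inverse function this
    curve keeps \<open>p\<close> and lowers \<open>g\<close>; it remains to see that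
    \<open>q\<close> is constant along it.\<close>
  define c where "c t = (p x0, g x0 - t)" for t
  have cV: "c t \<in> V" if "t \<in> {0..e/2}" for t
    using e that by (intro subsetD[OF e(2)]) (simp add: c_def f_def dist_Pair_Pair dist_real_def)
  have der0: "((\<lambda>t. q (\<gamma> (c t))) has_derivative (\<lambda>h. 0)) (at t within {0..e/2})" if t: "t \<in> {0..e/2}" for t
  proof -
    define x where "x = \<gamma> (c t)"
    have x: "x \<in> U" unfolding x_def by (rule f\<gamma>(2)[OF cV[OF t]])
    have "(c has_derivative (\<lambda>h. (0, - h))) (at t)"
      unfolding c_def[abs_def] by (auto intro!: derivative_eq_intros)
    from has_derivative_compose[OF this d\<gamma>[OF cV[OF t]]]
    have "((\<lambda>t. \<gamma> (c t)) has_derivative (\<lambda>h. inv_into UNIV (f' x) (0, - h))) (at t)"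
      unfolding x_def .
    from has_derivative_compose[OF this, OF q[OF x, unfolded x_def]]
    have "((\<lambda>t. q (\<gamma> (c t))) has_derivative
        (\<lambda>h. q1 x * fst (inv_into UNIV (f' x) (0, - h)) + q2 x * snd (inv_into UNIV (f' x) (0, - h)))) (at t)"
      unfolding x_def .
    moreover have "q1 x * fst (inv_into UNIV (f' x) (0, - h)) + q2 x * snd (inv_into UNIV (f' x) (0, - h)) = 0" for h
    proof -
      define k where "k = inv_into UNIV (f' x) (0, - h)"
      have surj: "surj (f' x)" and injx: "inj (f' x)" using bij[OF cV[OF t]] by (auto simp: x_def bij_def)
      have "f' x k = (0, - h)" unfolding k_def using surj by (rule surj_f_inv_f)
      then have k: "p1 x * fst k + p2 x * snd k = 0" by (simp add: f'_def)
      \<comment> \<open>The differential of \<open>p\<close> vanishes at \<open>k\<close>. By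
        dependence, either component of it times the value of the differential of \<open>q\<close>
        at \<open>k\<close> is 0; surjectivity of \<open>f' x\<close> excludes that both components
        are 0.\<close>
      have "p1 x * (q1 x * fst k + q2 x * snd k) = q1 x * (p1 x * fst k + p2 x * snd k)
          + (p1 x * q2 x - p2 x * q1 x) * snd k"
        "p2 x * (q1 x * fst k + q2 x * snd k) = q2 x * (p1 x * fst k + p2 x * snd k) - (p1 x * q2 x - p2 x *
            q1 x) * fst k"
        by (simp_all add: algebra_simps)
      then have "p1 x * (q1 x * fst k + q2 x * snd k) = 0" "p2 x * (q1 x * fst k + q2 x * snd k) = 0"
        using k dep[OF x] by simp_all
      moreover have "\<not> (p1 x = 0 \<and> p2 x = 0)"
      proof
        assume "p1 x = 0 \<and> p2 x = 0"
        then have "fst (f' x z) = 0" for z by (simp add: f'_def)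
        moreover obtain z where "f' x z = (1, 0)" using surj by (metis surjD)
        ultimately show False by (metis fst_conv zero_neq_one)
      qed
      ultimately show ?thesis unfolding k_def by auto
    qed
    ultimately show ?thesis by (simp add: has_derivative_at_withinI)
  qed
  have "q (\<gamma> (c (e/2))) = q (\<gamma> (c 0))"
    by (rule has_derivative_zero_unique[OF convex_real_interval(5) der0]) (use e in auto)
  moreover have "\<gamma> (c 0) = x0" by (simp add: c_def \<gamma>0)
  moreover have "f (\<gamma> (c (e/2))) = c (e/2)" "\<gamma> (c (e/2)) \<in> U"
    using f\<gamma>[OF cV[of "e/2"]] e by auto
  ultimately show ?thesis
    using e by (intro bexI[of _ "\<gamma> (c (e/2))"]) (auto simp: f_def c_def)
qed

text \<open>If the Jacobian vanishes identically, \<open>D\<close> is instead the Jacobian of \<open>P\<close> and a definite quadratic form \<open>g\<close>: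
  a point of a compact piece of a level set of \<open>(P, Q)\<close> at which \<open>g\<close> is least is a zero of \<open>D\<close>.\<close>

lemma real_direction:
  fixes P Q :: "complex \<times> complex \<Rightarrow> complex" and p q :: "real \<times> real \<Rightarrow> real"
  assumes r: "r > 0" and P: "hol2 P (ball (cpoint x0) r)" and Q: "hol2 Q (ball (cpoint x0) r)"
    and P0: "P (cpoint x0) = 0"
    and Pp: "\<And>x. x \<in> ball x0 r \<Longrightarrow> P (cpoint x) = of_real (p x)"
    and Qq: "\<And>x. x \<in> ball x0 r \<Longrightarrow> Q (cpoint x) = of_real (q x)"
  shows "\<exists>w1 w2 :: real. \<forall>\<^sub>F x in nhds x0. \<forall>s. s \<noteq> 0 \<longrightarrow> p x = s * w1 \<longrightarrow> q x = s * w2 \<longrightarrow>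
           d1 P (cpoint x) * d2 Q (cpoint x) - d2 P (cpoint x) * d1 Q (cpoint x) \<noteq> 0"
proof -
  define z0 where "z0 = cpoint x0"
  define J where "J z = d1 P z * d2 Q z - d2 P z * d1 Q z" for z
  have Ph: "hol2 P (ball z0 r)" and Qh: "hol2 Q (ball z0 r)" using P Q by (simp_all add: z0_def)
  have d12h: "hol2 (d1 P) (ball z0 r)" "hol2 (d2 P) (ball z0 r)" "hol2 (d1 Q) (ball z0 r)" "hol2 (d2 Q) (ball z0 r)"
    using hol2_d12[OF open_ball Ph] hol2_d12[OF open_ball Qh] by auto
  have Jh: "hol2 J (ball z0 r)"
    unfolding J_def[abs_def] by (intro hol2_diff hol2_mult d12h)
  have near: "\<forall>\<^sub>F x in nhds x0. x \<in> ball x0 r"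
    by (rule eventually_nhds_in_open) (use r in auto)
  have cp: "filterlim cpoint (nhds z0) (nhds x0)" unfolding z0_def by (rule filterlim_cpoint)
  have transfer: "\<exists>w1 w2 :: real. \<forall>\<^sub>F x in nhds x0. D (cpoint x) = 0 \<longrightarrow>
      (\<forall>s. p x = s * w1 \<longrightarrow> q x = s * w2 \<longrightarrow> s = 0)"
    if D: "hol2 D (ball z0 r)" "\<not> (\<forall>\<^sub>F z in nhds z0. D z = 0)" for D
  proof -
    from zero_direction_at[OF r D(1) Ph Qh D(2)] obtain w1 w2 :: real
      where w: "\<forall>\<^sub>F z in nhds z0. D z = 0 \<longrightarrow> (\<forall>s. P z = s * of_real w1 \<longrightarrow> Q z = s * of_real w2 \<longrightarrow> s = 0)"
      by blast
    have "\<forall>\<^sub>F x in nhds x0. D (cpoint x) = 0 \<longrightarrow>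
        (\<forall>s. P (cpoint x) = s * of_real w1 \<longrightarrow> Q (cpoint x) = s * of_real w2 \<longrightarrow> s = 0)"
      using cp w by (rule eventually_compose_filterlim[rotated])
    then have "\<forall>\<^sub>F x in nhds x0. D (cpoint x) = 0 \<longrightarrow> (\<forall>s. p x = s * w1 \<longrightarrow> q x = s * w2 \<longrightarrow> s = 0)"
      using near
    proof eventually_elim
      case (elim x)
      show ?case
      proof (intro impI allI)
        fix s assume "D (cpoint x) = 0" "p x = s * w1" "q x = s * w2"
        then have "of_real s = (0 :: complex)"
          using elim(1) Pp[OF elim(2)] Qq[OF elim(2)] by (metis of_real_mult)
        then show "s = 0" by simp
      qed
    qed
    then show ?thesis by blast
  qed
  show ?thesis
  proof (cases "\<forall>\<^sub>F z in nhds z0. J z = 0")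
    case False
    from transfer[OF Jh this] obtain w1 w2 :: real
      where "\<forall>\<^sub>F x in nhds x0. J (cpoint x) = 0 \<longrightarrow> (\<forall>s. p x = s * w1 \<longrightarrow> q x = s * w2 \<longrightarrow> s = 0)" by blast
    then have "\<forall>\<^sub>F x in nhds x0. \<forall>s. s \<noteq> 0 \<longrightarrow> p x = s * w1 \<longrightarrow> q x = s * w2 \<longrightarrow> J (cpoint x) \<noteq> 0"
      by eventually_elim blast
    then show ?thesis unfolding J_def by blast
  next
    case J0: True
    show ?thesis
    proof (cases "\<forall>\<^sub>F z in nhds z0. P z = 0")
      \<comment> \<open>If the first component vanishes identically, the direction
        \<open>(1, 0)\<close> is never attained with \<open>s \<noteq> 0\<close>.\<close>
      case True
      have "\<forall>\<^sub>F x in nhds x0. P (cpoint x) = 0" using cp True by (rule eventually_compose_filterlim[rotated])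
      then have "\<forall>\<^sub>F x in nhds x0. \<forall>s. s \<noteq> 0 \<longrightarrow> p x = s * 1 \<longrightarrow> q x = s * 0 \<longrightarrow> J (cpoint x) \<noteq> 0"
        using near
      proof eventually_elim
        case (elim x)
        then show ?case using Pp[of x] by simp
      qed
      then show ?thesis unfolding J_def by blast
    next
      case Pnz: False
      define a b where "a = fst x0" and "b = snd x0"
      \<comment> \<open>The Jacobian of \<open>P\<close> and
        \<open>(x - a)^2 + k * (y - b)^2\<close>. A single \<open>k\<close> would not do, as
        \<open>P\<close> could be a function of that very form; for both \<open>k = 1\<close> and
        \<open>k = 2\<close> the Jacobian vanishes near \<open>z0\<close> only if \<open>P\<close>
        is constant there.\<close>
      define D where "D k z = d1 P z * (of_real (2 * k) * (snd z - of_real b)) - d2 P z * (of_real 2 *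
          (fst z - of_real a))" for k z
      have Dh: "hol2 (D k) (ball z0 r)" for k
        unfolding D_def[abs_def] by (intro hol2_intros d12h)
      have "\<exists>k\<in>{1, 2}. \<not> (\<forall>\<^sub>F z in nhds z0. D k z = 0)"
      proof (rule ccontr)
        assume "\<not> ?thesis"
        then have "\<forall>\<^sub>F z in nhds z0. D 1 z = 0" "\<forall>\<^sub>F z in nhds z0. D 2 z = 0" by auto
        then have "\<forall>\<^sub>F z in nhds z0. d1 P z * (snd z - of_real b) = 0 \<and> d2 P z * (fst z - of_real a) = 0"
        proof eventually_elim
          case (elim z)
          define A B where "A = d1 P z * (snd z - of_real b)" and "B = d2 P z * (fst z - of_real a)"
          have AB: "2 * A - 2 * B = 0" "4 * A - 2 * B = 0"
            using elim by (simp_all add: D_def A_def B_def algebra_simps)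
          have "2 * A = (4 * A - 2 * B) - (2 * A - 2 * B)" by simp
          then have "A = 0 \<and> B = 0" using AB by simp
          then show ?case by (simp add: A_def B_def)
        qed
        then obtain e where e: "e > 0" "\<forall>z. dist z z0 < e \<longrightarrow> d1 P z * (snd z - of_real b) = 0
            \<and> d2 P z * (fst z - of_real a) = 0"
          unfolding eventually_nhds_metric by blast
        define \<rho> where "\<rho> = min e r"
        have \<rho>: "\<rho> > 0" "\<rho> \<le> e" "\<rho> \<le> r" using e r by (auto simp: \<rho>_def)
        have contd: "isCont (d1 P) z" "isCont (d2 P) z" if "z \<in> ball z0 \<rho>" for z
          using hol2_continuous_on[OF d12h(1)] hol2_continuous_on[OF d12h(2)] that \<rho>
          by (auto simp: continuous_on_eq_continuous_at)
        \<comment> \<open>Off the line where the coordinate factor is 0 the derivative vanishes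
          directly; on that line its value is a limit along a transversal line.\<close>
        have punct: "F z = 0" if F: "isCont F z" and line: "isCont L t0" "L t0 = z" and U: "open U" "z \<in> U"
            and zero: "\<And>t. t \<noteq> t0 \<Longrightarrow> L t \<in> U \<Longrightarrow> F (L t) = 0"
          for F :: "complex \<times> complex \<Rightarrow> complex" and z L U and t0 :: complex
        proof -
          have "isCont (\<lambda>t. F (L t)) t0"
            using isCont_o2[OF line(1)] F line(2) by simp
          then have lim: "(\<lambda>t. F (L t)) \<midarrow>t0\<rightarrow> F z" using line(2) by (simp add: isCont_def)
          have "\<forall>\<^sub>F t in at t0. L t \<in> U"
            using line U by (intro topological_tendstoD[of L z]) (auto simp: isCont_def)
          then have "\<forall>\<^sub>F t in at t0. F (L t) = 0"
            using eventually_neq_at_within[of t0 t0 UNIV] by eventually_elim (rule zero)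
          then have "(\<lambda>t. F (L t)) \<midarrow>t0\<rightarrow> 0" by (rule tendsto_eventually)
          with lim show ?thesis using tendsto_unique trivial_limit_at by blast
        qed
        have d1z: "d1 P z = 0" if z: "z \<in> ball z0 \<rho>" for z
        proof (cases "snd z = of_real b")
          case False
          then show ?thesis using e(2)[rule_format, of z] z \<rho> by (simp add: dist_commute)
        next
          case True
          show ?thesis
          proof (rule punct[where L = "\<lambda>t. (fst z, t)" and ?t0.0 = "of_real b" and U = "ball z0 \<rho>"])
            show "d1 P (fst z, t) = 0" if "t \<noteq> of_real b" "(fst z, t) \<in> ball z0 \<rho>" for t
              using e(2)[rule_format, of "(fst z, t)"] that \<rho> by (simp add: dist_commute)
          qed (use z True contd in \<open>auto simp: prod_eq_iff intro!: continuous_intros\<close>)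
        qed
        have d2z: "d2 P z = 0" if z: "z \<in> ball z0 \<rho>" for z
        proof (cases "fst z = of_real a")
          case False
          then show ?thesis using e(2)[rule_format, of z] z \<rho> by (simp add: dist_commute)
        next
          case True
          show ?thesis
          proof (rule punct[where L = "\<lambda>t. (t, snd z)" and ?t0.0 = "of_real a" and U = "ball z0 \<rho>"])
            show "d2 P (t, snd z) = 0" if "t \<noteq> of_real a" "(t, snd z) \<in> ball z0 \<rho>" for t
              using e(2)[rule_format, of "(t, snd z)"] that \<rho> by (simp add: dist_commute)
          qed (use z True contd in \<open>auto simp: prod_eq_iff intro!: continuous_intros\<close>)
        qed
        have "P z = P z0" if z: "z \<in> ball z0 \<rho>" for z
        proof (rule has_derivative_zero_unique[OF convex_ball _ z])
          show "(P has_derivative (\<lambda>h. 0)) (at y within ball z0 \<rho>)" if y: "y \<in> ball z0 \<rho>" for y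
            by (rule has_derivative_at_withinI) (use hol2D[OF Ph, of y] y \<rho> d1z[OF y] d2z[OF y] in simp)
        qed (use \<rho> in simp)
        then have "\<forall>\<^sub>F z in nhds z0. P z = 0"
          unfolding eventually_nhds using \<rho> P0 by (intro exI[of _ "ball z0 \<rho>"]) (auto simp: z0_def)
        with Pnz show False ..
      qed
      then obtain k :: real where k: "k = 1 \<or> k = 2" and Dnz: "\<not> (\<forall>\<^sub>F z in nhds z0. D k z = 0)" by blast
      from transfer[OF Dh Dnz] obtain w1 w2 :: real
        where w: "\<forall>\<^sub>F x in nhds x0. D k (cpoint x) = 0 \<longrightarrow> (\<forall>s. p x = s * w1 \<longrightarrow> q x = s * w2 \<longrightarrow> s = 0)" by blast
      have "\<forall>\<^sub>F x in nhds x0. J (cpoint x) = 0" using cp J0 by (rule eventually_compose_filterlim[rotated])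
      from eventually_conj[OF w this] obtain e where e: "e > 0" "\<forall>x. dist x x0 < e \<longrightarrow>
          (D k (cpoint x) = 0 \<longrightarrow> (\<forall>s. p x = s * w1 \<longrightarrow> q x = s * w2 \<longrightarrow> s = 0)) \<and> J (cpoint x) = 0"
        unfolding eventually_nhds_metric by blast
      define \<eta> where "\<eta> = min e r / 2"
      have \<eta>: "\<eta> > 0" "2 * \<eta> \<le> e" "2 * \<eta> \<le> r" using e r by (auto simp: \<eta>_def)
      have dp: "has_d12 p (Re (d1 P (cpoint x))) (Re (d2 P (cpoint x))) x"
          "d1 P (cpoint x) = of_real (Re (d1 P (cpoint x)))" "d2 P (cpoint x) = of_real (Re (d2 P (cpoint x)))"
          "has_d12 q (Re (d1 Q (cpoint x))) (Re (d2 Q (cpoint x))) x"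
          "d1 Q (cpoint x) = of_real (Re (d1 Q (cpoint x)))" "d2 Q (cpoint x) = of_real (Re (d2 Q (cpoint x)))"
        if "x \<in> ball x0 r" for x
      proof -
        have "cpoint x \<in> ball z0 r" using that by (simp add: z0_def dist_cpoint)
        then have "has_d12 P (d1 P (cpoint x)) (d2 P (cpoint x)) (cpoint x)"
            "has_d12 Q (d1 Q (cpoint x)) (d2 Q (cpoint x)) (cpoint x)"
          using hol2D[OF Ph] hol2D[OF Qh] by auto
        from has_derivative_of_real_cpoint[OF this(1) open_ball that Pp] has_derivative_of_real_cpoint[OF
            this(2) open_ball that Qq]
        show "has_d12 p (Re (d1 P (cpoint x))) (Re (d2 P (cpoint x))) x"
          "d1 P (cpoint x) = of_real (Re (d1 P (cpoint x)))" "d2 P (cpoint x) = of_real (Re (d2 P (cpoint x)))"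
          "has_d12 q (Re (d1 Q (cpoint x))) (Re (d2 Q (cpoint x))) x"
          "d1 Q (cpoint x) = of_real (Re (d1 Q (cpoint x)))" "d2 Q (cpoint x) = of_real (Re (d2 Q (cpoint x)))"
          by blast+
      qed
      have contp: "continuous_on (ball x0 r) p" "continuous_on (ball x0 r) q"
        by (intro continuous_at_imp_continuous_on ballI; rule has_derivative_continuous, erule dp)+
      define g where "g x = (fst x - a)\<^sup>2 + k * (snd x - b)\<^sup>2" for x
      have g_le: "(dist x x0)\<^sup>2 \<le> g x" "g x \<le> 2 * (dist x x0)\<^sup>2" for x
        using k by (auto simp: g_def dist_prod_def dist_real_def a_def b_def)
      \<comment> \<open>By contradiction: were \<open>x\<close> on the level of
        \<open>s * w1\<close> and \<open>s * w2\<close>, take the point \<open>y\<close> of that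
        level in \<open>cball x0 \<eta>\<close> at which \<open>g\<close> is least. It is an
        interior point and not a zero of \<open>D k\<close>, so \<open>g\<close> can still be
        lowered on the level.\<close>
      have "p x \<noteq> s * w1 \<or> q x \<noteq> s * w2" if x: "x \<in> ball x0 (\<eta> / 2)" and s: "s \<noteq> 0" for x s
      proof (rule ccontr)
        assume "\<not> ?thesis"
        then have xs: "p x = s * w1" "q x = s * w2" by auto
        define K where "K = {y \<in> cball x0 \<eta>. p y \<in> {p x}} \<inter> {y \<in> cball x0 \<eta>. q y \<in> {q x}}"
        have "cball x0 \<eta> \<subseteq> ball x0 r" using \<eta> by auto
        then have "closed {y \<in> cball x0 \<eta>. p y \<in> {p x}}" "closed {y \<in> cball x0 \<eta>. q y \<in> {q x}}"
          using continuous_closed_preimage[OF continuous_on_subset[OF contp(1)] closed_cball closed_singleton]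
            continuous_closed_preimage[OF continuous_on_subset[OF contp(2)] closed_cball closed_singleton]
          by (simp_all add: vimage_def Int_def)
        then have "closed K" unfolding K_def by (rule closed_Int)
        moreover have "bounded K" unfolding K_def by (rule bounded_subset[OF bounded_cball]) auto
        ultimately have "compact K" by (simp add: compact_eq_bounded_closed)
        moreover have xK: "x \<in> K" using x \<eta> by (auto simp: K_def)
        moreover have "continuous_on K g" unfolding g_def by (intro continuous_intros)
        ultimately obtain y where y: "y \<in> K" "\<forall>v\<in>K. g y \<le> g v"
          using continuous_attains_inf[of K g] by blast
        \<comment> \<open>Starting in the ball of radius \<open>\<eta> / 2\<close> absorbs the
          factor 2 between \<open>g\<close> and the squared distance, so \<open>y\<close> stays off
          the boundary sphere.\<close>
        have "(dist y x0)\<^sup>2 \<le> g x" using g_le(1)[of y] y(2) xK by fastforce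
        also have "\<dots> \<le> 2 * (\<eta> / 2)\<^sup>2"
          using x by (intro order_trans[OF g_le(2)] mult_left_mono power_mono) (auto simp: dist_commute)
        also have "\<dots> < \<eta>\<^sup>2" using \<eta> by (simp add: power2_eq_square)
        finally have "dist y x0 < \<eta>" using \<eta> by (intro power2_less_imp_less[of _ \<eta>]) auto
        then have yU: "y \<in> ball x0 \<eta>" by (simp add: dist_commute)
        have sub: "v \<in> ball x0 r" "dist v x0 < e" if "v \<in> ball x0 \<eta>" for v
          using that \<eta> by (auto simp: dist_commute)
        let ?p1 = "\<lambda>x. Re (d1 P (cpoint x))" and ?p2 = "\<lambda>x. Re (d2 P (cpoint x))"
        let ?q1 = "\<lambda>x. Re (d1 Q (cpoint x))" and ?q2 = "\<lambda>x. Re (d2 Q (cpoint x))"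
        have contRe: "continuous_on (ball x0 \<eta>) (\<lambda>x. Re (F (cpoint x)))" if "hol2 F (ball z0 r)" for F
        proof -
          have "continuous_on (ball x0 \<eta>) cpoint" unfolding cpoint_def by (intro continuous_intros)
          then have "continuous_on (ball x0 \<eta>) (\<lambda>x. F (cpoint x))"
            by (rule continuous_on_compose2[OF hol2_continuous_on[OF that]])
                (use \<eta> in \<open>auto simp: z0_def dist_cpoint\<close>)
          then show ?thesis by (intro continuous_intros)
        qed
        have Dy: "D k (cpoint y) \<noteq> 0"
          using e(2)[THEN spec, THEN mp, OF sub(2)[OF yU]] y(1) xs s by (auto simp: K_def)
        have "D k (cpoint y) = of_real (?p1 y * (2 * k * (snd y - b)) - ?p2 y * (2 * (fst y - a)))"
          unfolding D_def using dp(2,3)[OF sub(1)[OF yU]] by (simp add: cpoint_def)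
        with Dy have det: "?p1 y * (2 * k * (snd y - b)) - ?p2 y * (2 * (fst y - a)) \<noteq> 0" by (metis of_real_0)
        have "\<exists>v\<in>ball x0 \<eta>. p v = p y \<and> q v = q y \<and> g v < g y"
        proof (rule descend_along_level_set[OF open_ball yU, where p = p and ?p1.0 = ?p1 and ?p2.0 = ?p2
              and q = q and ?q1.0 = ?q1 and ?q2.0 = ?q2 and g = g
              and ?g1.0 = "\<lambda>x. 2 * (fst x - a)" and ?g2.0 = "\<lambda>x. 2 * k * (snd x - b)"])
          fix x assume x: "x \<in> ball x0 \<eta>"
          show "has_d12 p (?p1 x) (?p2 x) x" "has_d12 q (?q1 x) (?q2 x) x" by (rule dp[OF sub(1)[OF x]])+
          show "has_d12 g (2 * (fst x - a)) (2 * k * (snd x - b)) x"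
            unfolding g_def[abs_def] by (auto intro!: derivative_eq_intros simp: power2_eq_square algebra_simps)
          have "J (cpoint x) = of_real (?p1 x * ?q2 x - ?p2 x * ?q1 x)"
            unfolding J_def using dp[OF sub(1)[OF x]] by simp
          moreover have "J (cpoint x) = 0" using e(2) sub(2)[OF x] by blast
          ultimately show "?p1 x * ?q2 x - ?p2 x * ?q1 x = 0" by (metis of_real_eq_0_iff)
        next
          show "continuous_on (ball x0 \<eta>) ?p1" "continuous_on (ball x0 \<eta>) ?p2" by (intro contRe d12h)+
          show "continuous_on (ball x0 \<eta>) (\<lambda>x. 2 * (fst x - a))" "continuous_on (ball x0 \<eta>) (\<lambda>x. 2 * k * (snd x - b))"
            by (intro continuous_intros)+
        qed (fact det)
        then obtain v where v: "v \<in> ball x0 \<eta>" "p v = p y" "q v = q y" "g v < g y" by blast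
        then have "v \<in> K" using y(1) by (auto simp: K_def)
        with y(2) v(4) show False by force
      qed
      then have "\<forall>\<^sub>F x in nhds x0. \<forall>s. s \<noteq> 0 \<longrightarrow> p x = s * w1 \<longrightarrow> q x = s * w2 \<longrightarrow> J (cpoint x) \<noteq> 0"
        unfolding eventually_nhds using \<eta> by (intro exI[of _ "ball x0 (\<eta> / 2)"]) auto
      then show ?thesis unfolding J_def by blast
    qed
  qed
qed

section \<open>Functions of a point and of the perturbation parameter\<close>

text \<open>The argument is a pair of a point \<open>z\<close> and a parameter \<open>l\<close>,
  both in \<complex> x \<complex>. Continuous partial derivatives are part of the definition because
  the implicit function theorem asks for them.\<close>

definition hol4 :: "((complex \<times> complex) \<times> (complex \<times> complex) \<Rightarrow> complex) \<Rightarrow>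
    ((complex \<times> complex) \<times> (complex \<times> complex)) set \<Rightarrow> bool" where
  "hol4 F S \<longleftrightarrow> (\<exists>p1 p2 p3 p4. continuous_on S p1 \<and> continuous_on S p2 \<and> continuous_on S p3 \<and> continuous_on S p4 \<and>
     (\<forall>w\<in>S. has_d4 F (p1 w) (p2 w) (p3 w) (p4 w) w))"

lemma hol4I:
  assumes "continuous_on S p1" "continuous_on S p2" "continuous_on S p3" "continuous_on S p4"
    and "\<And>w. w \<in> S \<Longrightarrow> has_d4 F (p1 w) (p2 w) (p3 w) (p4 w) w"
  shows "hol4 F S"
  using assms unfolding hol4_def by blast

lemma hol4E:
  assumes "hol4 F S"
  obtains p1 p2 p3 p4 where "continuous_on S p1" "continuous_on S p2" "continuous_on S p3" "continuous_on S p4"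
    "\<forall>w\<in>S. has_d4 F (p1 w) (p2 w) (p3 w) (p4 w) w"
  using assms unfolding hol4_def by blast

lemma hol4_continuous_on: "hol4 F S \<Longrightarrow> continuous_on S F"
  by (erule hol4E, intro continuous_at_imp_continuous_on ballI) (rule has_derivative_continuous, blast)

lemma hol4_const: "hol4 (\<lambda>_. c) S"
  by (rule hol4I[where ?p1.0 = "\<lambda>_. 0" and ?p2.0 = "\<lambda>_. 0" and ?p3.0 = "\<lambda>_. 0" and ?p4.0 = "\<lambda>_. 0"]) auto

lemma hol4_param:
  "hol4 (\<lambda>w. fst (snd w)) S" "hol4 (\<lambda>w. snd (snd w)) S"
  by (rule hol4I[where ?p1.0 = "\<lambda>_. 0" and ?p2.0 = "\<lambda>_. 0" and ?p3.0 = "\<lambda>_. 1" and ?p4.0 = "\<lambda>_. 0"];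
      auto intro!: derivative_eq_intros)
     (rule hol4I[where ?p1.0 = "\<lambda>_. 0" and ?p2.0 = "\<lambda>_. 0" and ?p3.0 = "\<lambda>_. 0" and ?p4.0 = "\<lambda>_. 1"];
      auto intro!: derivative_eq_intros)

lemma hol4_hol2:
  assumes "open T" "hol2 f T" "\<And>w. w \<in> S \<Longrightarrow> fst w \<in> T"
  shows "hol4 (\<lambda>w. f (fst w)) S"
proof (rule hol4I[where ?p1.0 = "\<lambda>w. d1 f (fst w)" and ?p2.0 = "\<lambda>w. d2 f (fst w)" and ?p3.0 = "\<lambda>_. 0"
    and ?p4.0 = "\<lambda>_. 0"])
  show "continuous_on S (\<lambda>w. d1 f (fst w))" "continuous_on S (\<lambda>w. d2 f (fst w))"
    by (rule continuous_on_compose2[OF hol2_continuous_d1[OF assms(1,2)]] continuous_on_compose2[OF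
        hol2_continuous_d2[OF assms(1,2)]];
        use assms(3) in \<open>auto intro!: continuous_intros\<close>)+
  fix w assume w: "w \<in> S"
  have "(fst has_derivative fst) (at w)" by (intro has_derivative_fst has_derivative_ident)
  from has_derivative_compose[OF this hol2D[OF assms(2) assms(3)[OF w]]]
  show "has_d4 (\<lambda>w. f (fst w)) (d1 f (fst w)) (d2 f (fst w)) 0 0 w" by simp
qed auto

lemma hol4_add:
  assumes "hol4 F S" "hol4 G S"
  shows "hol4 (\<lambda>w. F w + G w) S"
proof -
  obtain p1 p2 p3 p4 where p: "continuous_on S p1" "continuous_on S p2" "continuous_on S p3" "continuous_on S p4"
    "\<forall>w\<in>S. has_d4 F (p1 w) (p2 w) (p3 w) (p4 w) w" by (rule hol4E[OF assms(1)])
  obtain q1 q2 q3 q4 where q: "continuous_on S q1" "continuous_on S q2" "continuous_on S q3" "continuous_on S q4"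
    "\<forall>w\<in>S. has_d4 G (q1 w) (q2 w) (q3 w) (q4 w) w" by (rule hol4E[OF assms(2)])
  show ?thesis
  proof (rule hol4I[where ?p1.0 = "\<lambda>w. p1 w + q1 w" and ?p2.0 = "\<lambda>w. p2 w + q2 w" and ?p3.0 = "\<lambda>w. p3 w + q3 w"
      and ?p4.0 = "\<lambda>w. p4 w + q4 w"])
    show "has_d4 (\<lambda>w. F w + G w) (p1 w + q1 w) (p2 w + q2 w) (p3 w + q3 w) (p4 w + q4 w) w" if "w \<in> S" for w
      using has_derivative_add[OF p(5)[rule_format, OF that] q(5)[rule_format, OF that]]
      by (rule has_derivative_eq_rhs) (simp add: fun_eq_iff algebra_simps)
  qed (intro continuous_intros p q)+
qed

lemma hol4_mult:
  assumes "hol4 F S" "hol4 G S"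
  shows "hol4 (\<lambda>w. F w * G w) S"
proof -
  obtain p1 p2 p3 p4 where p: "continuous_on S p1" "continuous_on S p2" "continuous_on S p3" "continuous_on S p4"
    "\<forall>w\<in>S. has_d4 F (p1 w) (p2 w) (p3 w) (p4 w) w" by (rule hol4E[OF assms(1)])
  obtain q1 q2 q3 q4 where q: "continuous_on S q1" "continuous_on S q2" "continuous_on S q3" "continuous_on S q4"
    "\<forall>w\<in>S. has_d4 G (q1 w) (q2 w) (q3 w) (q4 w) w" by (rule hol4E[OF assms(2)])
  show ?thesis
  proof (rule hol4I[where ?p1.0 = "\<lambda>w. F w * q1 w + p1 w * G w" and ?p2.0 = "\<lambda>w. F w * q2 w + p2 w * G w"
        and ?p3.0 = "\<lambda>w. F w * q3 w + p3 w * G w" and ?p4.0 = "\<lambda>w. F w * q4 w + p4 w * G w"])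
    show "has_d4 (\<lambda>w. F w * G w) (F w * q1 w + p1 w * G w) (F w * q2 w + p2 w * G w)
        (F w * q3 w + p3 w * G w) (F w * q4 w + p4 w * G w) w" if "w \<in> S" for w
      using has_derivative_mult[OF p(5)[rule_format, OF that] q(5)[rule_format, OF that]]
      by (rule has_derivative_eq_rhs) (simp add: fun_eq_iff algebra_simps)
  qed (intro continuous_intros p q hol4_continuous_on assms)+
qed

lemma hol4_diff:
  assumes "hol4 F S" "hol4 G S"
  shows "hol4 (\<lambda>w. F w - G w) S"
  using hol4_add[OF assms(1) hol4_mult[OF hol4_const[of "-1"] assms(2)]] by simp

lemmas hol4_intros = hol4_const hol4_param hol4_add hol4_diff hol4_mult

lemma has_d4_slices:
  assumes "has_d4 F a b c d (z, l)"
  shows "has_d12 (\<lambda>z. F (z, l)) a b z" and "has_d12 (\<lambda>l. F (z, l)) c d l"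
proof -
  have "((\<lambda>z. (z, l)) has_derivative (\<lambda>h. (h, 0))) (at z)" "((\<lambda>l. (z, l)) has_derivative (\<lambda>h. (0, h))) (at l)"
    by (auto intro!: derivative_eq_intros)
  from has_derivative_compose[OF this(1) assms] has_derivative_compose[OF this(2) assms]
  show "has_d12 (\<lambda>z. F (z, l)) a b z" "has_d12 (\<lambda>l. F (z, l)) c d l" by simp_all
qed

lemma hol4_slice: "hol4 F S \<Longrightarrow> (\<And>z. z \<in> T \<Longrightarrow> (z, l) \<in> S) \<Longrightarrow> hol2 (\<lambda>z. F (z, l)) T"
  by (erule hol4E) (rule hol2I, rule has_d4_slices(1), blast)

text \<open>Over a real point the conjugate of a solution \<open>l\<close> is again a solution, by
  the hypotheses \<open>real\<close>; uniqueness of small solutions makes \<Psi> real there. So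
  \<open>real_direction\<close> applies to \<Psi>, and the Jacobian clause of the implicit function
  theorem leads back to \<open>F1\<close> and \<open>F2\<close>.\<close>

lemma generic_direction:
  assumes r: "r > 0" and F1: "hol4 F1 (ball (cpoint x0) r \<times> UNIV)" and F2: "hol4 F2 (ball (cpoint x0) r \<times> UNIV)"
    and zero: "F1 (cpoint x0, (0, 0)) = 0" "F2 (cpoint x0, (0, 0)) = 0"
    and det: "d1 (\<lambda>l. F1 (cpoint x0, l)) (0, 0) * d2 (\<lambda>l. F2 (cpoint x0, l)) (0, 0)
            - d2 (\<lambda>l. F1 (cpoint x0, l)) (0, 0) * d1 (\<lambda>l. F2 (cpoint x0, l)) (0, 0) \<noteq> 0"
    and real: "\<And>x l1 l2. x \<in> ball x0 r \<Longrightarrow> F1 (cpoint x, (cnj l1, cnj l2)) = cnj (F1 (cpoint x, (l1, l2)))"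
      "\<And>x l1 l2. x \<in> ball x0 r \<Longrightarrow> F2 (cpoint x, (cnj l1, cnj l2)) = cnj (F2 (cpoint x, (l1, l2)))"
  shows "\<exists>w1 w2 :: real. \<exists>\<eta>>0. \<forall>x\<in>ball x0 \<eta>. \<forall>s::real. 0 < \<bar>s\<bar> \<longrightarrow> \<bar>s\<bar> < \<eta> \<longrightarrow>
     (let l = (of_real (s * w1), of_real (s * w2)) in
      F1 (cpoint x, l) = 0 \<longrightarrow> F2 (cpoint x, l) = 0 \<longrightarrow>
      d1 (\<lambda>z. F1 (z, l)) (cpoint x) * d2 (\<lambda>z. F2 (z, l)) (cpoint x)
        - d2 (\<lambda>z. F1 (z, l)) (cpoint x) * d1 (\<lambda>z. F2 (z, l)) (cpoint x) \<noteq> 0)"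
proof -
  define z0 where "z0 = cpoint x0"
  define S where "S = ball z0 r \<times> (UNIV :: (complex \<times> complex) set)"
  have FS: "hol4 F1 S" "hol4 F2 S" using F1 F2 by (simp_all add: S_def z0_def)
  have S: "open S" "(z0, (0, 0)) \<in> S" using r by (auto simp: S_def open_Times)
  obtain p1 p2 p3 p4 where p: "continuous_on S p1" "continuous_on S p2" "continuous_on S p3" "continuous_on S p4"
    "\<forall>w\<in>S. has_d4 F1 (p1 w) (p2 w) (p3 w) (p4 w) w"
    by (rule hol4E[OF FS(1)])
  obtain q1 q2 q3 q4 where q: "continuous_on S q1" "continuous_on S q2" "continuous_on S q3" "continuous_on S q4"
    "\<forall>w\<in>S. has_d4 F2 (q1 w) (q2 w) (q3 w) (q4 w) w"
    by (rule hol4E[OF FS(2)])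
  have det': "p3 (z0, (0, 0)) * q4 (z0, (0, 0)) - p4 (z0, (0, 0)) * q3 (z0, (0, 0)) \<noteq> 0"
    using det has_d12_imp[OF has_d4_slices(2)[OF p(5)[rule_format, OF S(2)]]] has_d12_imp[OF has_d4_slices(2)[OF
        q(5)[rule_format, OF S(2)]]]
    by (simp add: z0_def)
  obtain r1 \<Psi>1 \<Psi>2 where r1: "r1 > 0" and hol: "hol2 \<Psi>1 (ball z0 r1)" "hol2 \<Psi>2 (ball z0 r1)"
    and \<Psi>0: "(\<Psi>1 z0, \<Psi>2 z0) = (0, 0)"
    and \<Psi>F': "\<forall>z\<in>ball z0 r1. (z, (\<Psi>1 z, \<Psi>2 z)) \<in> S \<and> F1 (z, (\<Psi>1 z, \<Psi>2 z)) = 0 \<and> F2 (z, (\<Psi>1 z, \<Psi>2 z)) = 0"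
    and uniq': "\<forall>z\<in>ball z0 r1. \<forall>l\<in>ball (0, 0) r1. F1 (z, l) = 0 \<longrightarrow> F2 (z, l) = 0 \<longrightarrow> l = (\<Psi>1 z, \<Psi>2 z)"
    and jac': "\<forall>z\<in>ball z0 r1. p1 (z, (\<Psi>1 z, \<Psi>2 z)) * q2 (z, (\<Psi>1 z, \<Psi>2 z)) = p2 (z, (\<Psi>1 z, \<Psi>2 z)) *
        q1 (z, (\<Psi>1 z, \<Psi>2 z)) \<longrightarrow>
       d1 \<Psi>1 z * d2 \<Psi>2 z - d2 \<Psi>1 z * d1 \<Psi>2 z = 0"
    using holomorphic_implicit_function[OF S p(5) q(5) p(1-4) q(1-4) zero[folded z0_def] det']
    by (elim exE conjE) (rule that)
  note \<Psi>F = bspec[OF \<Psi>F'] and uniq = uniq'[rule_format] and jac = jac'[rule_format]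
  have "continuous_on (ball z0 r1) (\<lambda>z. (\<Psi>1 z, \<Psi>2 z))"
    by (intro continuous_on_Pair hol2_continuous_on hol)
  then have "isCont (\<lambda>z. (\<Psi>1 z, \<Psi>2 z)) z0"
    using r1 by (simp add: continuous_on_eq_continuous_at)
  then have "\<forall>\<^sub>F z in nhds z0. (\<Psi>1 z, \<Psi>2 z) \<in> ball (0, 0) r1"
    using r1 \<Psi>0 unfolding isCont_def tendsto_at_iff_tendsto_nhds[of "\<lambda>z. (\<Psi>1 z, \<Psi>2 z)" z0]
    by (intro topological_tendstoD[of _ "(0, 0)"]) auto
  then obtain r2' where r2': "r2' > 0" "\<forall>z. dist z z0 < r2' \<longrightarrow> (\<Psi>1 z, \<Psi>2 z) \<in> ball (0, 0) r1"
    unfolding eventually_nhds_metric by blast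
  define r2 where "r2 = min (min r1 r2') r"
  have r2: "r2 > 0" "r2 \<le> r1" "r2 \<le> r2'" "r2 \<le> r" using r1 r2' r by (auto simp: r2_def)
  have \<Psi>real: "cnj (\<Psi>1 (cpoint x)) = \<Psi>1 (cpoint x)" "cnj (\<Psi>2 (cpoint x)) = \<Psi>2 (cpoint x)" if x: "x \<in> ball x0 r2" for x
  proof -
    define z where "z = cpoint x"
    have z: "z \<in> ball z0 r1" "dist z z0 < r2'" using x r2 by (auto simp: z_def z0_def dist_cpoint dist_commute)
    have "(cnj (\<Psi>1 z), cnj (\<Psi>2 z)) = (\<Psi>1 z, \<Psi>2 z)"
    proof (rule uniq[OF z(1)])
      show "(cnj (\<Psi>1 z), cnj (\<Psi>2 z)) \<in> ball (0, 0) r1"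
        using r2'(2)[THEN spec, THEN mp, OF z(2)] by (simp add: dist_norm norm_prod_def)
      show "F1 (z, cnj (\<Psi>1 z), cnj (\<Psi>2 z)) = 0" "F2 (z, cnj (\<Psi>1 z), cnj (\<Psi>2 z)) = 0"
        using \<Psi>F[OF z(1)] real x r2 by (simp_all add: z_def)
    qed
    then show "cnj (\<Psi>1 (cpoint x)) = \<Psi>1 (cpoint x)" "cnj (\<Psi>2 (cpoint x)) = \<Psi>2 (cpoint x)" by (simp_all add: z_def)
  qed
  define a b where "a x = Re (\<Psi>1 (cpoint x))" and "b x = Re (\<Psi>2 (cpoint x))" for x
  have ab: "\<Psi>1 (cpoint x) = of_real (a x)" "\<Psi>2 (cpoint x) = of_real (b x)" if "x \<in> ball x0 r2" for x
    using \<Psi>real[OF that] by (simp_all add: a_def b_def complex_eq_iff)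
  have "\<exists>w1 w2 :: real. \<forall>\<^sub>F x in nhds x0. \<forall>s. s \<noteq> 0 \<longrightarrow> a x = s * w1 \<longrightarrow> b x = s * w2 \<longrightarrow>
           d1 \<Psi>1 (cpoint x) * d2 \<Psi>2 (cpoint x) - d2 \<Psi>1 (cpoint x) * d1 \<Psi>2 (cpoint x) \<noteq> 0"
  proof (rule real_direction[OF r2(1)])
    show "hol2 \<Psi>1 (ball (cpoint x0) r2)" "hol2 \<Psi>2 (ball (cpoint x0) r2)"
      using r2 by (auto intro!: hol2_subset[OF hol(1)] hol2_subset[OF hol(2)] simp: z0_def)
    show "\<Psi>1 (cpoint x0) = 0" using \<Psi>0 by (simp add: z0_def)
  qed (fact ab)+
  then obtain w1 w2 :: real and e where e: "e > 0"
    and w: "\<forall>x. dist x x0 < e \<longrightarrow> (\<forall>s. s \<noteq> 0 \<longrightarrow> a x = s * w1 \<longrightarrow> b x = s * w2 \<longrightarrow>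
           d1 \<Psi>1 (cpoint x) * d2 \<Psi>2 (cpoint x) - d2 \<Psi>1 (cpoint x) * d1 \<Psi>2 (cpoint x) \<noteq> 0)"
    unfolding eventually_nhds_metric by blast
  define K where "K = 1 + \<bar>w1\<bar> + \<bar>w2\<bar>"
  have K: "K > 0" "\<bar>w1\<bar> + \<bar>w2\<bar> < K" by (auto simp: K_def)
  \<comment> \<open>For \<open>\<bar>s\<bar> < r1 / K\<close> the parameter
    \<open>s * (w1, w2)\<close> stays in the ball where solutions are unique.\<close>
  define \<eta> where "\<eta> = min (min e r2) (r1 / K)"
  have \<eta>: "\<eta> > 0" "\<eta> \<le> e" "\<eta> \<le> r2" "\<eta> \<le> r1 / K" using e r2 r1 K by (auto simp: \<eta>_def)
  have main: "d1 (\<lambda>z. F1 (z, l)) (cpoint x) * d2 (\<lambda>z. F2 (z, l)) (cpoint x)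
        - d2 (\<lambda>z. F1 (z, l)) (cpoint x) * d1 (\<lambda>z. F2 (z, l)) (cpoint x) \<noteq> 0"
    if x: "x \<in> ball x0 \<eta>" and s: "0 < \<bar>s\<bar>" "\<bar>s\<bar> < \<eta>" and l: "l = (of_real (s * w1), of_real (s * w2))"
      and F0: "F1 (cpoint x, l) = 0" "F2 (cpoint x, l) = 0" for x s l
  proof -
    define z where "z = cpoint x"
    have z: "z \<in> ball z0 r1" using x \<eta> r2 by (auto simp: z_def z0_def dist_cpoint)
    have "norm l \<le> \<bar>s * w1\<bar> + \<bar>s * w2\<bar>"
      unfolding l using norm_Pair_le[of "complex_of_real (s * w1)" "complex_of_real (s * w2)"]
      unfolding norm_of_real .
    also have "\<dots> = \<bar>s\<bar> * (\<bar>w1\<bar> + \<bar>w2\<bar>)" by (simp add: abs_mult algebra_simps)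
    also have "\<dots> < (r1 / K) * K"
      using s \<eta> K by (intro mult_strict_mono') auto
    finally have "l \<in> ball (0, 0) r1" using K by (simp add: zero_prod_def[symmetric])
    then have leq: "l = (\<Psi>1 z, \<Psi>2 z)" using uniq[OF z] F0 by (simp add: z_def)
    have x2: "x \<in> ball x0 r2" using x \<eta> by simp
    have "complex_of_real (a x) = of_real (s * w1)" "complex_of_real (b x) = of_real (s * w2)"
      using leq ab[OF x2] l by (simp_all add: z_def)
    then have abx: "a x = s * w1" "b x = s * w2" by (simp_all only: of_real_eq_iff)
    have J: "d1 \<Psi>1 z * d2 \<Psi>2 z - d2 \<Psi>1 z * d1 \<Psi>2 z \<noteq> 0"
      unfolding z_def using w[THEN spec, THEN mp, of x] x \<eta> s abx by (auto simp: dist_commute)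
    have zl: "(z, l) \<in> S" using \<Psi>F[OF z] leq by simp
    have "p1 (z, l) * q2 (z, l) \<noteq> p2 (z, l) * q1 (z, l)"
      using jac[OF z] J unfolding leq by blast
    then show ?thesis
      using has_d12_imp[OF has_d4_slices(1)[OF p(5)[rule_format, OF zl]]] has_d12_imp[OF has_d4_slices(1)[OF
          q(5)[rule_format, OF zl]]]
      by (simp add: z_def)
  qed
  show ?thesis
    unfolding Let_def
    by (rule exI[of _ w1], rule exI[of _ w2], rule exI[of _ \<eta>]) (use \<eta>(1) main in blast)
qed

section \<open>Jets and umbilic points\<close>

definition mform :: "(3 \<Rightarrow> 'a::comm_ring_1) \<Rightarrow> (3 \<Rightarrow> 'a) \<Rightarrow> 'a" where
  "mform u v = u 1 * v 1 + u 2 * v 2 - u 3 * v 3"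

text \<open>The determinant with rows \<open>u\<close>, \<open>v\<close>, \<open>w\<close>, expanded
  so that it makes sense over any commutative ring.\<close>

definition tdet :: "(3 \<Rightarrow> 'a::comm_ring_1) \<Rightarrow> (3 \<Rightarrow> 'a) \<Rightarrow> (3 \<Rightarrow> 'a) \<Rightarrow> 'a" where
  "tdet u v w = (u 2 * v 3 - u 3 * v 2) * w 1 + (u 3 * v 1 - u 1 * v 3) * w 2 + (u 1 * v 2 - u 2 * v 1) * w 3"

text \<open>A \<open>2\<close>-jet \<open>J\<close> lists the derivatives \<open>x\<^sub>u, x\<^sub>v, x\<^sub>u\<^sub>u, x\<^sub>u\<^sub>v, x\<^sub>v\<^sub>v\<close> as \<open>J 0, \<dots>, J 4\<close>. Real and
  complex jets share the following polynomials.\<close>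

definition umb_a :: "(nat \<Rightarrow> 3 \<Rightarrow> 'a::comm_ring_1) \<Rightarrow> 'a" where
  "umb_a J = mform (J 0) (J 1) * tdet (J 0) (J 1) (J 4) - mform (J 1) (J 1) * tdet (J 0) (J 1) (J 3)"

definition umb_b :: "(nat \<Rightarrow> 3 \<Rightarrow> 'a::comm_ring_1) \<Rightarrow> 'a" where
  "umb_b J = mform (J 0) (J 0) * tdet (J 0) (J 1) (J 4) - mform (J 1) (J 1) * tdet (J 0) (J 1) (J 2)"

definition umb_c :: "(nat \<Rightarrow> 3 \<Rightarrow> 'a::comm_ring_1) \<Rightarrow> 'a" where
  "umb_c J = mform (J 0) (J 0) * tdet (J 0) (J 1) (J 3) - mform (J 0) (J 1) * tdet (J 0) (J 1) (J 2)"

definition rjet :: "(real \<times> real \<Rightarrow> real^3) \<Rightarrow> real \<times> real \<Rightarrow> nat \<Rightarrow> 3 \<Rightarrow> real" where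
  "rjet x q k i = [partial_u x q $ i, partial_v x q $ i, partial_u (partial_u x) q $ i,
     partial_v (partial_u x) q $ i, partial_v (partial_v x) q $ i] ! k"

definition cjet :: "(3 \<Rightarrow> complex \<times> complex \<Rightarrow> complex) \<Rightarrow> complex \<times> complex \<Rightarrow> nat \<Rightarrow> 3 \<Rightarrow> complex" where
  "cjet X z k i = [d1 (X i) z, d2 (X i) z, d1 (d1 (X i)) z, d2 (d1 (X i)) z, d2 (d2 (X i)) z] ! k"

lemma coeff_E_rjet: "coeff_E x q = mform (rjet x q 0) (rjet x q 0)"
  and coeff_F_rjet: "coeff_F x q = mform (rjet x q 0) (rjet x q 1)"
  and coeff_G_rjet: "coeff_G x q = mform (rjet x q 1) (rjet x q 1)"
  by (simp_all add: coeff_E_def coeff_F_def coeff_G_def mink_def mform_def rjet_def)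

lemma mink_mcross_tdet: "mink (mcross u v) w = tdet (($) u) (($) v) (($) w)"
  by (simp add: mink_def mcross_def cross3_def tdet_def algebra_simps)

lemma coeff_lmn_rjet:
  "coeff_l x q = tdet (rjet x q 0) (rjet x q 1) (rjet x q 2)"
  "coeff_m x q = tdet (rjet x q 0) (rjet x q 1) (rjet x q 3)"
  "coeff_n x q = tdet (rjet x q 0) (rjet x q 1) (rjet x q 4)"
  by (simp_all add: coeff_l_def coeff_m_def coeff_n_def mink_mcross_tdet) (simp_all add: tdet_def rjet_def)

lemma coeff_abc_rjet:
  "coeff_a x q = umb_a (rjet x q)" "coeff_b x q = umb_b (rjet x q)" "coeff_c x q = umb_c (rjet x q)"
  by (simp_all add: coeff_a_def coeff_b_def coeff_c_def coeff_E_rjet coeff_F_rjet coeff_G_rjet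
      coeff_lmn_rjet umb_a_def umb_b_def umb_c_def)

lemma umb_relation:
  "mform (J 0) (J 0) * umb_a J - mform (J 0) (J 1) * umb_b J + mform (J 1) (J 1) * umb_c J = 0"
  by (simp add: umb_a_def umb_b_def umb_c_def algebra_simps)

section \<open>The jet of the quadratic perturbation\<close>

text \<open>The derivatives, in the order used for jets, of
  \<open>(A * U^2 + 2 * B * U * V + C * V^2) / 2\<close> at \<open>(U, V)\<close>.\<close>

definition hjet :: "'a::comm_ring_1 \<Rightarrow> 'a \<Rightarrow> 'a \<Rightarrow> 'a \<Rightarrow> 'a \<Rightarrow> nat \<Rightarrow> 'a" where
  "hjet A B C U V k = [A * U + B * V, B * U + C * V, A, B, C] ! k"

text \<open>The jet of a surface displaced by a scalar function with jet \<open>h\<close> in the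
  constant direction \<open>\<xi>\<close>.\<close>

definition pjet :: "(nat \<Rightarrow> 3 \<Rightarrow> 'a::comm_ring_1) \<Rightarrow> (nat \<Rightarrow> 'a) \<Rightarrow> (3 \<Rightarrow> 'a) \<Rightarrow> nat \<Rightarrow> 3 \<Rightarrow> 'a" where
  "pjet J h \<xi> k i = J k i + h k * \<xi> i"

text \<open>At the centre the quadratic form has no first derivatives: metric and cross product stay
  fixed, and only the second derivatives move, by \<open>A\<close>, \<open>B\<close>,
  \<open>C\<close> times \<open>\<xi>\<close>. The coefficients become affine in \<open>A\<close>,
  \<open>B\<close>, \<open>C\<close>, from which submersivity can be read off.\<close>

lemma umb_pjet_origin:
  fixes J :: "nat \<Rightarrow> 3 \<Rightarrow> 'a::comm_ring_1"
  shows "umb_a (pjet J (hjet A B C 0 0) \<xi>) = umb_a J + tdet (J 0) (J 1) \<xi> * (mform (J 0) (J 1) * C -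
      mform (J 1) (J 1) * B)"
    and "umb_b (pjet J (hjet A B C 0 0) \<xi>) = umb_b J + tdet (J 0) (J 1) \<xi> * (mform (J 0) (J 0) * C -
        mform (J 1) (J 1) * A)"
    and "umb_c (pjet J (hjet A B C 0 0) \<xi>) = umb_c J + tdet (J 0) (J 1) \<xi> * (mform (J 0) (J 0) * B -
        mform (J 0) (J 1) * A)"
proof -
  have 01: "pjet J (hjet A B C 0 0) \<xi> 0 = J 0" "pjet J (hjet A B C 0 0) \<xi> (Suc 0) = J 1"
    by (simp_all add: fun_eq_iff pjet_def hjet_def)
  have t: "tdet u v (pjet J (hjet A B C 0 0) \<xi> 2) = tdet u v (J 2) + A * tdet u v \<xi>"
    "tdet u v (pjet J (hjet A B C 0 0) \<xi> 3) = tdet u v (J 3) + B * tdet u v \<xi>"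
    "tdet u v (pjet J (hjet A B C 0 0) \<xi> 4) = tdet u v (J 4) + C * tdet u v \<xi>" for u v
    by (simp_all add: tdet_def pjet_def hjet_def algebra_simps)
  show "umb_a (pjet J (hjet A B C 0 0) \<xi>) = umb_a J + tdet (J 0) (J 1) \<xi> * (mform (J 0) (J 1) * C -
      mform (J 1) (J 1) * B)"
    "umb_b (pjet J (hjet A B C 0 0) \<xi>) = umb_b J + tdet (J 0) (J 1) \<xi> * (mform (J 0) (J 0) * C -
        mform (J 1) (J 1) * A)"
    "umb_c (pjet J (hjet A B C 0 0) \<xi>) = umb_c J + tdet (J 0) (J 1) \<xi> * (mform (J 0) (J 0) * B -
        mform (J 0) (J 1) * A)"
    by (simp_all add: umb_a_def umb_b_def umb_c_def 01 t algebra_simps)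
qed

lemma umb_cong:
  assumes "\<And>k i. k < 5 \<Longrightarrow> J k i = J' k i"
  shows "umb_a J = umb_a J'" "umb_b J = umb_b J'" "umb_c J = umb_c J'"
proof -
  have "J 0 = J' 0" "J 1 = J' 1" "J 2 = J' 2" "J 3 = J' 3" "J 4 = J' 4"
    using assms by (simp_all add: fun_eq_iff)
  then show "umb_a J = umb_a J'" "umb_b J = umb_b J'" "umb_c J = umb_c J'"
    by (simp_all add: umb_a_def umb_b_def umb_c_def)
qed

lemma umb_of_real:
  "umb_a (\<lambda>k i. complex_of_real (J k i)) = of_real (umb_a J)"
  "umb_b (\<lambda>k i. complex_of_real (J k i)) = of_real (umb_b J)"
  "umb_c (\<lambda>k i. complex_of_real (J k i)) = of_real (umb_c J)"
  by (simp_all add: umb_a_def umb_b_def umb_c_def mform_def tdet_def)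

lemma umb_cnj:
  "umb_a (\<lambda>k i. cnj (J k i)) = cnj (umb_a J)"
  "umb_b (\<lambda>k i. cnj (J k i)) = cnj (umb_b J)"
  "umb_c (\<lambda>k i. cnj (J k i)) = cnj (umb_c J)"
  by (simp_all add: umb_a_def umb_b_def umb_c_def mform_def tdet_def)

lemma hol4_umb:
  assumes "\<And>k i. k < 5 \<Longrightarrow> hol4 (\<lambda>w. J w k i) S"
  shows "hol4 (\<lambda>w. umb_a (J w)) S" "hol4 (\<lambda>w. umb_b (J w)) S" "hol4 (\<lambda>w. umb_c (J w)) S"
  unfolding umb_a_def umb_b_def umb_c_def mform_def tdet_def
  by (intro hol4_intros assms; simp)+

lemma hol2_umb:
  assumes "\<And>k i. k < 5 \<Longrightarrow> hol2 (\<lambda>w. J w k i) S"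
  shows "hol2 (\<lambda>w. umb_a (J w)) S" "hol2 (\<lambda>w. umb_b (J w)) S" "hol2 (\<lambda>w. umb_c (J w)) S"
  unfolding umb_a_def umb_b_def umb_c_def mform_def tdet_def
  by (intro hol2_intros assms; simp)+

lemma nat_less_5: "k < 5 \<longleftrightarrow> k = 0 \<or> k = 1 \<or> k = 2 \<or> k = 3 \<or> k = (4::nat)"
  by auto

lemma hol2_cjet:
  assumes "open S" "\<And>i. hol2 (X i) S" "k < 5"
  shows "hol2 (\<lambda>z. cjet X z k i) S"
  using assms(3) hol2_d12[OF assms(1,2)] hol2_d12[OF assms(1)]
  unfolding nat_less_5 cjet_def by auto

lemma d12_cong:
  assumes "open S" "z \<in> S" "hol2 g S" "\<And>w. w \<in> S \<Longrightarrow> f w = g w"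
  shows "d1 f z = d1 g z" "d2 f z = d2 g z"
proof -
  have "has_d12 f (d1 g z) (d2 g z) z"
    by (rule has_derivative_transform_within_open[OF hol2D[OF assms(3,2)] assms(1,2)]) (simp add: assms(4))
  then show "d1 f z = d1 g z" "d2 f z = d2 g z" by (rule has_d12_imp)+
qed

definition quad :: "complex \<times> complex \<Rightarrow> complex \<Rightarrow> complex \<Rightarrow> complex \<Rightarrow> complex \<times> complex \<Rightarrow> complex" where
  "quad p A B C z = A * (fst z - fst p)^2 * (1/2) + B * (fst z - fst p) * (snd z - snd p)
      + C * (snd z - snd p)^2 * (1/2)"

lemma has_d12_quad:
  "has_d12 (quad p A B C) (A * (fst z - fst p) + B * (snd z - snd p)) (B * (fst z - fst p) + C * (snd z - snd p)) z"
  unfolding quad_def[abs_def]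
  by (rule has_derivative_eq_rhs, (rule derivative_intros)+) (auto simp: fun_eq_iff algebra_simps)

lemma cjet_quad:
  assumes S: "open S" "z \<in> S" and X: "\<And>i. hol2 (X i) S" and k: "k < 5"
  shows "cjet (\<lambda>i z. X i z + quad p A B C z * \<xi> i) z k i
       = pjet (cjet X z) (hjet A B C (fst z - fst p) (snd z - snd p)) \<xi> k i"
proof -
  define Y where "Y z = X i z + quad p A B C z * \<xi> i" for z
  have hd: "hol2 (d1 (X i)) S" "hol2 (d2 (X i)) S" using hol2_d12[OF S(1) X] by auto
  have Y: "has_d12 Y (d1 (X i) w + (A * (fst w - fst p) + B * (snd w - snd p)) * \<xi> i)
      (d2 (X i) w + (B * (fst w - fst p) + C * (snd w - snd p)) * \<xi> i) w" if "w \<in> S" for w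
    unfolding Y_def[abs_def]
    using has_d12_add[OF hol2D[OF X that] has_d12_mult[OF has_d12_quad has_d12_const]] by simp
  have L: "has_d12 (\<lambda>w. (a * (fst w - fst p) + b * (snd w - snd p)) * e) (a * e) (b * e) w"
    for a b e :: complex and w :: "complex \<times> complex"
    by (rule has_derivative_eq_rhs, (rule derivative_intros)+) (auto simp: fun_eq_iff algebra_simps)
  note eqs = has_d12_imp[OF Y]
  have D1: "has_d12 (\<lambda>w. d1 (X i) w + (A * (fst w - fst p) + B * (snd w - snd p)) * \<xi> i)
      (d1 (d1 (X i)) z + A * \<xi> i) (d2 (d1 (X i)) z + B * \<xi> i) z"
    by (rule has_d12_add[OF hol2D[OF hd(1) S(2)] L])
  have D2: "has_d12 (\<lambda>w. d2 (X i) w + (B * (fst w - fst p) + C * (snd w - snd p)) * \<xi> i)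
      (d1 (d2 (X i)) z + B * \<xi> i) (d2 (d2 (X i)) z + C * \<xi> i) z"
    by (rule has_d12_add[OF hol2D[OF hd(2) S(2)] L])
  have "has_d12 (d1 Y) (d1 (d1 (X i)) z + A * \<xi> i) (d2 (d1 (X i)) z + B * \<xi> i) z"
    by (rule has_derivative_transform_within_open[OF D1 S]) (simp add: eqs(1))
  moreover have "has_d12 (d2 Y) (d1 (d2 (X i)) z + B * \<xi> i) (d2 (d2 (X i)) z + C * \<xi> i) z"
    by (rule has_derivative_transform_within_open[OF D2 S]) (simp add: eqs(2))
  ultimately have "d1 (d1 Y) z = d1 (d1 (X i)) z + A * \<xi> i" "d2 (d1 Y) z = d2 (d1 (X i)) z + B * \<xi> i"
      "d2 (d2 Y) z = d2 (d2 (X i)) z + C * \<xi> i"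
    using has_d12_imp by blast+
  with eqs[OF S(2)] show ?thesis
    using k unfolding nat_less_5 cjet_def pjet_def hjet_def Y_def[abs_def] by auto
qed

section \<open>Holomorphic extensions of parametrisations\<close>

text \<open>One radius serves all three components, and \<open>cpoint\<close> is an isometry, so the
  real ball maps into the complex one. The notion is stable under partial derivatives, sums and
  scaling, which makes it the setting in which jets are compared.\<close>

definition cext :: "(3 \<Rightarrow> complex \<times> complex \<Rightarrow> complex) \<Rightarrow> (real \<times> real \<Rightarrow> real^3) \<Rightarrow> real \<times> real \<Rightarrow> real \<Rightarrow> bool" where
  "cext X x q0 r \<longleftrightarrow> (\<forall>i. hol2 (X i) (ball (cpoint q0) r)) \<and> (\<forall>i. \<forall>q\<in>ball q0 r. X i (cpoint q) = of_real (x q $ i))"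

lemma has_derivative_vecI:
  fixes f :: "'a::real_normed_vector \<Rightarrow> real^'n"
  assumes "\<And>i. ((\<lambda>x. f x $ i) has_derivative (\<lambda>h. f' h $ i)) (at a within S)"
  shows "(f has_derivative f') (at a within S)"
  unfolding has_derivative_componentwise_within[of f]
  using assms by (auto simp: Basis_vec_def inner_axis)

text \<open>The complex partial derivatives of the extension are real at real points and hence are
  those of \<open>x\<close>.\<close>

lemma cext_has_derivative:
  assumes X: "cext X x q0 r" and q: "q \<in> ball q0 r"
  shows "(x has_derivative (\<lambda>h. fst h *\<^sub>R partial_u x q + snd h *\<^sub>R partial_v x q)) (at q)"
    and "of_real (partial_u x q $ i) = d1 (X i) (cpoint q)"
    and "of_real (partial_v x q $ i) = d2 (X i) (cpoint q)"
proof -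
  define u v where "u = (\<chi> i. Re (d1 (X i) (cpoint q)))" and "v = (\<chi> i. Re (d2 (X i) (cpoint q)))"
  have comp: "has_d12 (\<lambda>q. x q $ i) (u $ i) (v $ i) q \<and> d1 (X i) (cpoint q) = of_real (u $ i)
      \<and> d2 (X i) (cpoint q) = of_real (v $ i)" for i
  proof -
    have "has_d12 (X i) (d1 (X i) (cpoint q)) (d2 (X i) (cpoint q)) (cpoint q)"
      using X q by (intro hol2D) (auto simp: cext_def dist_cpoint)
    from has_derivative_of_real_cpoint[OF this open_ball q, of "\<lambda>q. x q $ i"] X
    show ?thesis by (simp add: cext_def u_def v_def)
  qed
  have der: "(x has_derivative (\<lambda>h. fst h *\<^sub>R u + snd h *\<^sub>R v)) (at q)"
    by (rule has_derivative_vecI) (use comp in \<open>simp add: mult.commute\<close>)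
  have der': "(x has_derivative (\<lambda>h. fst h *\<^sub>R u + snd h *\<^sub>R v)) (at (fst q, snd q))"
    using der by simp
  have s1: "((\<lambda>s. (s, snd q)) has_derivative (\<lambda>h. (h, 0))) (at (fst q))"
    and s2: "((\<lambda>s. (fst q, s)) has_derivative (\<lambda>h. (0, h))) (at (snd q))"
    by (auto intro!: derivative_eq_intros)
  from has_derivative_compose[OF s1 der'] has_derivative_compose[OF s2 der']
  have "((\<lambda>s. x (s, snd q)) has_derivative (\<lambda>h. h *\<^sub>R u)) (at (fst q))"
      "((\<lambda>s. x (fst q, s)) has_derivative (\<lambda>h. h *\<^sub>R v)) (at (snd q))"
    by simp_all
  then have uv: "partial_u x q = u" "partial_v x q = v"
    unfolding partial_u_def partial_v_def by (auto intro!: vector_derivative_at simp: has_vector_derivative_def)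
  show "(x has_derivative (\<lambda>h. fst h *\<^sub>R partial_u x q + snd h *\<^sub>R partial_v x q)) (at q)" unfolding uv by (rule der)
  show "of_real (partial_u x q $ i) = d1 (X i) (cpoint q)" "of_real (partial_v x q $ i) = d2 (X i) (cpoint q)"
    unfolding uv using comp by auto
qed

lemma cext_partial:
  assumes "cext X x q0 r"
  shows "cext (\<lambda>i. d1 (X i)) (partial_u x) q0 r" "cext (\<lambda>i. d2 (X i)) (partial_v x) q0 r"
  using assms cext_has_derivative(2,3)[OF assms] hol2_d12[OF open_ball] unfolding cext_def by auto

lemma cjet_cpoint:
  assumes X: "cext X x q0 r" and q: "q \<in> ball q0 r" and k: "k < 5"
  shows "cjet X (cpoint q) k i = of_real (rjet x q k i)"
  using k cext_has_derivative(2,3)[OF X q] cext_has_derivative(2,3)[OF cext_partial(1)[OF X] q]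
    cext_has_derivative(2,3)[OF cext_partial(2)[OF X] q]
  unfolding nat_less_5 cjet_def rjet_def by auto

lemma umb_cpoint:
  assumes "cext X x q0 r" "q \<in> ball q0 r"
  shows "umb_a (cjet X (cpoint q)) = of_real (coeff_a x q)"
    "umb_b (cjet X (cpoint q)) = of_real (coeff_b x q)"
    "umb_c (cjet X (cpoint q)) = of_real (coeff_c x q)"
  unfolding coeff_abc_rjet umb_of_real[symmetric]
  by (rule umb_cong, rule cjet_cpoint[OF assms], assumption)+

lemma mform_cpoint:
  assumes "cext X x q0 r" "q \<in> ball q0 r"
  shows "mform (cjet X (cpoint q) 0) (cjet X (cpoint q) 0) = of_real (coeff_E x q)"
    "mform (cjet X (cpoint q) 0) (cjet X (cpoint q) 1) = of_real (coeff_F x q)"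
    "mform (cjet X (cpoint q) 1) (cjet X (cpoint q) 1) = of_real (coeff_G x q)"
  using cjet_cpoint[OF assms]
  by (simp_all add: coeff_E_rjet coeff_F_rjet coeff_G_rjet mform_def)

abbreviation wedge :: "(complex \<times> complex \<Rightarrow> complex) \<Rightarrow> (complex \<times> complex \<Rightarrow> complex) \<Rightarrow> complex \<times>
    complex \<Rightarrow> complex" where
  "wedge f g z \<equiv> d1 f z * d2 g z - d2 f z * d1 g z"

text \<open>At an umbilic point the relation \<open>E a - F b + G c = 0\<close> differentiates to a
  linear relation between the differentials of \<open>a\<close>, \<open>b\<close>, \<open>c\<close>.
  It makes the Jacobians of \<open>(b, c)\<close>, \<open>(a, c)\<close>, \<open>(a, b)\<close>
  proportional to E, F, G. If any of them is nonzero, so is the one of the pair that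
  \<open>umbilic_mult\<close> selects.\<close>

lemma umbilic_mult_eq_1:
  assumes X: "cext X x q0 r" and q: "q \<in> ball q0 r" and umb: "umbilic_at x q"
    and reg: "coeff_E x q \<noteq> 0 \<or> coeff_F x q \<noteq> 0 \<or> coeff_G x q \<noteq> 0"
    and w: "wedge (\<lambda>z. umb_a (cjet X z)) (\<lambda>z. umb_b (cjet X z)) (cpoint q) \<noteq> 0 \<or>
      wedge (\<lambda>z. umb_a (cjet X z)) (\<lambda>z. umb_c (cjet X z)) (cpoint q) \<noteq> 0 \<or>
      wedge (\<lambda>z. umb_b (cjet X z)) (\<lambda>z. umb_c (cjet X z)) (cpoint q) \<noteq> 0"
  shows "umbilic_mult x q = 1"
proof -
  define S where "S = ball (cpoint q0) r"
  define p where "p = cpoint q"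
  have S: "open S" "p \<in> S" using q by (auto simp: S_def p_def dist_cpoint)
  have XS: "hol2 (X i) S" for i using X by (simp add: cext_def S_def)
  define a b c where "a z = umb_a (cjet X z)" and "b z = umb_b (cjet X z)" and "c z = umb_c (cjet X z)" for z
  have abc: "hol2 a S" "hol2 b S" "hol2 c S"
    unfolding a_def[abs_def] b_def[abs_def] c_def[abs_def] by (rule hol2_umb, rule hol2_cjet[OF S(1) XS], assumption)+
  define E F G where "E z = mform (cjet X z 0) (cjet X z 0)" and "F z = mform (cjet X z 0) (cjet X z 1)"
    and "G z = mform (cjet X z 1) (cjet X z 1)" for z
  have EFG: "hol2 E S" "hol2 F S" "hol2 G S"
    unfolding E_def[abs_def] F_def[abs_def] G_def[abs_def] mform_def
    by (intro hol2_intros hol2_cjet[OF S(1) XS]; simp)+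
  have zero: "a p = 0" "b p = 0" "c p = 0"
    using umb umb_cpoint[OF X q] by (simp_all add: a_def b_def c_def p_def umbilic_at_def)
  have EFGp: "E p = of_real (coeff_E x q)" "F p = of_real (coeff_F x q)" "G p = of_real (coeff_G x q)"
    using mform_cpoint[OF X q] by (simp_all add: E_def F_def G_def p_def)
  have d: "has_d12 a (d1 a p) (d2 a p) p" "has_d12 b (d1 b p) (d2 b p) p" "has_d12 c (d1 c p) (d2 c p) p"
    "has_d12 E (d1 E p) (d2 E p) p" "has_d12 F (d1 F p) (d2 F p) p" "has_d12 G (d1 G p) (d2 G p) p"
    using hol2D[OF _ S(2)] abc EFG by auto
  have "has_d12 (\<lambda>z. E z * a z - F z * b z + G z * c z)
      (E p * d1 a p - F p * d1 b p + G p * d1 c p) (E p * d2 a p - F p * d2 b p + G p * d2 c p) p"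
    using has_d12_add[OF has_d12_diff[OF has_d12_mult[OF d(4,1)] has_d12_mult[OF d(5,2)]] has_d12_mult[OF d(6,3)]]
    by (simp add: zero)
  moreover have "(\<lambda>z. E z * a z - F z * b z + G z * c z) = (\<lambda>_. 0)"
    using umb_relation unfolding E_def F_def G_def a_def b_def c_def by blast
  ultimately have "has_d12 (\<lambda>_. 0) (E p * d1 a p - F p * d1 b p + G p * d1 c p) (E p * d2 a p - F p * d2 b p
      + G p * d2 c p) p"
    by simp
  from has_d12_imp[OF this] has_d12_imp[OF has_d12_const[of 0 p]]
  have rel: "E p * d1 a p - F p * d1 b p + G p * d1 c p = 0" "E p * d2 a p - F p * d2 b p + G p * d2 c p = 0"
    by simp_all
  have w1: "E p * wedge a c p = F p * wedge b c p"
  proof -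
    have "E p * wedge a c p - F p * wedge b c p =
      (E p * d1 a p - F p * d1 b p + G p * d1 c p) * d2 c p - (E p * d2 a p - F p * d2 b p + G p * d2 c p) * d1 c p"
      by (simp add: algebra_simps)
    then show ?thesis using rel by simp
  qed
  have w2: "F p * wedge a b p = G p * wedge a c p"
  proof -
    have "G p * wedge a c p - F p * wedge a b p =
      (E p * d2 a p - F p * d2 b p + G p * d2 c p) * d1 a p - (E p * d1 a p - F p * d1 b p + G p * d1 c p) * d2 a p"
      by (simp add: algebra_simps)
    then show ?thesis using rel by simp
  qed
  have w3: "E p * wedge a b p = G p * wedge b c p"
  proof -
    have "E p * wedge a b p - G p * wedge b c p =
      (E p * d1 a p - F p * d1 b p + G p * d1 c p) * d2 b p - (E p * d2 a p - F p * d2 b p + G p * d2 c p) * d1 b p"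
      by (simp add: algebra_simps)
    then show ?thesis using rel by simp
  qed
  have w': "wedge a b p \<noteq> 0 \<or> wedge a c p \<noteq> 0 \<or> wedge b c p \<noteq> 0"
    using w unfolding a_def[abs_def] b_def[abs_def] c_def[abs_def] p_def .
  have an: "analytic2_at a p" "analytic2_at b p" "analytic2_at c p"
    using hol2_imp_analytic2_at[OF S(1) _ S(2)] abc by auto
  have near: "\<forall>\<^sub>F z in nhds q. z \<in> ball q0 r" by (rule eventually_nhds_in_open) (use q in auto)
  have "\<forall>\<^sub>F z in nhds q. a (cpoint z) = of_real (coeff_a x z)" "\<forall>\<^sub>F z in nhds q. b (cpoint z) = of_real (coeff_b x z)"
    "\<forall>\<^sub>F z in nhds q. c (cpoint z) = of_real (coeff_c x z)"
    using near by (eventually_elim, simp add: a_def b_def c_def umb_cpoint[OF X])+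
  then have germs: "complexification (coeff_a x) q = germ p a" "complexification (coeff_b x) q = germ p b"
    "complexification (coeff_c x) q = germ p c"
    using an unfolding p_def by (simp_all add: complexification_eq_germ)
  show ?thesis
  proof (cases "coeff_E x q \<noteq> 0")
    case True
    then have "E p \<noteq> 0" by (simp add: EFGp)
    then have "wedge b c p \<noteq> 0" using w' w1 w3 by auto
    then show ?thesis using True germs an zero unfolding umbilic_mult_def p_def[symmetric]
        by (simp add: germ_mult_eq_1)
  next
    case E0: False
    show ?thesis
    proof (cases "coeff_F x q \<noteq> 0")
      case True
      then have "E p = 0" "F p \<noteq> 0" using E0 by (simp_all add: EFGp)
      then have "wedge a c p \<noteq> 0" using w' w1 w2 by auto
      then show ?thesis using True E0 germs an zero unfolding umbilic_mult_def p_def[symmetric]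
          by (simp add: germ_mult_eq_1)
    next
      case False
      then have "E p = 0" "F p = 0" "G p \<noteq> 0" using E0 reg by (simp_all add: EFGp)
      then have "wedge a b p \<noteq> 0" using w' w2 w3 by auto
      then show ?thesis using False E0 germs an zero unfolding umbilic_mult_def p_def[symmetric]
          by (simp add: germ_mult_eq_1)
    qed
  qed
qed

section \<open>Perturbation of the parametrisation\<close>

text \<open>\<open>generic_direction\<close> for two umbilic equations of the perturbed jet. The
  hypotheses on \<open>A\<close>, \<open>B\<close>, \<open>C\<close> allow each coefficient of the
  quadratic form to be a coordinate of \<open>l\<close> or 0.\<close>

lemma umb_direction:
  fixes \<xi> :: "3 \<Rightarrow> complex" and f1 f2 :: "(nat \<Rightarrow> 3 \<Rightarrow> complex) \<Rightarrow> complex"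
  assumes X: "cext X x q0 r" and r: "r > 0" and \<xi>: "\<And>i. cnj (\<xi> i) = \<xi> i"
    and f: "f1 \<in> {umb_a, umb_b, umb_c}" "f2 \<in> {umb_a, umb_b, umb_c}"
    and ABC: "A \<in> {\<lambda>_. 0, fst, snd}" "B \<in> {\<lambda>_. 0, fst, snd}" "C \<in> {\<lambda>_. 0, fst, snd}"
    and zero: "f1 (cjet X (cpoint q0)) = 0" "f2 (cjet X (cpoint q0)) = 0"
    and det: "wedge (\<lambda>l. f1 (pjet (cjet X (cpoint q0)) (hjet (A l) (B l) (C l) 0 0) \<xi>))
                (\<lambda>l. f2 (pjet (cjet X (cpoint q0)) (hjet (A l) (B l) (C l) 0 0) \<xi>)) (0, 0) \<noteq> 0"
  shows "\<exists>w1 w2 :: real. \<exists>\<eta>>0. \<forall>q\<in>ball q0 \<eta>. \<forall>s::real. 0 < \<bar>s\<bar> \<longrightarrow> \<bar>s\<bar> < \<eta> \<longrightarrow>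
     (let l = (of_real (s * w1), of_real (s * w2));
          Y = \<lambda>i z. X i z + quad (cpoint q0) (A l) (B l) (C l) z * \<xi> i in
      f1 (cjet Y (cpoint q)) = 0 \<longrightarrow> f2 (cjet Y (cpoint q)) = 0 \<longrightarrow>
      wedge (\<lambda>z. f1 (cjet Y z)) (\<lambda>z. f2 (cjet Y z)) (cpoint q) \<noteq> 0)"
proof -
  define z0 where "z0 = cpoint q0"
  define S where "S = ball z0 r"
  have S: "open S" "z0 \<in> S" using r by (auto simp: S_def)
  have XS: "hol2 (X i) S" for i using X by (simp add: cext_def S_def z0_def)
  \<comment> \<open>The perturbed jet as a function of the point and of \<open>l\<close>. It is
    affine in \<open>l\<close>, so it makes sense for complex \<open>l\<close>, and over real points
    it commutes with conjugation.\<close>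
  define P where "P w = pjet (cjet X (fst w)) (hjet (A (snd w)) (B (snd w)) (C (snd w)) (fst (fst w) -
      fst z0) (snd (fst w) - snd z0)) \<xi>" for w
  have hABC: "hol4 (\<lambda>w. A (snd w)) T" "hol4 (\<lambda>w. B (snd w)) T" "hol4 (\<lambda>w. C (snd w)) T" for T
    using ABC by (auto intro: hol4_const hol4_param)
  have hJ: "hol4 (\<lambda>w. cjet X (fst w) k i) (S \<times> UNIV)" if "k < 5" for k i
    by (rule hol4_hol2[OF S(1) hol2_cjet[OF S(1) XS that]]) auto
  have hZ: "hol4 (\<lambda>w. fst (fst w)) T" "hol4 (\<lambda>w. snd (fst w)) T" for T
    by (rule hol4_hol2[OF open_UNIV]; simp add: hol2_fst hol2_snd)+
  have hh: "hol4 (\<lambda>w. hjet (A (snd w)) (B (snd w)) (C (snd w)) (fst (fst w) - fst z0) (snd (fst w) - snd z0) k)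
      T" if "k < 5" for k T
    using that unfolding nat_less_5 hjet_def
    by (auto intro!: hol4_intros hABC hZ)
  have hP: "hol4 (\<lambda>w. P w k i) (S \<times> UNIV)" if "k < 5" for k i
    unfolding P_def pjet_def by (intro hol4_add hol4_mult hol4_const hJ hh that)
  have hf: "hol4 (\<lambda>w. f (P w)) (S \<times> UNIV)" if "f \<in> {umb_a, umb_b, umb_c}" for f
    using that hol4_umb[of P, OF hP] by auto
  have fcong: "f J = f J'" if "f \<in> {umb_a, umb_b, umb_c}" "\<And>k i. k < 5 \<Longrightarrow> J k i = J' k i"
    for f :: "(nat \<Rightarrow> 3 \<Rightarrow> complex) \<Rightarrow> complex" and J J'
    using that(1) umb_cong[OF that(2)] by auto
  have fcnj: "f (\<lambda>k i. cnj (J k i)) = cnj (f J)" if "f \<in> {umb_a, umb_b, umb_c}" for f J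
    using that umb_cnj by auto
  have Pcnj: "P (cpoint q, (cnj l1, cnj l2)) k i = cnj (P (cpoint q, (l1, l2)) k i)"
    if q: "q \<in> ball q0 r" and k: "k < 5" for q l1 l2 k i
  proof -
    have c: "cnj (A (l1, l2)) = A (cnj l1, cnj l2)" "cnj (B (l1, l2)) = B (cnj l1, cnj l2)" "cnj (C (l1, l2))
        = C (cnj l1, cnj l2)"
      using ABC by auto
    have "cnj (hjet (A (l1, l2)) (B (l1, l2)) (C (l1, l2)) (fst (cpoint q) - fst z0) (snd (cpoint q) - snd z0) k)
      = hjet (A (cnj l1, cnj l2)) (B (cnj l1, cnj l2)) (C (cnj l1, cnj l2)) (fst (cpoint q) -
          fst z0) (snd (cpoint q) - snd z0) k"
      using k unfolding nat_less_5 hjet_def by (auto simp: c cpoint_def z0_def)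
    then show ?thesis
      by (simp add: P_def pjet_def cjet_cpoint[OF X q k] \<xi>)
  qed
  have freal: "f (P (cpoint q, (cnj l1, cnj l2))) = cnj (f (P (cpoint q, (l1, l2))))"
    if "f \<in> {umb_a, umb_b, umb_c}" "q \<in> ball q0 r" for f q l1 l2
    unfolding fcnj[OF that(1), symmetric] by (rule fcong[OF that(1)], rule Pcnj[OF that(2)])
  have P0: "P (z0, l) = pjet (cjet X z0) (hjet (A l) (B l) (C l) 0 0) \<xi>" for l by (simp add: P_def)
  have f0: "f (P (z0, (0, 0))) = f (cjet X z0)" if "f \<in> {umb_a, umb_b, umb_c}" for f
  proof (rule fcong[OF that])
    fix k i assume k: "k < (5::nat)"
    have "A (0, 0) = 0" "B (0, 0) = 0" "C (0, 0) = 0" using ABC by auto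
    moreover have "hjet (0::complex) 0 0 0 0 k = 0"
      using k unfolding nat_less_5 hjet_def by auto
    ultimately show "P (z0, (0, 0)) k i = cjet X z0 k i" by (simp add: P0 pjet_def)
  qed
  have "\<exists>w1 w2 :: real. \<exists>\<eta>>0. \<forall>q\<in>ball q0 \<eta>. \<forall>s::real. 0 < \<bar>s\<bar> \<longrightarrow> \<bar>s\<bar> < \<eta> \<longrightarrow>
     (let l = (of_real (s * w1), of_real (s * w2)) in
      f1 (P (cpoint q, l)) = 0 \<longrightarrow> f2 (P (cpoint q, l)) = 0 \<longrightarrow>
      wedge (\<lambda>z. f1 (P (z, l))) (\<lambda>z. f2 (P (z, l))) (cpoint q) \<noteq> 0)"
  proof (rule generic_direction[OF r])
    show "hol4 (\<lambda>w. f1 (P w)) (ball (cpoint q0) r \<times> UNIV)" "hol4 (\<lambda>w. f2 (P w)) (ball (cpoint q0) r \<times> UNIV)"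
      using hf[OF f(1)] hf[OF f(2)] by (simp_all add: S_def z0_def)
    show "f1 (P (cpoint q0, (0, 0))) = 0" "f2 (P (cpoint q0, (0, 0))) = 0"
      using f0[OF f(1)] f0[OF f(2)] zero by (simp_all add: z0_def)
    show "wedge (\<lambda>l. f1 (P (cpoint q0, l))) (\<lambda>l. f2 (P (cpoint q0, l))) (0, 0) \<noteq> 0"
      using det P0 by (simp add: z0_def)
    show "f1 (P (cpoint q, (cnj l1, cnj l2))) = cnj (f1 (P (cpoint q, (l1, l2))))"
      "f2 (P (cpoint q, (cnj l1, cnj l2))) = cnj (f2 (P (cpoint q, (l1, l2))))" if "q \<in> ball q0 r" for q l1 l2
      by (rule freal[OF _ that], rule f)+
  qed
  then obtain w1 w2 \<eta> :: real where \<eta>: "\<eta> > 0" and w: "\<forall>q\<in>ball q0 \<eta>. \<forall>s::real. 0 < \<bar>s\<bar> \<longrightarrow> \<bar>s\<bar> < \<eta> \<longrightarrow>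
     (let l = (of_real (s * w1), of_real (s * w2)) in
      f1 (P (cpoint q, l)) = 0 \<longrightarrow> f2 (P (cpoint q, l)) = 0 \<longrightarrow>
      wedge (\<lambda>z. f1 (P (z, l))) (\<lambda>z. f2 (P (z, l))) (cpoint q) \<noteq> 0)" by blast
  define \<eta>' where "\<eta>' = min \<eta> r"
  have \<eta>': "\<eta>' > 0" "\<eta>' \<le> \<eta>" "\<eta>' \<le> r" using \<eta> r by (auto simp: \<eta>'_def)
  have main: "wedge (\<lambda>z. f1 (cjet Y z)) (\<lambda>z. f2 (cjet Y z)) (cpoint q) \<noteq> 0"
    if q: "q \<in> ball q0 \<eta>'" and s: "0 < \<bar>s\<bar>" "\<bar>s\<bar> < \<eta>'"
      and l: "l = (of_real (s * w1), of_real (s * w2))"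
      and Y: "Y = (\<lambda>i z. X i z + quad (cpoint q0) (A l) (B l) (C l) z * \<xi> i)"
      and Y0: "f1 (cjet Y (cpoint q)) = 0" "f2 (cjet Y (cpoint q)) = 0" for q s l Y
  proof -
    have qS: "cpoint q \<in> S" using q \<eta>' by (auto simp: S_def z0_def dist_cpoint)
    \<comment> \<open>The equality holds on an open set and not only at \<open>q\<close>, so the
      differentials agree as well.\<close>
    have eq: "f (cjet Y z) = f (P (z, l))" if "f \<in> {umb_a, umb_b, umb_c}" "z \<in> S" for f z
    proof (rule fcong[OF that(1)])
      fix k i assume "k < (5::nat)"
      from cjet_quad[OF S(1) that(2) XS this] show "cjet Y z k i = P (z, l) k i"
        unfolding Y P_def by (simp add: z0_def)
    qed
    have h: "hol2 (\<lambda>z. f (P (z, l))) S" if "f \<in> {umb_a, umb_b, umb_c}" for f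
      by (rule hol4_slice[OF hf[OF that]]) simp
    note d = d12_cong[OF S(1) qS h eq]
    have "wedge (\<lambda>z. f1 (cjet Y z)) (\<lambda>z. f2 (cjet Y z)) (cpoint q)
        = wedge (\<lambda>z. f1 (P (z, l))) (\<lambda>z. f2 (P (z, l))) (cpoint q)"
      by (simp only: d[OF f(1) f(1)] d[OF f(2) f(2)])
    moreover have "f1 (P (cpoint q, l)) = 0" "f2 (P (cpoint q, l)) = 0"
      using Y0 eq[OF f(1) qS] eq[OF f(2) qS] by simp_all
    moreover have "q \<in> ball q0 \<eta>" "\<bar>s\<bar> < \<eta>" using q s \<eta>' by auto
    ultimately show ?thesis
      using w s(1) unfolding Let_def l by auto
  qed
  show ?thesis
    unfolding Let_def
    by (rule exI[of _ w1], rule exI[of _ w2], rule exI[of _ \<eta>']) (use \<eta>'(1) main in blast)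
qed

text \<open>Two equations and two coefficients are chosen according to the first of E, F, G that is
  nonzero at the centre; the Jacobian in these coefficients is then, up to sign, the square of that
  entry times \<open>D\<close>^2. The conclusion offers all three pairs because at a nearby point
  \<open>umbilic_mult\<close> may select another one.\<close>

lemma exists_good_perturbation:
  fixes \<xi> :: "3 \<Rightarrow> real"
  assumes X: "cext X x q0 r" and r: "r > 0" and umb: "umbilic_at x q0"
    and reg: "coeff_E x q0 \<noteq> 0 \<or> coeff_F x q0 \<noteq> 0 \<or> coeff_G x q0 \<noteq> 0"
    and \<xi>: "tdet (rjet x q0 0) (rjet x q0 1) \<xi> \<noteq> 0"
  shows "\<exists>\<alpha> \<beta> \<gamma> :: real. \<exists>\<eta>>0. \<forall>q\<in>ball q0 \<eta>. \<forall>s::real. 0 < \<bar>s\<bar> \<longrightarrow> \<bar>s\<bar> < \<eta> \<longrightarrow>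
     (let Y = \<lambda>i z. X i z + quad (cpoint q0) (of_real (s * \<alpha>)) (of_real (s * \<beta>)) (of_real (s * \<gamma>)) z *
         of_real (\<xi> i) in
      umb_a (cjet Y (cpoint q)) = 0 \<longrightarrow> umb_b (cjet Y (cpoint q)) = 0 \<longrightarrow> umb_c (cjet Y (cpoint q)) = 0 \<longrightarrow>
      wedge (\<lambda>z. umb_a (cjet Y z)) (\<lambda>z. umb_b (cjet Y z)) (cpoint q) \<noteq> 0 \<or>
      wedge (\<lambda>z. umb_a (cjet Y z)) (\<lambda>z. umb_c (cjet Y z)) (cpoint q) \<noteq> 0 \<or>
      wedge (\<lambda>z. umb_b (cjet Y z)) (\<lambda>z. umb_c (cjet Y z)) (cpoint q) \<noteq> 0)"
proof -
  define J where "J = cjet X (cpoint q0)"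
  define \<xi>c where "\<xi>c i = complex_of_real (\<xi> i)" for i
  have q0: "q0 \<in> ball q0 r" using r by simp
  have z: "umb_a J = 0" "umb_b J = 0" "umb_c J = 0"
    using umb_cpoint[OF X q0] umb by (simp_all add: J_def umbilic_at_def)
  define E F G D where "E = mform (J 0) (J 0)" and "F = mform (J 0) (J 1)" and "G = mform (J 1) (J 1)"
      and "D = tdet (J 0) (J 1) \<xi>c"
  have EFG: "E \<noteq> 0 \<or> F \<noteq> 0 \<or> G \<noteq> 0"
    using reg mform_cpoint[OF X q0] by (simp add: E_def F_def G_def J_def)
  have "D = of_real (tdet (rjet x q0 0) (rjet x q0 1) \<xi>)"
    using cjet_cpoint[OF X q0] by (simp add: D_def J_def tdet_def \<xi>c_def)
  then have D: "D \<noteq> 0" using \<xi> by simp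
  have cnj: "cnj (\<xi>c i) = \<xi>c i" for i by (simp add: \<xi>c_def)
  have val: "umb_a (pjet J (hjet A B C 0 0) \<xi>c) = D * (F * C - G * B)"
    "umb_b (pjet J (hjet A B C 0 0) \<xi>c) = D * (E * C - G * A)"
    "umb_c (pjet J (hjet A B C 0 0) \<xi>c) = D * (E * B - F * A)" for A B C
    using umb_pjet_origin[of J A B C \<xi>c] z by (simp_all add: E_def F_def G_def D_def)
  have m0: "(\<lambda>_. 0) \<in> {\<lambda>_. 0, fst, snd :: complex \<times> complex \<Rightarrow> complex}"
    and m1: "fst \<in> {\<lambda>_. 0, fst, snd :: complex \<times> complex \<Rightarrow> complex}"
    and m2: "snd \<in> {\<lambda>_. 0, fst, snd :: complex \<times> complex \<Rightarrow> complex}" by simp_all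
  have f: "umb_a \<in> {umb_a, umb_b, umb_c}" "umb_b \<in> {umb_a, umb_b, umb_c}" "umb_c \<in> {umb_a, umb_b, umb_c}" by simp_all
  consider "E \<noteq> 0" | "E = 0" "F \<noteq> 0" | "E = 0" "F = 0" "G \<noteq> 0" using EFG by blast
  then show ?thesis
  proof cases
    case 1
    have h: "has_d12 (\<lambda>l. umb_b (pjet J (hjet 0 (fst l) (snd l) 0 0) \<xi>c)) 0 (D * E) (0, 0)"
        "has_d12 (\<lambda>l. umb_c (pjet J (hjet 0 (fst l) (snd l) 0 0) \<xi>c)) (D * E) 0 (0, 0)"
      unfolding val by (rule has_derivative_eq_rhs, (rule derivative_intros)+, simp add: fun_eq_iff algebra_simps)+
    have "wedge (\<lambda>l. umb_b (pjet J (hjet 0 (fst l) (snd l) 0 0) \<xi>c)) (\<lambda>l.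
        umb_c (pjet J (hjet 0 (fst l) (snd l) 0 0) \<xi>c)) (0, 0) \<noteq> 0"
      unfolding has_d12_imp[OF h(1)] has_d12_imp[OF h(2)] using 1 D by simp
    from umb_direction[where A = "\<lambda>_. 0" and B = "fst" and C = "snd",
        OF X r cnj f(2) f(3) m0 m1 m2 z(2)[unfolded J_def] z(3)[unfolded J_def] this[unfolded J_def]]
    obtain w1 w2 \<eta> :: real where "\<eta> > 0" and w: "\<forall>q\<in>ball q0 \<eta>. \<forall>s::real. 0 < \<bar>s\<bar> \<longrightarrow> \<bar>s\<bar> < \<eta> \<longrightarrow>
     (let l = (of_real (s * w1), of_real (s * w2));
          Y = \<lambda>i z. X i z + quad (cpoint q0) 0 (fst l) (snd l) z * \<xi>c i in
      umb_b (cjet Y (cpoint q)) = 0 \<longrightarrow> umb_c (cjet Y (cpoint q)) = 0 \<longrightarrow>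
      wedge (\<lambda>z. umb_b (cjet Y z)) (\<lambda>z. umb_c (cjet Y z)) (cpoint q) \<noteq> 0)"
      by blast
    show ?thesis
      by (rule exI[of _ "0"], rule exI[of _ "w1"], rule exI[of _ "w2"], rule exI[of _ \<eta>])
         (use \<open>\<eta> > 0\<close> w in \<open>auto simp: Let_def \<xi>c_def\<close>)
  next
    case 2
    have h: "has_d12 (\<lambda>l. umb_a (pjet J (hjet (fst l) 0 (snd l) 0 0) \<xi>c)) 0 (D * F) (0, 0)"
        "has_d12 (\<lambda>l. umb_c (pjet J (hjet (fst l) 0 (snd l) 0 0) \<xi>c)) (- (D * F)) 0 (0, 0)"
      unfolding val 2(1) by (rule has_derivative_eq_rhs, (rule derivative_intros)+,
          simp add: fun_eq_iff algebra_simps)+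
    have "wedge (\<lambda>l. umb_a (pjet J (hjet (fst l) 0 (snd l) 0 0) \<xi>c)) (\<lambda>l.
        umb_c (pjet J (hjet (fst l) 0 (snd l) 0 0) \<xi>c)) (0, 0) \<noteq> 0"
      unfolding has_d12_imp[OF h(1)] has_d12_imp[OF h(2)] using 2 D by simp
    from umb_direction[where A = "fst" and B = "\<lambda>_. 0" and C = "snd",
        OF X r cnj f(1) f(3) m1 m0 m2 z(1)[unfolded J_def] z(3)[unfolded J_def] this[unfolded J_def]]
    obtain w1 w2 \<eta> :: real where "\<eta> > 0" and w: "\<forall>q\<in>ball q0 \<eta>. \<forall>s::real. 0 < \<bar>s\<bar> \<longrightarrow> \<bar>s\<bar> < \<eta> \<longrightarrow>
     (let l = (of_real (s * w1), of_real (s * w2));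
          Y = \<lambda>i z. X i z + quad (cpoint q0) (fst l) 0 (snd l) z * \<xi>c i in
      umb_a (cjet Y (cpoint q)) = 0 \<longrightarrow> umb_c (cjet Y (cpoint q)) = 0 \<longrightarrow>
      wedge (\<lambda>z. umb_a (cjet Y z)) (\<lambda>z. umb_c (cjet Y z)) (cpoint q) \<noteq> 0)"
      by blast
    show ?thesis
      by (rule exI[of _ "w1"], rule exI[of _ "0"], rule exI[of _ "w2"], rule exI[of _ \<eta>])
         (use \<open>\<eta> > 0\<close> w in \<open>auto simp: Let_def \<xi>c_def\<close>)
  next
    case 3
    have h: "has_d12 (\<lambda>l. umb_a (pjet J (hjet (fst l) (snd l) 0 0 0) \<xi>c)) 0 (- (D * G)) (0, 0)"
        "has_d12 (\<lambda>l. umb_b (pjet J (hjet (fst l) (snd l) 0 0 0) \<xi>c)) (- (D * G)) 0 (0, 0)"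
      unfolding val 3(1,2) by (rule has_derivative_eq_rhs, (rule derivative_intros)+,
          simp add: fun_eq_iff algebra_simps)+
    have "wedge (\<lambda>l. umb_a (pjet J (hjet (fst l) (snd l) 0 0 0) \<xi>c)) (\<lambda>l.
        umb_b (pjet J (hjet (fst l) (snd l) 0 0 0) \<xi>c)) (0, 0) \<noteq> 0"
      unfolding has_d12_imp[OF h(1)] has_d12_imp[OF h(2)] using 3 D by simp
    from umb_direction[where A = "fst" and B = "snd" and C = "\<lambda>_. 0",
        OF X r cnj f(1) f(2) m1 m2 m0 z(1)[unfolded J_def] z(2)[unfolded J_def] this[unfolded J_def]]
    obtain w1 w2 \<eta> :: real where "\<eta> > 0" and w: "\<forall>q\<in>ball q0 \<eta>. \<forall>s::real. 0 < \<bar>s\<bar> \<longrightarrow> \<bar>s\<bar> < \<eta> \<longrightarrow>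
     (let l = (of_real (s * w1), of_real (s * w2));
          Y = \<lambda>i z. X i z + quad (cpoint q0) (fst l) (snd l) 0 z * \<xi>c i in
      umb_a (cjet Y (cpoint q)) = 0 \<longrightarrow> umb_b (cjet Y (cpoint q)) = 0 \<longrightarrow>
      wedge (\<lambda>z. umb_a (cjet Y z)) (\<lambda>z. umb_b (cjet Y z)) (cpoint q) \<noteq> 0)"
      by blast
    show ?thesis
      by (rule exI[of _ "w1"], rule exI[of _ "w2"], rule exI[of _ "0"], rule exI[of _ \<eta>])
         (use \<open>\<eta> > 0\<close> w in \<open>auto simp: Let_def \<xi>c_def\<close>)
  qed
qed

lemma cext_subset: "cext X x q0 r \<Longrightarrow> s \<le> r \<Longrightarrow> cext X x q0 s"
  unfolding cext_def by (auto intro: hol2_subset)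

lemma cext_add:
  "cext X x q0 r \<Longrightarrow> cext Y y q0 r \<Longrightarrow> cext (\<lambda>i z. X i z + Y i z) (\<lambda>q. x q + y q) q0 r"
  unfolding cext_def by (auto intro: hol2_add)

lemma cext_scaleR:
  "cext X x q0 r \<Longrightarrow> cext (\<lambda>i z. of_real c * X i z) (\<lambda>q. c *\<^sub>R x q) q0 r"
  unfolding cext_def by (auto intro: hol2_mult hol2_const)

lemma cext_continuous_on: "cext X x q0 r \<Longrightarrow> continuous_on (ball q0 r) x"
  by (intro continuous_at_imp_continuous_on ballI) (rule has_derivative_continuous, erule (1) cext_has_derivative(1))

text \<open>At real points the real parts of the complex coefficients already give the
  expansion.\<close>

lemma analytic2_at_real:
  assumes H: "analytic2_at H (cpoint q)" and h: "\<forall>\<^sub>F z in nhds q. H (cpoint z) = complex_of_real (h z)"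
  shows "analytic2_at h q"
proof -
  obtain c where c: "\<forall>\<^sub>F z in nhds (cpoint q). ((\<lambda>(i, j). c i j * (fst z - fst (cpoint q))^i *
      (snd z - snd (cpoint q))^j) has_sum H z) UNIV"
    using H unfolding analytic2_at_def by blast
  have "\<forall>\<^sub>F z in nhds q. ((\<lambda>(i, j). c i j * (fst (cpoint z) - fst (cpoint q))^i * (snd (cpoint z) -
      snd (cpoint q))^j) has_sum H (cpoint z)) UNIV"
    using filterlim_cpoint c by (rule eventually_compose_filterlim[rotated])
  then have "\<forall>\<^sub>F z in nhds q. ((\<lambda>(i, j). Re (c i j) * (fst z - fst q)^i * (snd z - snd q)^j) has_sum h z) UNIV"
    using h
  proof eventually_elim
    case (elim z)
    have "((\<lambda>x. Re ((\<lambda>(i, j). c i j * (fst (cpoint z) - fst (cpoint q))^i * (snd (cpoint z) - snd (cpoint q))^j)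
        x)) has_sum Re (H (cpoint z))) UNIV"
      using has_sum_bounded_linear[OF bounded_linear_Re elim(1)] by (simp add: o_def)
    moreover have "Re (c i j * (fst (cpoint z) - fst (cpoint q))^i * (snd (cpoint z) - snd (cpoint q))^j)
        = Re (c i j) * (fst z - fst q)^i * (snd z - snd q)^j" for i j
      by (simp add: cpoint_def flip: of_real_diff of_real_power)
    ultimately show ?case using elim(2) by (simp add: case_prod_unfold)
  qed
  then show ?thesis unfolding analytic2_at_def by (rule exI[of _ "\<lambda>i j. Re (c i j)"])
qed

lemma cext_analytic2_at:
  fixes x :: "real \<times> real \<Rightarrow> real^3"
  assumes X: "cext X x q0 r" and q: "q \<in> ball q0 r"
  shows "analytic2_at (\<lambda>z. x z $ i) q"
proof (rule analytic2_at_real)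
  show "analytic2_at (X i) (cpoint q)"
    by (rule hol2_imp_analytic2_at[OF open_ball]) (use X q in \<open>auto simp: cext_def dist_cpoint\<close>)
  have "\<forall>\<^sub>F z in nhds q. z \<in> ball q0 r" by (rule eventually_nhds_in_open) (use q in auto)
  then show "\<forall>\<^sub>F z in nhds q. X i (cpoint z) = of_real (x z $ i)"
    by eventually_elim (use X in \<open>simp add: cext_def\<close>)
qed

lemma analytic2_at_cext:
  fixes x :: "real \<times> real \<Rightarrow> real^3"
  assumes "\<And>i. analytic2_at (\<lambda>z. x z $ i) q0"
  obtains X r where "r > 0" "cext X x q0 r"
proof -
  have "\<forall>i. \<exists>H r. r > 0 \<and> hol2 H (ball (cpoint q0) r) \<and> (\<forall>q\<in>ball q0 r. H (cpoint q) = of_real (x q $ i))"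
  proof
    fix i
    obtain H where H: "analytic2_at H (cpoint q0)" "\<forall>\<^sub>F z in nhds q0. H (cpoint z) = complex_of_real (x z $ i)"
      by (rule analytic2_at_complexify[OF assms])
    obtain S where S: "open S" "cpoint q0 \<in> S" "hol2 H S" by (rule analytic2_at_imp_hol2[OF H(1)])
    obtain a where a: "a > 0" "ball (cpoint q0) a \<subseteq> S" using S(1,2) open_contains_ball by blast
    obtain b where b: "b > 0" "\<forall>q. dist q q0 < b \<longrightarrow> H (cpoint q) = complex_of_real (x q $ i)"
      using H(2) unfolding eventually_nhds_metric by blast
    show "\<exists>H r. r > 0 \<and> hol2 H (ball (cpoint q0) r) \<and> (\<forall>q\<in>ball q0 r. H (cpoint q) = of_real (x q $ i))"
      by (rule exI[of _ H], rule exI[of _ "min a b"])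
         (use a b in \<open>auto intro!: hol2_subset[OF S(3)] simp: dist_commute subset_iff\<close>)
  qed
  then obtain X R where XR: "\<forall>i. R i > 0 \<and> hol2 (X i) (ball (cpoint q0) (R i))
      \<and> (\<forall>q\<in>ball q0 (R i). X i (cpoint q) = of_real (x q $ i))"
    by metis
  define r where "r = Min (range R)"
  have r: "r > 0" "r \<le> R i" for i using XR by (auto simp: r_def)
  have "cext X x q0 r"
    unfolding cext_def
  proof (intro conjI allI ballI)
    show "hol2 (X i) (ball (cpoint q0) r)" for i
      by (rule hol2_subset[of _ "ball (cpoint q0) (R i)"]) (use XR r(2)[of i] in auto)
    show "X i (cpoint q) = of_real (x q $ i)" if "q \<in> ball q0 r" for i q
      using XR r(2)[of i] that by auto
  qed
  then show ?thesis using that r(1) by blast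
qed

text \<open>Maps \<open>y0 q + t * y1 q\<close> are closed under directional derivatives in
  \<open>(q, t)\<close>: differentiating in \<open>t\<close> moves \<open>y1\<close> into the part
  free of \<open>t\<close>. The induction therefore runs over all pairs of extendable maps.\<close>

lemma cext_Ck_on:
  assumes "cext Y0 y0 q0 r" "cext Y1 y1 q0 r" "open T"
    and "\<And>p. p \<in> ball q0 r \<times> T \<Longrightarrow> f p = y0 (fst p) + snd p *\<^sub>R y1 (fst p)"
  shows "Ck_on k f (ball q0 r \<times> (T :: real set))"
  using assms
proof (induction k arbitrary: f Y0 y0 Y1 y1)
  case 0
  have "continuous_on (ball q0 r \<times> T) (\<lambda>p. y0 (fst p) + snd p *\<^sub>R y1 (fst p))"
    by (intro continuous_intros continuous_on_compose2[OF cext_continuous_on[OF 0(1)]]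
        continuous_on_compose2[OF cext_continuous_on[OF 0(2)]]) auto
  then show ?case using 0(4) by (simp cong: continuous_on_cong)
next
  case (Suc k)
  define S where "S = ball q0 r \<times> T"
  have S: "open S" using Suc.prems(3) by (auto simp: S_def open_Times)
  define L where "L p v = (fst (fst v) *\<^sub>R partial_u y0 (fst p) + snd (fst v) *\<^sub>R partial_v y0 (fst p)
      + snd v *\<^sub>R y1 (fst p))
      + snd p *\<^sub>R (fst (fst v) *\<^sub>R partial_u y1 (fst p) + snd (fst v) *\<^sub>R partial_v y1 (fst p))" for p v
  have der: "(f has_derivative L p) (at p)" if p: "p \<in> S" for p
  proof -
    have fp: "fst p \<in> ball q0 r" using p by (auto simp: S_def)
    have "(fst has_derivative fst) (at p)" by (intro has_derivative_fst has_derivative_ident)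
    from has_derivative_compose[OF this cext_has_derivative(1)[OF Suc.prems(1) fp]]
      has_derivative_compose[OF this cext_has_derivative(1)[OF Suc.prems(2) fp]]
    have "((\<lambda>p. y0 (fst p) + snd p *\<^sub>R y1 (fst p)) has_derivative L p) (at p)"
      unfolding L_def[abs_def]
      by (rule has_derivative_eq_rhs[OF has_derivative_add[OF _ has_derivative_scaleR[OF has_derivative_snd[OF
          has_derivative_ident]]]])
         (auto simp: fun_eq_iff algebra_simps)
    then show ?thesis
      by (rule has_derivative_transform_within_open[OF _ S p]) (simp add: Suc.prems(4) S_def)
  qed
  have "Ck_on k (\<lambda>p. frechet_derivative f (at p) v) S" for v
    unfolding S_def
  proof (rule Suc.IH)
    show "cext (\<lambda>i z. of_real (fst (fst v)) * d1 (Y0 i) z + of_real (snd (fst v)) * d2 (Y0 i) z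
        + of_real (snd v) * Y1 i z)
       (\<lambda>q. fst (fst v) *\<^sub>R partial_u y0 q + snd (fst v) *\<^sub>R partial_v y0 q + snd v *\<^sub>R y1 q) q0 r"
      by (intro cext_add cext_scaleR cext_partial Suc.prems)
    show "cext (\<lambda>i z. of_real (fst (fst v)) * d1 (Y1 i) z + of_real (snd (fst v)) * d2 (Y1 i) z)
       (\<lambda>q. fst (fst v) *\<^sub>R partial_u y1 q + snd (fst v) *\<^sub>R partial_v y1 q) q0 r"
      by (intro cext_add cext_scaleR cext_partial Suc.prems)
    show "frechet_derivative f (at p) v = fst (fst v) *\<^sub>R partial_u y0 (fst p)
        + snd (fst v) *\<^sub>R partial_v y0 (fst p) + snd v *\<^sub>R y1 (fst p)
        + snd p *\<^sub>R (fst (fst v) *\<^sub>R partial_u y1 (fst p) + snd (fst v) *\<^sub>R partial_v y1 (fst p))"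
      if "p \<in> ball q0 r \<times> T" for p
      using fun_cong[OF frechet_derivative_at[OF der[of p], symmetric], of v] that by (simp add: S_def L_def)
  qed (fact Suc.prems)
  moreover have "f differentiable (at p)" if "p \<in> S" for p
    by (rule differentiableI[OF der[OF that]])
  ultimately show ?case by (simp add: S_def)
qed

section \<open>Regularity of the deformed surfaces\<close>

text \<open>The perturbed map is an injective linear map \<open>D0\<close>, bounded below by
  \<open>B\<close>, plus a remainder whose derivative is at most \<open>B / 2\<close> near
  \<open>q0\<close>. The lower Lipschitz bound is uniform in \<open>t\<close>: it gives embeddings
  on one fixed disc and later confines the umbilic points to parameters near
  \<open>q0\<close>.\<close>

lemma bi_lipschitz_perturbation:
  assumes X: "cext X x q0 r" and Y: "cext Y y q0 r" and r: "r > 0"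
    and inj: "inj (\<lambda>h. fst h *\<^sub>R partial_u x q0 + snd h *\<^sub>R partial_v x q0)"
  shows "\<exists>c>0. \<exists>\<rho>>0. \<exists>\<delta>>0. \<rho> \<le> r \<and> (\<forall>t. \<bar>t\<bar> < \<delta> \<longrightarrow>
     (\<forall>p\<in>ball q0 \<rho>. \<forall>q\<in>ball q0 \<rho>. c * dist p q \<le> dist (x p + t *\<^sub>R y p) (x q + t *\<^sub>R y q)) \<and>
     (\<forall>q\<in>ball q0 \<rho>. inj (frechet_derivative (\<lambda>q. x q + t *\<^sub>R y q) (at q))))"
proof -
  define D0 where "D0 h = fst h *\<^sub>R partial_u x q0 + snd h *\<^sub>R partial_v x q0" for h :: "real \<times> real"
  have lin0: "linear D0" unfolding D0_def by (rule linearI) (auto simp: algebra_simps)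
  obtain B where B: "B > 0" "\<And>h. B * norm h \<le> norm (D0 h)"
    using linear_inj_bounded_below_pos[OF lin0] inj unfolding D0_def by blast
  have q0: "q0 \<in> ball q0 r" using r by simp
  have cont: "isCont (partial_u x) q0" "isCont (partial_v x) q0" "isCont (partial_u y) q0" "isCont (partial_v y) q0"
    using cext_continuous_on[OF cext_partial(1)[OF X]] cext_continuous_on[OF cext_partial(2)[OF X]]
      cext_continuous_on[OF cext_partial(1)[OF Y]] cext_continuous_on[OF cext_partial(2)[OF Y]] q0
    by (simp_all add: continuous_on_eq_continuous_at)
  define M where "M = norm (partial_u y q0) + norm (partial_v y q0) + 1"
  have M: "M > 0" by (auto simp: M_def intro: add_nonneg_pos)
  have ev: "\<forall>\<^sub>F q in nhds q0. g q < b" if "isCont g q0" "g q0 < b" for g :: "real \<times> real \<Rightarrow> real" and b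
    using that order_tendstoD(2)[of g "g q0" "nhds q0" b] by (simp add: isCont_def tendsto_at_iff_tendsto_nhds)
  have "\<forall>\<^sub>F q in nhds q0. norm (partial_u x q - partial_u x q0) + norm (partial_v x q - partial_v x q0) < B / 4"
    by (rule ev, intro continuous_intros cont) (use B(1) in simp)
  moreover have "\<forall>\<^sub>F q in nhds q0. norm (partial_u y q) + norm (partial_v y q) < M"
    by (rule ev, intro continuous_intros cont) (simp add: M_def)
  ultimately have "\<forall>\<^sub>F q in nhds q0. norm (partial_u x q - partial_u x q0)
      + norm (partial_v x q - partial_v x q0) < B / 4 \<and>
      norm (partial_u y q) + norm (partial_v y q) < M"
    by (rule eventually_conj)
  then obtain e where e: "e > 0" "\<forall>q. dist q q0 < e \<longrightarrow>
      norm (partial_u x q - partial_u x q0) + norm (partial_v x q - partial_v x q0) < B / 4 \<and>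
      norm (partial_u y q) + norm (partial_v y q) < M"
    unfolding eventually_nhds_metric by blast
  define \<rho> where "\<rho> = min e r"
  \<comment> \<open>Half of the allowance \<open>B / 2\<close> goes to the variation of the
    derivative of \<open>x\<close>, the other half to \<open>t\<close> times the derivative of
    \<open>y\<close>, as \<open>\<delta> * M = B / 4\<close>.\<close>
  define \<delta> where "\<delta> = B / (4 * M)"
  have pos: "\<rho> > 0" "\<delta> > 0" "\<rho> \<le> r" using e r B M by (auto simp: \<rho>_def \<delta>_def)
  define f where "f t q = x q + t *\<^sub>R y q - D0 q" for t q
  define f' where "f' t q h = fst h *\<^sub>R (partial_u x q - partial_u x q0 + t *\<^sub>R partial_u y q)
      + snd h *\<^sub>R (partial_v x q - partial_v x q0 + t *\<^sub>R partial_v y q)" for t q and h :: "real \<times> real"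
  have derx: "((\<lambda>q. x q + t *\<^sub>R y q) has_derivative (\<lambda>h. D0 h + f' t q h)) (at q)" if "q \<in> ball q0 \<rho>" for t q
  proof -
    have qr: "q \<in> ball q0 r" using that pos by auto
    show ?thesis
      by (rule has_derivative_eq_rhs[OF has_derivative_add[OF cext_has_derivative(1)[OF X qr]
              has_derivative_scaleR_right[OF cext_has_derivative(1)[OF Y qr]]]])
         (simp add: fun_eq_iff D0_def f'_def algebra_simps)
  qed
  have derf: "(f t has_derivative f' t q) (at q)" if "q \<in> ball q0 \<rho>" for t q
    unfolding f_def[abs_def]
    by (rule has_derivative_eq_rhs[OF has_derivative_diff[OF derx[OF that] linear_imp_has_derivative[OF lin0]]])
       (simp add: fun_eq_iff)
  have f'_le: "norm (f' t q h) \<le> B / 2 * norm h" if q: "q \<in> ball q0 \<rho>" and t: "\<bar>t\<bar> < \<delta>" for t q h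
  proof -
    have qe: "dist q q0 < e" using q by (auto simp: \<rho>_def dist_commute)
    have h: "\<bar>fst h\<bar> \<le> norm h" "\<bar>snd h\<bar> \<le> norm h"
      using norm_fst_le[of "fst h" "snd h"] norm_snd_le[of "snd h" "fst h"] by simp_all
    have a: "norm (partial_u x q - partial_u x q0 + t *\<^sub>R partial_u y q) \<le> norm (partial_u x q - partial_u x q0)
        + \<bar>t\<bar> * norm (partial_u y q)"
      "norm (partial_v x q - partial_v x q0 + t *\<^sub>R partial_v y q) \<le> norm (partial_v x q - partial_v x q0)
          + \<bar>t\<bar> * norm (partial_v y q)"
      by (rule norm_triangle_le, simp)+
    have "norm (f' t q h) \<le> \<bar>fst h\<bar> * norm (partial_u x q - partial_u x q0 + t *\<^sub>R partial_u y q)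
        + \<bar>snd h\<bar> * norm (partial_v x q - partial_v x q0 + t *\<^sub>R partial_v y q)"
      unfolding f'_def by (rule norm_triangle_le) simp
    also have "\<dots> \<le> norm h * (norm (partial_u x q - partial_u x q0) + \<bar>t\<bar> * norm (partial_u y q))
        + norm h * (norm (partial_v x q - partial_v x q0) + \<bar>t\<bar> * norm (partial_v y q))"
      by (intro add_mono mult_mono h a) auto
    also have "\<dots> = norm h * ((norm (partial_u x q - partial_u x q0) + norm (partial_v x q - partial_v x q0))
        + \<bar>t\<bar> * (norm (partial_u y q) + norm (partial_v y q)))"
      by (simp add: algebra_simps)
    also have "\<dots> \<le> norm h * (B / 4 + \<delta> * M)"
      using e(2)[THEN spec, THEN mp, OF qe] t by (intro mult_left_mono add_mono mult_mono) auto
    also have "\<delta> * M = B / 4" using M by (simp add: \<delta>_def)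
    finally show ?thesis by (simp add: mult.commute)
  qed
  have lip: "B / 2 * dist p q \<le> dist (x p + t *\<^sub>R y p) (x q + t *\<^sub>R y q)"
    if t: "\<bar>t\<bar> < \<delta>" and p: "p \<in> ball q0 \<rho>" and q: "q \<in> ball q0 \<rho>" for t p q
  proof -
    have "norm (f t p - f t q) \<le> B / 2 * norm (p - q)"
    proof (rule differentiable_bound[OF convex_ball _ _ p q])
      show "(f t has_derivative f' t z) (at z within ball q0 \<rho>)" if "z \<in> ball q0 \<rho>" for z
        by (rule has_derivative_at_withinI[OF derf[OF that]])
      show "onorm (f' t z) \<le> B / 2" if "z \<in> ball q0 \<rho>" for z
        by (rule onorm_bound) (use B f'_le[OF that t] in auto)
    qed
    moreover have "(x p + t *\<^sub>R y p) - (x q + t *\<^sub>R y q) = D0 (p - q) + (f t p - f t q)"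
      by (simp add: f_def linear_diff[OF lin0])
    moreover have "norm (D0 (p - q)) - norm (f t p - f t q) \<le> norm (D0 (p - q) + (f t p - f t q))"
      by (rule norm_diff_ineq)
    ultimately show ?thesis using B(2)[of "p - q"] by (simp add: dist_norm)
  qed
  have injD: "inj (frechet_derivative (\<lambda>q. x q + t *\<^sub>R y q) (at q))" if t: "\<bar>t\<bar> < \<delta>" and q: "q \<in> ball q0 \<rho>" for t q
  proof -
    have eq: "frechet_derivative (\<lambda>q. x q + t *\<^sub>R y q) (at q) = (\<lambda>h. D0 h + f' t q h)"
      using frechet_derivative_at[OF derx[OF q]] by simp
    have lin: "linear (\<lambda>h. D0 h + f' t q h)" using has_derivative_linear[OF derx[OF q]] .
    have "h = 0" if "D0 h + f' t q h = 0" for h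
    proof -
      have "D0 h = - f' t q h" using that by (simp add: eq_neg_iff_add_eq_0)
      then have "B * norm h \<le> B / 2 * norm h" using B(2)[of h] f'_le[OF q t, of h] by simp
      then show ?thesis using B(1) by (simp add: mult_le_cancel_right)
    qed
    then show ?thesis unfolding eq using linear_injective_0[OF lin] by blast
  qed
  show ?thesis
    by (rule exI[of _ "B / 2"], rule conjI, use B in simp, rule exI[of _ \<rho>], rule conjI, use pos in simp,
        rule exI[of _ \<delta>]) (use pos lip injD in blast)
qed

lemma cross3_nonzero:
  fixes u v :: "real^3"
  assumes "inj (\<lambda>h :: real \<times> real. fst h *\<^sub>R u + snd h *\<^sub>R v)"
  shows "cross3 u v \<noteq> 0"
proof
  assume "cross3 u v = 0"
  then have "collinear {0, u, v}" by (simp add: cross_eq_0)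
  then consider "u = 0" | "v = 0" | c where "v = c *\<^sub>R u" using collinear_lemma by metis
  then have "\<exists>h :: real \<times> real. h \<noteq> 0 \<and> fst h *\<^sub>R u + snd h *\<^sub>R v = 0"
  proof cases
    case 1
    then show ?thesis by (intro exI[of _ "(1, 0)"]) (simp add: zero_prod_def)
  next
    case 2
    then show ?thesis by (intro exI[of _ "(0, 1)"]) (simp add: zero_prod_def)
  next
    case 3
    then show ?thesis by (intro exI[of _ "(- c, 1)"]) (simp add: zero_prod_def)
  qed
  then obtain h :: "real \<times> real" where "h \<noteq> 0" "fst h *\<^sub>R u + snd h *\<^sub>R v = fst 0 *\<^sub>R u + snd 0 *\<^sub>R v" by auto
  with injD[OF assms, of h 0] show False by simp
qed

text \<open>A form of signature (2, 1) has no totally isotropic plane. In coordinates, Lagrange's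
  identity makes the third component of the cross product vanish, and the squares of the other two
  components equal its square.\<close>

lemma mink_nondegenerate:
  assumes "mink u u = 0" "mink u v = 0" "mink v v = 0"
  shows "cross3 u v = 0"
proof -
  have real: "a * e - b * d = 0 \<and> b * f - c * e = 0 \<and> c * d - a * f = 0"
    if h1: "a * a + b * b = c * c" and h2: "a * d + b * e = c * f" and h3: "d * d + e * e = f * f"
        for a b c d e f :: real
  proof -
    have "(a * e - b * d)^2 = (a * a + b * b) * (d * d + e * e) - (a * d + b * e)^2"
      by (simp add: power2_eq_square algebra_simps)
    also have "\<dots> = 0" unfolding h1 h2 h3 by (simp add: power2_eq_square)
    finally have k: "(a * e - b * d)^2 = 0" .
    have "(b * f - c * e)^2 = b * b * (f * f) + c * c * (e * e) - 2 * (b * e) * (c * f)"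
      by (simp add: power2_eq_square algebra_simps)
    also have "\<dots> = (a * e - b * d)^2"
      unfolding h1[symmetric] h2[symmetric] h3[symmetric] by (simp add: power2_eq_square algebra_simps)
    finally have k1: "(b * f - c * e)^2 = 0" using k by simp
    have "(c * d - a * f)^2 = a * a * (f * f) + c * c * (d * d) - 2 * (a * d) * (c * f)"
      by (simp add: power2_eq_square algebra_simps)
    also have "\<dots> = (a * e - b * d)^2"
      unfolding h1[symmetric] h2[symmetric] h3[symmetric] by (simp add: power2_eq_square algebra_simps)
    finally have "(c * d - a * f)^2 = 0" using k by simp
    then show ?thesis using k k1 by simp
  qed
  have e: "u$1 * u$1 + u$2 * u$2 = u$3 * u$3" "u$1 * v$1 + u$2 * v$2 = u$3 * v$3" "v$1 * v$1 + v$2 * v$2 = v$3 * v$3"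
    using assms unfolding mink_def by linarith+
  show ?thesis
    using real[OF e] by (simp add: cross3_def vec_eq_iff forall_3)
qed

lemma cext_regular:
  assumes X: "cext X x q0 r" and q: "q \<in> ball q0 r" and inj: "inj (frechet_derivative x (at q))"
  shows "coeff_E x q \<noteq> 0 \<or> coeff_F x q \<noteq> 0 \<or> coeff_G x q \<noteq> 0"
    and "inj (\<lambda>h. fst h *\<^sub>R partial_u x q + snd h *\<^sub>R partial_v x q)"
proof -
  show i: "inj (\<lambda>h. fst h *\<^sub>R partial_u x q + snd h *\<^sub>R partial_v x q)"
    using inj frechet_derivative_at[OF cext_has_derivative(1)[OF X q]] by simp
  show "coeff_E x q \<noteq> 0 \<or> coeff_F x q \<noteq> 0 \<or> coeff_G x q \<noteq> 0"
    using cross3_nonzero[OF i] mink_nondegenerate unfolding coeff_E_def coeff_F_def coeff_G_def by blast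
qed

theorem theorem3p10:
  fixes M :: "(real^3) set" and p0 :: "real^3"
  assumes "regular_analytic_surface M"
    and "p0 \<in> M"
    and "umbilic_point M p0"
  shows "\<exists>U \<delta> x. local_deformation M p0 U \<delta> x \<and>
           (\<exists>W \<epsilon>. open W \<and> p0 \<in> W \<and> 0 < \<epsilon> \<and> \<epsilon> \<le> \<delta> \<and>
              (\<forall>t q. 0 < \<bar>t\<bar> \<and> \<bar>t\<bar> < \<epsilon> \<and> q \<in> U \<and> x t q \<in> W \<and> umbilic_at (x t) q
                 \<longrightarrow> umbilic_mult (x t) q = 1))"
proof -
  obtain U0 x q0 where par: "local_parametrisation M U0 x" and q0: "q0 \<in> U0" "x q0 = p0" and umb: "umbilic_at x q0"
    using assms(3) unfolding umbilic_point_def by blast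
  have U0: "open U0" "\<And>q i. q \<in> U0 \<Longrightarrow> analytic2_at (\<lambda>z. x z $ i) q" "inj (frechet_derivative x (at q0))"
    and hom: "\<exists>g. homeomorphism U0 (x ` U0) x g" and opn: "openin (top_of_set M) (x ` U0)"
    using par q0 unfolding local_parametrisation_def analytic_parametrisation_def by blast+
  obtain X r0 where r0: "r0 > 0" "cext X x q0 r0"
    by (rule analytic2_at_cext[OF U0(2)[OF q0(1)]])
  obtain r1 where r1: "r1 > 0" "ball q0 r1 \<subseteq> U0" using U0(1) q0(1) open_contains_ball by blast
  define r where "r = min r0 r1"
  have r: "r > 0" "r \<le> r0" "ball q0 r \<subseteq> U0" using r0 r1 by (auto simp: r_def)
  have X: "cext X x q0 r" by (rule cext_subset[OF r0(2) r(2)])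
  have q0r: "q0 \<in> ball q0 r" using r by simp
  note reg = cext_regular[OF X q0r U0(3)]
  \<comment> \<open>The Euclidean cross product rather than the Minkowski one: the determinant of
    the tangent vectors and \<open>\<xi>\<close> is then a Euclidean square norm, nonzero also where
    the metric is degenerate. The Minkowski normal would be tangent to the surface there.\<close>
  define \<xi> where "\<xi> = cross3 (partial_u x q0) (partial_v x q0)"
  have \<xi>: "\<xi> \<noteq> 0" unfolding \<xi>_def by (rule cross3_nonzero[OF reg(2)])
  have tdet: "tdet (rjet x q0 0) (rjet x q0 1) (($) \<xi>) \<noteq> 0"
  proof -
    have "tdet (rjet x q0 0) (rjet x q0 1) (($) \<xi>) = \<xi> $ 1 * \<xi> $ 1 + \<xi> $ 2 * \<xi> $ 2 + \<xi> $ 3 * \<xi> $ 3"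
      by (simp add: \<xi>_def tdet_def rjet_def cross3_def)
    also have "\<dots> = \<xi> \<bullet> \<xi>" by (simp add: inner_vec_def sum_3)
    finally show ?thesis using \<xi> by simp
  qed
  obtain \<alpha> \<beta> \<gamma> \<eta> :: real where \<eta>: "\<eta> > 0" and good: "\<forall>q\<in>ball q0 \<eta>. \<forall>s::real. 0 < \<bar>s\<bar> \<longrightarrow> \<bar>s\<bar> < \<eta> \<longrightarrow>
     (let Y = \<lambda>i z. X i z + quad (cpoint q0) (of_real (s * \<alpha>)) (of_real (s * \<beta>)) (of_real (s * \<gamma>)) z *
         of_real (\<xi> $ i) in
      umb_a (cjet Y (cpoint q)) = 0 \<longrightarrow> umb_b (cjet Y (cpoint q)) = 0 \<longrightarrow> umb_c (cjet Y (cpoint q)) = 0 \<longrightarrow>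
      wedge (\<lambda>z. umb_a (cjet Y z)) (\<lambda>z. umb_b (cjet Y z)) (cpoint q) \<noteq> 0 \<or>
      wedge (\<lambda>z. umb_a (cjet Y z)) (\<lambda>z. umb_c (cjet Y z)) (cpoint q) \<noteq> 0 \<or>
      wedge (\<lambda>z. umb_b (cjet Y z)) (\<lambda>z. umb_c (cjet Y z)) (cpoint q) \<noteq> 0)"
    using exists_good_perturbation[OF X r(1) umb reg(1) tdet] by blast
  define y where "y q = (\<alpha> * (fst q - fst q0)^2 * (1/2) + \<beta> * (fst q - fst q0) * (snd q - snd q0)
      + \<gamma> * (snd q - snd q0)^2 * (1/2)) *\<^sub>R \<xi>" for q
  define Y where "Y i z = quad (cpoint q0) (of_real \<alpha>) (of_real \<beta>) (of_real \<gamma>) z * complex_of_real (\<xi> $ i)" for i z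
  have Y: "cext Y y q0 r"
    unfolding cext_def
  proof (intro conjI allI ballI)
    show "hol2 (Y i) (ball (cpoint q0) r)" for i
      unfolding Y_def by (intro hol2_mult hol2_const) (rule hol2I, rule has_d12_quad)
    show "Y i (cpoint q) = of_real (y q $ i)" for i q
      by (simp add: Y_def y_def quad_def cpoint_def)
  qed
  define xt where "xt t q = x q + t *\<^sub>R y q" for t q
  define Xt where "Xt t i z = X i z + complex_of_real t * Y i z" for t i z
  have Xt: "cext (Xt t) (xt t) q0 r" for t
    unfolding Xt_def xt_def by (intro cext_add cext_scaleR X Y)
  have Xt_eq: "Xt s = (\<lambda>i z. X i z + quad (cpoint q0) (of_real (s * \<alpha>)) (of_real (s * \<beta>)) (of_real (s * \<gamma>)) z *
      of_real (\<xi> $ i))" for s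
    by (simp add: fun_eq_iff Xt_def Y_def quad_def algebra_simps)
  obtain c \<rho> \<delta> where c: "c > 0" and \<rho>: "\<rho> > 0" "\<rho> \<le> r" and \<delta>: "\<delta> > 0" and lip: "\<forall>t. \<bar>t\<bar> < \<delta> \<longrightarrow>
     (\<forall>p\<in>ball q0 \<rho>. \<forall>q\<in>ball q0 \<rho>. c * dist p q \<le> dist (xt t p) (xt t q)) \<and>
     (\<forall>q\<in>ball q0 \<rho>. inj (frechet_derivative (xt t) (at q)))"
    using bi_lipschitz_perturbation[OF X Y r(1) reg(2)] unfolding xt_def by blast
  define U where "U = ball q0 \<rho>"
  have Ur: "U \<subseteq> ball q0 r" using \<rho> by (auto simp: U_def)
  have UU0: "U \<subseteq> U0" using Ur r(3) by blast
  have xt0: "xt 0 = x" by (simp add: xt_def fun_eq_iff)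
  \<comment> \<open>The quadratic form vanishes at \<open>q0\<close>, so all surfaces of the family
    pass through \<open>p0\<close>.\<close>
  have xtq0: "xt t q0 = p0" for t using q0(2) by (simp add: xt_def y_def)
  have par_t: "analytic_parametrisation U (xt t)" if t: "\<bar>t\<bar> < \<delta>" for t
    unfolding analytic_parametrisation_def
  proof (intro conjI ballI allI)
    show "open U" by (simp add: U_def)
    show "analytic2_at (\<lambda>z. xt t z $ i) q" if "q \<in> U" for q i
      using cext_analytic2_at[OF Xt] that Ur by blast
    show "inj (frechet_derivative (xt t) (at q))" if "q \<in> U" for q
      using lip t that by (auto simp: U_def)
    have L: "c * dist p q \<le> dist (xt t p) (xt t q)" if "p \<in> U" "q \<in> U" for p q
      using lip t that by (auto simp: U_def)
    have injU: "inj_on (xt t) U"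
    proof (rule inj_onI)
      fix p q assume pq: "p \<in> U" "q \<in> U" "xt t p = xt t q"
      then have "c * dist p q \<le> 0" using L[of p q] by simp
      then show "p = q" using c by (simp add: mult_le_0_iff)
    qed
    have "homeomorphism U (xt t ` U) (xt t) (inv_into U (xt t))"
    proof (rule homeomorphismI)
      show "continuous_on U (xt t)" by (rule continuous_on_subset[OF cext_continuous_on[OF Xt] Ur])
      show "continuous_on (xt t ` U) (inv_into U (xt t))"
        unfolding continuous_on_iff
      proof (intro ballI allI impI)
        fix a and e :: real assume a: "a \<in> xt t ` U" and e: "e > 0"
        show "\<exists>d>0. \<forall>b\<in>xt t ` U. dist b a < d \<longrightarrow> dist (inv_into U (xt t) b) (inv_into U (xt t) a) < e"
        proof (intro exI[of _ "c * e"] conjI ballI impI)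
          show "c * e > 0" using c e by simp
          fix b assume b: "b \<in> xt t ` U" "dist b a < c * e"
          have "c * dist (inv_into U (xt t) b) (inv_into U (xt t) a) \<le> dist b a"
            using L[OF inv_into_into[OF b(1)] inv_into_into[OF a]] f_inv_into_f[OF a] f_inv_into_f[OF b(1)] by simp
          then have "c * dist (inv_into U (xt t) b) (inv_into U (xt t) a) < c * e" using b(2) by simp
          then show "dist (inv_into U (xt t) b) (inv_into U (xt t) a) < e" using c by simp
        qed
      qed
    qed (use injU in \<open>auto intro: inv_into_into f_inv_into_f simp: inv_into_f_f\<close>)
    then show "\<exists>g. homeomorphism U (xt t ` U) (xt t) g" by blast
  qed
  have "openin (top_of_set M) (x ` U)"
  proof -
    obtain g where g: "homeomorphism U0 (x ` U0) x g" using hom by blast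
    have "openin (top_of_set U0) U" using UU0 by (simp add: U_def open_openin_trans U0(1) open_subset)
    from homeomorphism_imp_open_map[OF g this] have "openin (top_of_set (x ` U0)) (x ` U)" .
    then show ?thesis using opn by (rule openin_trans)
  qed
  then have "local_parametrisation M U (xt 0)"
    using par_t[of 0] \<delta> by (simp add: local_parametrisation_def xt0)
  moreover have "p0 \<in> xt 0 ` U"
    using xtq0[of 0] \<rho> by (force simp: U_def)
  moreover have "smooth_on (\<lambda>(q, t). xt t q) (U \<times> {-\<delta><..<\<delta>})"
    unfolding smooth_on_def U_def
    by (intro allI cext_Ck_on[OF cext_subset[OF X \<rho>(2)] cext_subset[OF Y \<rho>(2)]]) (auto simp: xt_def)
  ultimately have deform: "local_deformation M p0 U \<delta> xt"
    using \<delta> par_t by (simp add: local_deformation_def)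
  define \<eta>' where "\<eta>' = min \<eta> \<rho>"
  define \<epsilon> where "\<epsilon> = min \<delta> \<eta>"
  \<comment> \<open>Since \<open>xt t q0 = p0\<close>, the lower Lipschitz bound turns membership of
    \<open>xt t q\<close> in this ball into \<open>dist q0 q < \<eta>'\<close>, for all small
    \<open>t\<close> at once. This makes the neighbourhood independent of \<open>t\<close>.\<close>
  define W where "W = ball p0 (c * \<eta>')"
  have main: "umbilic_mult (xt t) q = 1"
    if t: "0 < \<bar>t\<bar>" "\<bar>t\<bar> < \<epsilon>" and q: "q \<in> U" "xt t q \<in> W" and u: "umbilic_at (xt t) q" for t q
  proof -
    have td: "\<bar>t\<bar> < \<delta>" "\<bar>t\<bar> < \<eta>" using t by (auto simp: \<epsilon>_def)
    have "c * dist q0 q \<le> dist (xt t q0) (xt t q)"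
      using lip td(1) q(1) \<rho> by (auto simp: U_def)
    also have "\<dots> < c * \<eta>'" using q(2) by (simp add: W_def xtq0)
    finally have "q \<in> ball q0 \<eta>" using c by (simp add: \<eta>'_def)
    have qr: "q \<in> ball q0 r" using q(1) Ur by blast
    have reg_t: "coeff_E (xt t) q \<noteq> 0 \<or> coeff_F (xt t) q \<noteq> 0 \<or> coeff_G (xt t) q \<noteq> 0"
      by (rule cext_regular(1)[OF Xt qr]) (use lip td q in \<open>auto simp: U_def\<close>)
    show ?thesis
    proof (rule umbilic_mult_eq_1[OF Xt qr u reg_t])
      have "umb_a (cjet (Xt t) (cpoint q)) = 0" "umb_b (cjet (Xt t) (cpoint q)) = 0"
          "umb_c (cjet (Xt t) (cpoint q)) = 0"
        using u umb_cpoint[OF Xt qr] by (simp_all add: umbilic_at_def)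
      moreover note good[unfolded Let_def, rule_format, OF \<open>q \<in> ball q0 \<eta>\<close> t(1) td(2), folded Xt_eq]
      ultimately show "wedge (\<lambda>z. umb_a (cjet (Xt t) z)) (\<lambda>z. umb_b (cjet (Xt t) z)) (cpoint q) \<noteq> 0 \<or>
        wedge (\<lambda>z. umb_a (cjet (Xt t) z)) (\<lambda>z. umb_c (cjet (Xt t) z)) (cpoint q) \<noteq> 0 \<or>
        wedge (\<lambda>z. umb_b (cjet (Xt t) z)) (\<lambda>z. umb_c (cjet (Xt t) z)) (cpoint q) \<noteq> 0"
        by blast
    qed
  qed
  have "open W" "p0 \<in> W" "0 < \<epsilon>" "\<epsilon> \<le> \<delta>"
    using c \<eta> \<rho> \<delta> by (auto simp: W_def \<eta>'_def \<epsilon>_def)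
  with deform main show ?thesis by blast
qed

end
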